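(* Let $S=k[x_1,\ldots,x_n]$ be a polynomial ring over a field $k$. Let $u=x_1x_{i_2}x_{i_3}$ ($1<i_2<i_3\le n$) and $v=x_{j_1}x_{j_2}x_{j_3}$ ($j_1<j_2<j_3\le n$), where $j_1\geq 2$, be two squarefree monomials of degree $3$ and $I=(L(u,v))$ the squarefree lexsegment ideal determined by them. Then: (a) $\mathrm{depth}(S/I)=2$ if $x_{i_2-1}x_{i_3-1}x_n\geq_{lex} v$. (b) $\mathrm{depth}(S/I)=4$ if either $i_2=4$, $i_3\geq 6$ and $j_1=2$, $j_2=3$, $j_3<i_3-1$; or $i_2\geq 5$ and $j_1=2$, $j_2=3$, $i_2-1\leq j_3\leq n-1$. (c) $\mathrm{depth}(S/I)=i_2-j_3+3$ if $i_2>4$, $j_1=2$, $j_2=3$ and $j_3\leq i_2-1$. (d) $\mathrm{depth}(S/I)=3$ in all the other cases.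
   Context: Monomials are ordered by the lexicographic order with $x_1>x_2>\cdots>x_n$. For squarefree monomials $u\geq_{lex}v$ of degree $3$, $L(u,v)=\{w: w\text{ a squarefree monomial of degree }3,\ u\geq_{lex}w\geq_{lex}v\}$, and $(L(u,v))$ is the squarefree lexsegment ideal determined by $u,v$. Depth is taken with respect to the graded maximal ideal $(x_1,\ldots,x_n)$. *)

theory Defs
  imports
    "HOL-Algebra.Module"
    "HOL-Algebra.QuotRing"
    "HOL-Library.Poly_Mapping"
    "HOL-Library.Extended_Nat"
begin

section \<open>Regular sequences and depth\<close>

text \<open>The quotient ring \<open>R Quot I\<close>, regarded as a module over \<open>R\<close>.\<close>

definition quot_module :: "('a, 'b) ring_scheme \<Rightarrow> 'a set \<Rightarrow> ('a, 'a set) module" where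
  "quot_module R I =
     \<lparr>carrier = carrier (R Quot I),
      mult = mult (R Quot I),
      one = one (R Quot I),
      zero = zero (R Quot I),
      add = add (R Quot I),
      smult = (\<lambda>r X. (I +>\<^bsub>R\<^esub> r) \<otimes>\<^bsub>R Quot I\<^esub> X)\<rparr>"

lemma (in cring) quot_module_module:
  assumes "ideal I R"
  shows "Module.module R (quot_module R I)"
proof -
  interpret I: ideal I R by fact
  have hom: "(+>) I \<in> ring_hom R (R Quot I)"
    by (rule I.rcos_ring_hom)
  have Q: "cring (R Quot I)"
    using I.quotient_is_cring is_cring by blast
  then interpret Q: cring "R Quot I" .
  have ag: "abelian_group (quot_module R I)"
    by (rule abelian_groupI)
      (auto simp: quot_module_def Q.a_ac intro: bexI Q.l_neg)
  have cl: "I +> a \<in> carrier (R Quot I)" if "a \<in> carrier R" for a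
    using hom that by (rule ring_hom_closed)
  show ?thesis
  proof (rule Module.moduleI)
    show "cring R" ..
    show "abelian_group (quot_module R I)" by (rule ag)
  qed (auto simp: quot_module_def cl ring_hom_add[OF hom] ring_hom_mult[OF hom]
        ring_hom_one[OF hom] Q.l_distr Q.r_distr Q.m_assoc)
qed

text \<open>The submodule \<open>(f\<^sub>1, \<dots>, f\<^sub>r) M\<close>; it is zero for the empty sequence.\<close>

definition seq_submodule :: "('a, 'm, 'e) module_scheme \<Rightarrow> 'a list \<Rightarrow> 'm set" where
  "seq_submodule M fs =
     {\<Oplus>\<^bsub>M\<^esub>i\<in>{..<length fs}. fs ! i \<odot>\<^bsub>M\<^esub> g i | g. g \<in> {..<length fs} \<rightarrow> carrier M}"

text \<open>
  An \<open>M\<close>-regular sequence: each \<open>f\<^sub>i\<close> is a nonzerodivisor on \<open>M / (f\<^sub>1, \<dots>, f\<^sub>i\<^sub>-\<^sub>1) M\<close>,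
  and \<open>(f\<^sub>1, \<dots>, f\<^sub>r) M \<noteq> M\<close>.
\<close>

definition regular_sequence ::
    "('a, 'b) ring_scheme \<Rightarrow> ('a, 'm, 'e) module_scheme \<Rightarrow> 'a list \<Rightarrow> bool" where
  "regular_sequence R M fs \<longleftrightarrow>
     set fs \<subseteq> carrier R \<and>
     (\<forall>i < length fs. \<forall>x \<in> carrier M.
        fs ! i \<odot>\<^bsub>M\<^esub> x \<in> seq_submodule M (take i fs) \<longrightarrow> x \<in> seq_submodule M (take i fs)) \<and>
     seq_submodule M fs \<noteq> carrier M"

text \<open>
  The depth of \<open>M\<close> with respect to an ideal \<open>J\<close>: the supremum of the lengths of the
  \<open>M\<close>-regular sequences consisting of elements of \<open>J\<close>.
\<close>

definition depth ::
    "('a, 'b) ring_scheme \<Rightarrow> 'a set \<Rightarrow> ('a, 'm, 'e) module_scheme \<Rightarrow> enat" where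
  "depth R J M = Sup {enat (length fs) | fs. set fs \<subseteq> J \<and> regular_sequence R M fs}"


section \<open>Polynomials in \<open>x\<^sub>1, \<dots>, x\<^sub>n\<close>\<close>

text \<open>
  A monomial is its exponent vector, of type \<^typ>\<open>nat \<Rightarrow>\<^sub>0 nat\<close>; a polynomial maps
  monomials to coefficients, with the convolution product of the library. Variables are
  indexed from 1.
\<close>

definition poly_ring :: "nat \<Rightarrow> ((nat \<Rightarrow>\<^sub>0 nat) \<Rightarrow>\<^sub>0 'k::comm_ring_1) ring" where
  "poly_ring n =
     \<lparr>carrier = {p. \<forall>w \<in> Poly_Mapping.keys p. Poly_Mapping.keys w \<subseteq> {1..n}},
      mult = (*), one = 1, zero = 0, add = (+)\<rparr>"

lemma poly_ring_cring: "cring (poly_ring n)"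
proof (rule cringI)
  show "abelian_group (poly_ring n)"
  proof (rule abelian_groupI)
    fix x :: "(nat \<Rightarrow>\<^sub>0 nat) \<Rightarrow>\<^sub>0 'k::comm_ring_1"
    assume "x \<in> carrier (poly_ring n)"
    then show "\<exists>y\<in>carrier (poly_ring n). y \<oplus>\<^bsub>poly_ring n\<^esub> x = \<zero>\<^bsub>poly_ring n\<^esub>"
      by (intro bexI[of _ "- x"]) (auto simp: poly_ring_def)
  next
    fix x y :: "(nat \<Rightarrow>\<^sub>0 nat) \<Rightarrow>\<^sub>0 'k::comm_ring_1"
    assume "x \<in> carrier (poly_ring n)" "y \<in> carrier (poly_ring n)"
    then show "x \<oplus>\<^bsub>poly_ring n\<^esub> y \<in> carrier (poly_ring n)"
      using Poly_Mapping.keys_add[of x y] by (fastforce simp: poly_ring_def)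
  qed (auto simp: poly_ring_def add_ac)
  show "Group.comm_monoid (poly_ring n)"
  proof (rule comm_monoidI)
    fix x y :: "(nat \<Rightarrow>\<^sub>0 nat) \<Rightarrow>\<^sub>0 'k::comm_ring_1"
    assume xy: "x \<in> carrier (poly_ring n)" "y \<in> carrier (poly_ring n)"
    have "Poly_Mapping.keys w \<subseteq> {1..n}" if w: "w \<in> Poly_Mapping.keys (x * y)" for w
    proof -
      obtain a b where "w = a + b" "a \<in> Poly_Mapping.keys x" "b \<in> Poly_Mapping.keys y"
        using Poly_Mapping.keys_mult[of x y] w by blast
      then show ?thesis
        using xy Poly_Mapping.keys_add[of a b] by (fastforce simp: poly_ring_def)
    qed
    then show "x \<otimes>\<^bsub>poly_ring n\<^esub> y \<in> carrier (poly_ring n)"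
      by (auto simp: poly_ring_def)
  qed (auto simp: poly_ring_def mult_ac)
qed (auto simp: poly_ring_def algebra_simps)

definition monom :: "(nat \<Rightarrow>\<^sub>0 nat) \<Rightarrow> (nat \<Rightarrow>\<^sub>0 nat) \<Rightarrow>\<^sub>0 'k::comm_ring_1" where
  "monom w = Poly_Mapping.single w 1"

definition graded_max_ideal :: "nat \<Rightarrow> ((nat \<Rightarrow>\<^sub>0 nat) \<Rightarrow>\<^sub>0 'k::comm_ring_1) set" where
  "graded_max_ideal n = Idl\<^bsub>poly_ring n\<^esub> {monom (Poly_Mapping.single i 1) | i. i \<in> {1..n}}"


section \<open>Squarefree lexsegment ideals\<close>

text \<open>
  The library's linear order on exponent vectors is the lexicographic order with
  \<open>x\<^sub>1 > x\<^sub>2 > \<dots>\<close>, so \<open>u \<ge>\<^sub>l\<^sub>e\<^sub>x v\<close> is written \<open>v \<le> u\<close>.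
\<close>

lemma lex_less_iff:
  fixes v u :: "nat \<Rightarrow>\<^sub>0 nat"
  shows "v < u \<longleftrightarrow>
    (\<exists>k. Poly_Mapping.lookup v k < Poly_Mapping.lookup u k \<and>
         (\<forall>k' < k. Poly_Mapping.lookup v k' = Poly_Mapping.lookup u k'))"
  by (simp add: less_poly_mapping.rep_eq less_fun_def)

definition squarefree_monomials :: "nat \<Rightarrow> nat \<Rightarrow> (nat \<Rightarrow>\<^sub>0 nat) set" where
  "squarefree_monomials n d =
     {w. Poly_Mapping.keys w \<subseteq> {1..n} \<and>
         (\<forall>i. Poly_Mapping.lookup w i \<le> 1) \<and>
         (\<Sum>i\<in>Poly_Mapping.keys w. Poly_Mapping.lookup w i) = d}"

definition mon3 :: "nat \<Rightarrow> nat \<Rightarrow> nat \<Rightarrow> nat \<Rightarrow>\<^sub>0 nat" where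
  "mon3 a b c = Poly_Mapping.single a 1 + Poly_Mapping.single b 1 + Poly_Mapping.single c 1"

definition lexsegment :: "nat \<Rightarrow> (nat \<Rightarrow>\<^sub>0 nat) \<Rightarrow> (nat \<Rightarrow>\<^sub>0 nat) \<Rightarrow> (nat \<Rightarrow>\<^sub>0 nat) set" where
  "lexsegment n u v = {w \<in> squarefree_monomials n 3. v \<le> w \<and> w \<le> u}"

definition lexsegment_ideal ::
    "nat \<Rightarrow> (nat \<Rightarrow>\<^sub>0 nat) \<Rightarrow> (nat \<Rightarrow>\<^sub>0 nat) \<Rightarrow> ((nat \<Rightarrow>\<^sub>0 nat) \<Rightarrow>\<^sub>0 'k::comm_ring_1) set" where
  "lexsegment_ideal n u v = Idl\<^bsub>poly_ring n\<^esub> (monom ` lexsegment n u v)"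

end

theory Submission
  imports Defs
begin

text \<open>
  The ideal \<open>I\<close> is squarefree, so a monomial lies outside \<open>I\<close> exactly when its support is a face of
  the simplicial complex \<open>\<Delta>\<close> of all subsets of \<open>{1..n}\<close> that contain no triple of the segment.
  Everything about the depth of \<open>S/I\<close> is read off from \<open>\<Delta>\<close>; the two bounds need different
  certificates, and both certificates work over every field.

  \<^emph>\<open>Lower bound.\<close> If \<open>\<Delta>\<close> can be built from the empty family by adding intervals \<open>[R, F]\<close> of faces
  with \<open>card F \<ge> r\<close>, every intermediate stage being a complex (\<open>shelled r \<Delta>\<close>), then \<open>S/I\<close> has a
  filtration whose quotients are polynomial rings \<open>k[F]\<close> in at least \<open>r\<close> variables. The elementary
  symmetric polynomials, taken in the order \<open>e\<^sub>r, \<dots>, e\<^sub>1\<close>, form a regular sequence on each of these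
  rings at once, and a sequence that is regular on the ends of a short exact sequence is regular in
  the middle. So depth is at least \<open>r\<close> (\<open>weakly_regular_esyms\<close>). Linear forms could not serve here,
  because over a small field no fixed linear forms restrict well to all faces.

  \<^emph>\<open>Upper bound.\<close> For a regular sequence of length \<open>r\<close> in the maximal ideal, the Koszul cohomology
  of \<open>S/I\<close> on the squares of the variables vanishes in degrees below \<open>r\<close> (\<open>koszul_acyclic\<close>). In the
  multidegree of a face \<open>F\<close> this cohomology contains the reduced cohomology of the link of \<open>F\<close>, so a
  nonzero class in degree \<open>q - 1\<close> of that link bounds the depth by \<open>card F + q\<close>
  (\<open>link_coboundary\<close>). Three shapes of this bound suffice: a facet \<open>F\<close> (\<open>q = 0\<close>), a
  disconnected link (\<open>q = 1\<close>), and a loop in \<open>\<Delta>\<close> itself that carries a nonzero class (\<open>q = 2\<close>).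

  \<^emph>\<open>The segment.\<close> All pairs are faces, so depth is at least 2. If \<open>x\<^bsub>i2-1\<^esub> x\<^bsub>i3-1\<^esub> x\<^sub>n \<ge> v\<close>, the
  edges that join \<open>{i2..i3-1}\<close> to \<open>{i3..n}\<close> carry a nonzero class on the loop \<open>1, i2, i3\<close> and
  depth is 2. Otherwise the triangle \<open>i2-1, i3-1, n\<close> is a face; it attaches one of these edges, and
  through it all the others can be attached, so the 2-skeleton is shellable and depth is at least 3. If
  \<open>x\<^sub>2x\<^sub>3x\<^sub>n\<close> is in the segment, \<open>{1, 2, 3}\<close> is a facet and depth is 3. What remains is
  \<open>v = x\<^sub>2x\<^sub>3x\<^bsub>j3\<^esub>\<close> with \<open>j3 < n\<close>, where \<open>{1, 2, 3} \<union> {j3+1..i2-1} \<union> {n}\<close> is a facet if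
  \<open>i2 \<ge> 4\<close>. If \<open>i2 \<ge> 5\<close>, or if \<open>i2 = 4\<close> and \<open>j3 < i3 - 1\<close>, a shelling obtained by splitting off
  single vertices shows that its cardinality is the depth. If \<open>i2 = 3\<close> the facet \<open>{1, 2, n}\<close>, and if
  \<open>i2 = 4\<close> and \<open>j3 \<ge> i3 - 1\<close> the disconnected link of \<open>{1, 2}\<close>, give depth 3.
\<close>

section \<open>Weakly regular sequences modulo an ideal\<close>

text \<open>
  Polynomials in \<open>x\<^sub>1, \<dots>, x\<^sub>n\<close> form a subset of a type whose ring operations are already those of a
  type class. Working relative to a subset \<open>C\<close> keeps the class operations and their automation.
\<close>
locale subring_of =
  fixes C :: "'a::comm_ring_1 set"
  assumes one_C [simp, intro]: "1 \<in> C"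
    and diff_C [simp, intro]: "a \<in> C \<Longrightarrow> b \<in> C \<Longrightarrow> a - b \<in> C"
    and mult_C [simp, intro]: "a \<in> C \<Longrightarrow> b \<in> C \<Longrightarrow> a * b \<in> C"
begin

lemma zero_C [simp, intro]: "0 \<in> C"
  using diff_C[OF one_C one_C] by simp

lemma uminus_C [simp, intro]: "a \<in> C \<Longrightarrow> - a \<in> C"
  using diff_C[OF zero_C] by simp

lemma add_C [simp, intro]: "a \<in> C \<Longrightarrow> b \<in> C \<Longrightarrow> a + b \<in> C"
  using diff_C[of a "- b"] by simp

lemma power_C [simp, intro]: "a \<in> C \<Longrightarrow> a ^ m \<in> C"
  by (induction m) auto

lemma sum_C [intro]: "(\<And>i. i \<in> X \<Longrightarrow> h i \<in> C) \<Longrightarrow> sum h X \<in> C"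
  by (induction X rule: infinite_finite_induct) auto

definition is_ideal :: "'a set \<Rightarrow> bool" where
  "is_ideal A \<longleftrightarrow> A \<subseteq> C \<and> 0 \<in> A \<and> (\<forall>a\<in>A. \<forall>b\<in>A. a + b \<in> A) \<and> (\<forall>a\<in>A. \<forall>c\<in>C. c * a \<in> A)"

lemma is_idealI:
  assumes "A \<subseteq> C" "0 \<in> A" "\<And>a b. a \<in> A \<Longrightarrow> b \<in> A \<Longrightarrow> a + b \<in> A"
    "\<And>a c. a \<in> A \<Longrightarrow> c \<in> C \<Longrightarrow> c * a \<in> A"
  shows "is_ideal A"
  using assms by (auto simp: is_ideal_def)

context
  fixes A :: "'a set"
  assumes A: "is_ideal A"
begin

lemma ideal_C: "a \<in> A \<Longrightarrow> a \<in> C"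
  using A by (auto simp: is_ideal_def)

lemma ideal_zero: "0 \<in> A"
  using A by (auto simp: is_ideal_def)

lemma ideal_add: "a \<in> A \<Longrightarrow> b \<in> A \<Longrightarrow> a + b \<in> A"
  using A by (auto simp: is_ideal_def)

lemma ideal_mult: "a \<in> A \<Longrightarrow> c \<in> C \<Longrightarrow> c * a \<in> A"
  using A by (auto simp: is_ideal_def)

lemma ideal_mult': "a \<in> A \<Longrightarrow> c \<in> C \<Longrightarrow> a * c \<in> A"
  using ideal_mult[of a c] by (simp add: mult.commute)

lemma ideal_uminus: "a \<in> A \<Longrightarrow> - a \<in> A"
  using ideal_mult[of a "-1"] by simp

lemma ideal_diff: "a \<in> A \<Longrightarrow> b \<in> A \<Longrightarrow> a - b \<in> A"
  using ideal_add[of a "- b"] ideal_uminus[of b] by simp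

lemma ideal_sum: "(\<And>i. i \<in> X \<Longrightarrow> h i \<in> A) \<Longrightarrow> sum h X \<in> A"
  by (induction X rule: infinite_finite_induct) (auto intro: ideal_zero ideal_add)

end

definition adjoin :: "'a set \<Rightarrow> 'a \<Rightarrow> 'a set" where
  "adjoin A f = {a + f * c |a c. a \<in> A \<and> c \<in> C}"

lemma adjoinI: "a \<in> A \<Longrightarrow> c \<in> C \<Longrightarrow> a + f * c \<in> adjoin A f"
  by (auto simp: adjoin_def)

lemma adjoin_iff:
  assumes "is_ideal A"
  shows "b \<in> adjoin A f \<longleftrightarrow> (\<exists>c\<in>C. b - f * c \<in> A)"
proof
  assume "\<exists>c\<in>C. b - f * c \<in> A"
  then obtain c where "c \<in> C" "b - f * c \<in> A" by blast
  then show "b \<in> adjoin A f"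
    using adjoinI[of "b - f * c" A c f] by simp
next
  assume "b \<in> adjoin A f"
  then obtain a c where "b = a + f * c" "a \<in> A" "c \<in> C" by (auto simp: adjoin_def)
  then show "\<exists>c\<in>C. b - f * c \<in> A" by (intro bexI[of _ c]) auto
qed

lemma adjoin_subset: "is_ideal A \<Longrightarrow> A \<subseteq> adjoin A f"
  using adjoinI[of _ A 0 f] by force

lemma ideal_adjoin:
  assumes A: "is_ideal A" and f: "f \<in> C"
  shows "is_ideal (adjoin A f)"
proof (rule is_idealI)
  show "adjoin A f \<subseteq> C"
    using ideal_C[OF A] f by (auto simp: adjoin_def)
  show "0 \<in> adjoin A f"
    using adjoin_subset[OF A] ideal_zero[OF A] by blast
next
  fix a b assume "a \<in> adjoin A f" "b \<in> adjoin A f"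
  then obtain a' c b' d where "a = a' + f * c" "b = b' + f * d" "a' \<in> A" "b' \<in> A" "c \<in> C" "d \<in> C"
    by (auto simp: adjoin_def)
  then show "a + b \<in> adjoin A f"
    using adjoinI[of "a' + b'" A "c + d" f] ideal_add[OF A] by (simp add: algebra_simps)
next
  fix a e assume "a \<in> adjoin A f" "e \<in> C"
  then obtain a' c where "a = a' + f * c" "a' \<in> A" "c \<in> C" "e \<in> C"
    by (auto simp: adjoin_def)
  then show "e * a \<in> adjoin A f"
    using adjoinI[of "e * a'" A "e * c" f] ideal_mult[OF A] by (simp add: algebra_simps)
qed

lemma adjoin_commute: "adjoin (adjoin A f) g = adjoin (adjoin A g) f"
proof -
  have "adjoin (adjoin A f) g \<subseteq> adjoin (adjoin A g) f" for f g
  proof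
    fix x assume "x \<in> adjoin (adjoin A f) g"
    then obtain a c d where "x = a + f * c + g * d" "a \<in> A" "c \<in> C" "d \<in> C"
      by (auto simp: adjoin_def)
    then show "x \<in> adjoin (adjoin A g) f"
      using adjoinI[OF adjoinI[of a A d g], of c f] by (simp add: algebra_simps)
  qed
  then show ?thesis by blast
qed

definition nonzerodivisor_mod :: "'a set \<Rightarrow> 'a \<Rightarrow> bool" where
  "nonzerodivisor_mod A f \<longleftrightarrow> (\<forall>a\<in>C. f * a \<in> A \<longrightarrow> a \<in> A)"

text \<open>
  Regularity without the condition that the quotient be nonzero. Recursion from the head passes to
  the ideal \<open>adjoin A f\<close>, which is what inductions on the sequence need.
\<close>
primrec weakly_regular :: "'a set \<Rightarrow> 'a list \<Rightarrow> bool" where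
  "weakly_regular A [] \<longleftrightarrow> True"
| "weakly_regular A (f # fs) \<longleftrightarrow> nonzerodivisor_mod A f \<and> weakly_regular (adjoin A f) fs"

lemma weakly_regular_C: "weakly_regular C fs" if "set fs \<subseteq> C"
proof -
  have "adjoin C f = C" if "f \<in> C" for f
    using that adjoinI[of _ C 0 f] by (force simp: adjoin_def)
  then show ?thesis
    using that by (induction fs) (auto simp: nonzerodivisor_mod_def)
qed

text \<open>
  The short exact sequence \<open>0 \<rightarrow> C/(A : w) \<rightarrow> C/A \<rightarrow> C/(A + w) \<rightarrow> 0\<close>. Regularity of the first element
  on the right-hand term keeps the sequence exact after dividing by that element, that is,
  \<open>(A + f) : w = (A : w) + f\<close>; hence the induction.
\<close>
lemma weakly_regular_extension:
  assumes "is_ideal A" "w \<in> C" "set fs \<subseteq> C"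
    and "weakly_regular (adjoin A w) fs"
    and "weakly_regular P fs" and "is_ideal P" and "\<And>q. q \<in> C \<Longrightarrow> w * q \<in> A \<longleftrightarrow> q \<in> P"
  shows "weakly_regular A fs"
  using assms
proof (induction fs arbitrary: A P)
  case (Cons f fs)
  note A = Cons.prems(1) and w = Cons.prems(2) and P = Cons.prems(6) and AP = Cons.prems(7)
  have f: "f \<in> C" "set fs \<subseteq> C" using Cons.prems by auto
  have B: "is_ideal (adjoin A w)" by (rule ideal_adjoin[OF A w])
  have nzB: "a \<in> adjoin A w" if "a \<in> C" "f * a \<in> adjoin A w" for a
    using Cons.prems(4) that by (auto simp: nonzerodivisor_mod_def)
  have nzP: "a \<in> P" if "a \<in> C" "f * a \<in> P" for a
    using Cons.prems(5) that by (auto simp: nonzerodivisor_mod_def)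
  have nz: "nonzerodivisor_mod A f"
    unfolding nonzerodivisor_mod_def
  proof (intro ballI impI)
    fix a assume a: "a \<in> C" "f * a \<in> A"
    then have "a \<in> adjoin A w" using nzB adjoin_subset[OF A] by blast
    then obtain a' c where c: "a = a' + w * c" "a' \<in> A" "c \<in> C" by (auto simp: adjoin_def)
    have "w * (f * c) = f * a - f * a'" by (simp add: c algebra_simps)
    also have "\<dots> \<in> A" by (intro ideal_diff[OF A] a ideal_mult[OF A] c f)
    finally have "f * c \<in> P" using AP f c by blast
    then have "c \<in> P" using nzP c by blast
    then have "w * c \<in> A" using AP c by blast
    then show "a \<in> A" using c ideal_add[OF A] by blast
  qed
  have "weakly_regular (adjoin A f) fs"
  proof (rule Cons.IH[of _ "adjoin P f"])
    show "weakly_regular (adjoin (adjoin A f) w) fs"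
      using Cons.prems(4) by (simp add: adjoin_commute)
    show "weakly_regular (adjoin P f) fs" using Cons.prems(5) by simp
    fix q assume q: "q \<in> C"
    show "w * q \<in> adjoin A f \<longleftrightarrow> q \<in> adjoin P f"
    proof
      assume "w * q \<in> adjoin A f"
      then obtain h where h: "h \<in> C" "w * q - f * h \<in> A" using adjoin_iff[OF A] by blast
      have "f * h = - (w * q - f * h) + w * q" by simp
      also have "\<dots> \<in> adjoin A w" using h q by (intro adjoinI ideal_uminus[OF A])
      finally have "h \<in> adjoin A w" using nzB h by blast
      then obtain a q' where a: "h = a + w * q'" "a \<in> A" "q' \<in> C"
        by (auto simp: adjoin_def)
      have "w * (q - f * q') = (w * q - f * h) + f * a" by (simp add: a algebra_simps)
      also have "\<dots> \<in> A" using a h f by (intro ideal_add[OF A] ideal_mult[OF A])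
      finally have "q - f * q' \<in> P" using AP[of "q - f * q'"] a q f by simp
      then show "q \<in> adjoin P f" using a adjoin_iff[OF P] by blast
    next
      assume "q \<in> adjoin P f"
      then obtain p c where "q = p + f * c" "p \<in> P" "c \<in> C" by (auto simp: adjoin_def)
      then show "w * q \<in> adjoin A f"
        using adjoinI[of "w * p" A "w * c" f] AP ideal_C[OF P] w by (auto simp: algebra_simps)
    qed
  qed (use A w f P in \<open>auto intro: ideal_adjoin\<close>)
  then show ?case using nz by simp
qed simp

end

section \<open>Ordered Koszul cochains\<close>

text \<open>
  The Koszul differential for \<open>y\<close> on cochains that are arbitrary functions of a list of indices,
  \<open>d c (t\<^sub>0, \<dots>, t\<^sub>p) = \<Sum>\<^sub>i (-1)\<^sup>i y\<^bsub>t\<^sub>i\<^esub> c (\<dots>, t\<^bsub>i-1\<^esub>, t\<^bsub>i+1\<^esub>, \<dots>)\<close>. Cochains are not required to be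
  alternating: this removes all sign bookkeeping, since the differential becomes a recursion on
  lists.
\<close>
primrec koszul_d :: "(nat \<Rightarrow> 'a::comm_ring_1) \<Rightarrow> (nat list \<Rightarrow> 'a) \<Rightarrow> nat list \<Rightarrow> 'a" where
  "koszul_d y c [] = 0"
| "koszul_d y c (t # ts) = y t * c ts - koszul_d y (\<lambda>u. c (t # u)) ts"

lemma koszul_d_add: "koszul_d y (\<lambda>T. c T + e T) T = koszul_d y c T + koszul_d y e T"
  by (induction T arbitrary: c e) (auto simp: algebra_simps)

lemma koszul_d_diff: "koszul_d y (\<lambda>T. c T - e T) T = koszul_d y c T - koszul_d y e T"
  by (induction T arbitrary: c e) (auto simp: algebra_simps)

lemma koszul_d_scale: "koszul_d y (\<lambda>T. q * c T) T = q * koszul_d y c T"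
  by (induction T arbitrary: c) (auto simp: algebra_simps)

lemma koszul_d_scale_seq: "koszul_d (\<lambda>t. q * y t) c T = q * koszul_d y c T"
  by (induction T arbitrary: c) (auto simp: algebra_simps)

lemma koszul_d_add_seq: "koszul_d (\<lambda>t. y t + z t) c T = koszul_d y c T + koszul_d z c T"
  by (induction T arbitrary: c) (auto simp: algebra_simps)

lemma koszul_d_anticommute: "koszul_d y (koszul_d z c) T = - koszul_d z (koszul_d y c) T"
  by (induction T arbitrary: c) (auto simp: right_diff_distrib koszul_d_diff koszul_d_scale)

lemma koszul_d_d: "koszul_d y (koszul_d y c) T = 0"
  by (induction T arbitrary: c) (auto simp: koszul_d_diff koszul_d_scale)

context subring_of
begin

inductive_set generated :: "(nat \<Rightarrow> 'a) \<Rightarrow> 'a set" for y where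
  generated_zero: "0 \<in> generated y"
| generated_step: "q \<in> generated y \<Longrightarrow> c \<in> C \<Longrightarrow> q + c * y t \<in> generated y"

lemma koszul_d_ideal:
  assumes A: "is_ideal A" and "\<And>t. y t \<in> C"
    and "\<And>U. Suc (length U) = length T \<Longrightarrow> c U \<in> A"
  shows "koszul_d y c T \<in> A"
  using assms(2-)
proof (induction T arbitrary: c)
  case (Cons t T)
  then have "koszul_d y (\<lambda>u. c (t # u)) T \<in> A" by simp
  then show ?case using Cons.prems by (auto intro!: ideal_diff[OF A] ideal_mult[OF A])
qed (simp add: ideal_zero[OF A])

lemma koszul_d_C:
  assumes "\<And>t. y t \<in> C" and "\<And>U. c U \<in> C"
  shows "koszul_d y c T \<in> C"
  using assms by (induction T arbitrary: c) auto

text \<open>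
  Prefixing the index \<open>t\<close> is a contracting homotopy for multiplication by \<open>y t\<close>: by definition,
  \<open>d c (t # T) = y t * c T - d (\<lambda>U. c (t # U)) T\<close>. Hence the whole ideal generated by \<open>y\<close> kills the
  cohomology.
\<close>
lemma generated_null_homotopic:
  assumes A: "is_ideal A" and "\<And>t. y t \<in> C" and c: "\<And>T. c T \<in> C"
    and cocycle: "\<And>T. length T = Suc p \<Longrightarrow> koszul_d y c T \<in> A"
    and q: "q \<in> generated y"
  shows "\<exists>b. (\<forall>T. b T \<in> C) \<and> (\<forall>T. length T = p \<longrightarrow> q * c T - koszul_d y b T \<in> A)"
  using q
proof induction
  case generated_zero
  have "koszul_d y (\<lambda>T. 0) T = 0" for T :: "nat list" by (induction T) auto
  then show ?case by (intro exI[of _ "\<lambda>T. 0"]) (auto simp: ideal_zero[OF A])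
next
  case (generated_step q a t)
  then obtain b where b: "\<And>T. b T \<in> C" "\<And>T. length T = p \<Longrightarrow> q * c T - koszul_d y b T \<in> A"
    by blast
  define b' where "b' T = b T + a * c (t # T)" for T
  have "(q + a * y t) * c T - koszul_d y b' T \<in> A" if "length T = p" for T
  proof -
    have "(q + a * y t) * c T - koszul_d y b' T
      = (q * c T - koszul_d y b T) + a * koszul_d y c (t # T)"
      unfolding b'_def by (simp add: koszul_d_add koszul_d_scale algebra_simps)
    also have "\<dots> \<in> A"
      using that generated_step.hyps by (intro ideal_add[OF A] ideal_mult[OF A] cocycle b(2)) auto
    finally show ?thesis .
  qed
  then show ?case
    using b(1) c generated_step.hyps(2)
    by (intro exI[of _ b'] conjI allI impI) (simp add: b'_def, blast)
qed

text \<open>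
  Let \<open>f\<close> be the first element and \<open>c\<close> a cocycle modulo \<open>A\<close>. A power of \<open>f\<close> kills cohomology, so
  \<open>f\<^sup>K c = d b\<close>. Then \<open>b\<close> is a cocycle modulo \<open>A + f\<close> of one degree less, and by induction
  \<open>b = d e + f g\<close>. So \<open>f\<^sup>K c = f d g\<close>, and as \<open>f\<close> is a nonzerodivisor one factor of \<open>f\<close> cancels.
  Repeating this removes all the factors. The elements only need powers in the ideal generated by
  \<open>y\<close>; this is what permits to use squares of variables for \<open>y\<close>.
\<close>
lemma koszul_acyclic:
  assumes "is_ideal A" and "weakly_regular A fs" and "set fs \<subseteq> C"
    and "\<And>f. f \<in> set fs \<Longrightarrow> \<exists>K. f ^ K \<in> generated y" and "\<And>t. y t \<in> C"
    and "p < length fs" and "\<And>T. c T \<in> C" and "\<And>T. length T = Suc p \<Longrightarrow> koszul_d y c T \<in> A"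
  shows "\<exists>g. (\<forall>T. g T \<in> C) \<and> (\<forall>T. length T = p \<longrightarrow> c T - koszul_d y g T \<in> A)"
  using assms
proof (induction fs arbitrary: A p c)
  case (Cons f fs)
  note A = Cons.prems(1) and y = Cons.prems(5) and c = Cons.prems(7)
  have f: "f \<in> C" using Cons.prems by auto
  have nz: "a \<in> A" if "a \<in> C" "f * a \<in> A" for a
    using Cons.prems(2) that by (auto simp: nonzerodivisor_mod_def)
  have step: "\<exists>b'. (\<forall>T. b' T \<in> C) \<and> (\<forall>T. length T = p \<longrightarrow> f ^ k * c T - koszul_d y b' T \<in> A)"
    if b: "\<And>T. b T \<in> C" "\<And>T. length T = p \<Longrightarrow> f ^ Suc k * c T - koszul_d y b T \<in> A" for b k
  proof (cases p)
    case 0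
    have "f * (f ^ k * c []) \<in> A" using b(2)[of "[]"] 0 by (simp add: mult.assoc)
    then have "f ^ k * c [] \<in> A" using nz f c by blast
    then show ?thesis using 0 by (intro exI[of _ "\<lambda>T. 0"]) auto
  next
    case (Suc m)
    have A': "is_ideal (adjoin A f)" by (rule ideal_adjoin[OF A f])
    have "koszul_d y b T \<in> adjoin A f" if "length T = Suc m" for T
    proof -
      have "koszul_d y b T = - (f ^ Suc k * c T - koszul_d y b T) + f * (f ^ k * c T)"
        by (simp add: algebra_simps)
      also have "\<dots> \<in> adjoin A f"
        using b(2) that Suc c f by (intro adjoinI ideal_uminus[OF A]) auto
      finally show ?thesis .
    qed
    moreover have "weakly_regular (adjoin A f) fs" "set fs \<subseteq> C" "m < length fs"
      using Cons.prems Suc by auto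
    moreover have "\<exists>K. h ^ K \<in> generated y" if "h \<in> set fs" for h
      using Cons.prems(4) that by simp
    ultimately have "\<exists>e. (\<forall>T. e T \<in> C) \<and> (\<forall>T. length T = m \<longrightarrow> b T - koszul_d y e T \<in> adjoin A f)"
      by (intro Cons.IH[OF A']) (blast intro: y b(1))+
    then obtain e where e: "\<forall>T. e T \<in> C" "\<forall>T. length T = m \<longrightarrow> b T - koszul_d y e T \<in> adjoin A f"
      by (elim exE conjE) (rule that)
    have "\<exists>h. h \<in> C \<and> (length T = m \<longrightarrow> b T - koszul_d y e T - f * h \<in> A)" for T
    proof (cases "length T = m")
      case True
      then show ?thesis using e(2) adjoin_iff[OF A] by auto
    qed (use zero_C in auto)
    then obtain g where "\<forall>T. g T \<in> C \<and> (length T = m \<longrightarrow> b T - koszul_d y e T - f * g T \<in> A)"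
      using choice[of "\<lambda>T h. h \<in> C \<and> (length T = m \<longrightarrow> b T - koszul_d y e T - f * h \<in> A)"] by auto
    then have g: "\<And>T. g T \<in> C" "\<And>T. length T = m \<Longrightarrow> b T - koszul_d y e T - f * g T \<in> A"
      by simp_all
    have "f ^ k * c T - koszul_d y g T \<in> A" if T: "length T = p" for T
    proof (rule nz)
      show "f ^ k * c T - koszul_d y g T \<in> C" using f c y g koszul_d_C by auto
      \<comment> \<open>Apply the differential to \<open>b = d e + f g\<close>.\<close>
      have "koszul_d y (\<lambda>T. b T - koszul_d y e T - f * g T) T \<in> A"
        using T Suc g by (intro koszul_d_ideal[OF A y]) auto
      then have "koszul_d y b T - f * koszul_d y g T \<in> A"
        by (simp add: koszul_d_diff koszul_d_scale koszul_d_d)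
      from ideal_add[OF A b(2)[OF T] this] show "f * (f ^ k * c T - koszul_d y g T) \<in> A"
        by (simp add: algebra_simps)
    qed
    then show ?thesis using g(1) by (intro exI[of _ g]) simp
  qed
  obtain K where K: "f ^ K \<in> generated y" using Cons.prems(4) by auto
  then have "\<exists>b. (\<forall>T. b T \<in> C) \<and> (\<forall>T. length T = p \<longrightarrow> f ^ K * c T - koszul_d y b T \<in> A)"
    using generated_null_homotopic[OF A y c Cons.prems(8)] by blast
  then have "\<exists>b. (\<forall>T. b T \<in> C) \<and> (\<forall>T. length T = p \<longrightarrow> f ^ 0 * c T - koszul_d y b T \<in> A)"
  proof (induction K)
    case (Suc K)
    from Suc.prems obtain b where "\<forall>T. b T \<in> C" "\<forall>T. length T = p \<longrightarrow> f ^ Suc K * c T - koszul_d y b T \<in> A"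
      by (elim exE conjE) (rule that)
    then show ?case by (intro Suc.IH step[of b]) simp_all
  qed
  then show ?case by simp
qed simp

end

section \<open>Monomial ideals of simplicial complexes\<close>

abbreviation mons :: "((nat \<Rightarrow>\<^sub>0 nat) \<Rightarrow>\<^sub>0 'k::zero) \<Rightarrow> (nat \<Rightarrow>\<^sub>0 nat) set" where
  "mons \<equiv> Poly_Mapping.keys"

abbreviation vars :: "(nat \<Rightarrow>\<^sub>0 nat) \<Rightarrow> nat set" where
  "vars \<equiv> Poly_Mapping.keys"

abbreviation coeff :: "('b \<Rightarrow>\<^sub>0 'c::zero) \<Rightarrow> 'b \<Rightarrow> 'c" where
  "coeff \<equiv> Poly_Mapping.lookup"

definition polys :: "nat \<Rightarrow> ((nat \<Rightarrow>\<^sub>0 nat) \<Rightarrow>\<^sub>0 'k::field) set" where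
  "polys n = {p. \<forall>w\<in>mons p. vars w \<subseteq> {1..n}}"

lemma vars_add: "vars (a + b) = vars a \<union> vars b"
  by (auto simp: Poly_Mapping.in_keys_iff Poly_Mapping.lookup_add)

lemma coeff_monom_mult: "coeff (monom w * p) (w + v) = coeff p v"
proof -
  have "(\<Sum>q. coeff p q when w + v = w + q) = coeff p v" by simp
  then show ?thesis
    by (simp add: monom_def Poly_Mapping.lookup_mult Poly_Mapping.lookup_single when_mult)
qed

lemma mons_monom_mult: "mons (monom w * p) = (+) w ` mons p"
proof
  show "mons (monom w * p) \<subseteq> (+) w ` mons p"
    using Poly_Mapping.keys_mult[of "monom w" p] by (auto simp: monom_def split: if_splits)
  show "(+) w ` mons p \<subseteq> mons (monom w * p)"
    by (auto simp: Poly_Mapping.in_keys_iff coeff_monom_mult)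
qed

global_interpretation poly: subring_of "polys n :: ((nat \<Rightarrow>\<^sub>0 nat) \<Rightarrow>\<^sub>0 'k::field) set" for n
proof
  show "(1 :: (nat \<Rightarrow>\<^sub>0 nat) \<Rightarrow>\<^sub>0 'k) \<in> polys n" by (simp add: polys_def)
next
  fix a b :: "(nat \<Rightarrow>\<^sub>0 nat) \<Rightarrow>\<^sub>0 'k" assume "a \<in> polys n" "b \<in> polys n"
  then show "a - b \<in> polys n" "a * b \<in> polys n"
    using Poly_Mapping.keys_diff[of a b] Poly_Mapping.keys_mult[of a b]
    by (fastforce simp: polys_def vars_add)+
qed

lemma sum_terms: "(p :: (nat \<Rightarrow>\<^sub>0 nat) \<Rightarrow>\<^sub>0 'k::comm_monoid_add) = (\<Sum>w\<in>mons p. Poly_Mapping.single w (coeff p w))"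
  by (rule poly_mapping_eqI) (auto simp: Poly_Mapping.lookup_sum Poly_Mapping.lookup_single when_def
      Poly_Mapping.in_keys_iff)

lemma ideal_of_terms:
  assumes "poly.is_ideal n A" and "\<And>w. w \<in> mons p \<Longrightarrow> Poly_Mapping.single w (coeff p w) \<in> A"
  shows "p \<in> A"
  by (subst sum_terms) (rule poly.ideal_sum[OF assms])

definition down_closed :: "'a set set \<Rightarrow> bool" where
  "down_closed \<Gamma> \<longleftrightarrow> (\<forall>G\<in>\<Gamma>. \<forall>H. H \<subseteq> G \<longrightarrow> H \<in> \<Gamma>)"

lemma down_closedD: "down_closed \<Gamma> \<Longrightarrow> G \<in> \<Gamma> \<Longrightarrow> H \<subseteq> G \<Longrightarrow> H \<in> \<Gamma>"
  by (auto simp: down_closed_def)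

text \<open>
  For a complex on \<open>{1..n}\<close> this is its Stanley-Reisner ideal. The definition by supports makes sense for
  an arbitrary family, with value \<open>polys n\<close> for the empty one.
\<close>
definition face_ideal :: "nat \<Rightarrow> nat set set \<Rightarrow> ((nat \<Rightarrow>\<^sub>0 nat) \<Rightarrow>\<^sub>0 'k::field) set" where
  "face_ideal n \<Gamma> = {p \<in> polys n. \<forall>w\<in>mons p. vars w \<notin> \<Gamma>}"

lemma ideal_face_ideal:
  assumes "down_closed \<Gamma>"
  shows "poly.is_ideal n (face_ideal n \<Gamma> :: ((nat \<Rightarrow>\<^sub>0 nat) \<Rightarrow>\<^sub>0 'k::field) set)"
proof (rule poly.is_idealI)
  fix a b :: "(nat \<Rightarrow>\<^sub>0 nat) \<Rightarrow>\<^sub>0 'k" assume "a \<in> face_ideal n \<Gamma>" "b \<in> face_ideal n \<Gamma>"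
  then show "a + b \<in> face_ideal n \<Gamma>"
    using Poly_Mapping.keys_add[of a b] by (force simp: face_ideal_def)
next
  fix a c :: "(nat \<Rightarrow>\<^sub>0 nat) \<Rightarrow>\<^sub>0 'k" assume *: "a \<in> face_ideal n \<Gamma>" "c \<in> polys n"
  have "vars w \<notin> \<Gamma>" if w: "w \<in> mons (c * a)" for w
  proof -
    obtain u v where "w = u + v" "v \<in> mons a" using Poly_Mapping.keys_mult[of c a] w by blast
    then show ?thesis
      using * down_closedD[OF assms, of "vars w" "vars v"] by (auto simp: face_ideal_def vars_add)
  qed
  with * show "c * a \<in> face_ideal n \<Gamma>" by (simp add: face_ideal_def)
qed (auto simp: face_ideal_def)

definition squarefree_exponent :: "nat set \<Rightarrow> (nat \<Rightarrow>\<^sub>0 nat)" where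
  "squarefree_exponent T = (\<Sum>i\<in>T. Poly_Mapping.single i 1)"

lemma coeff_squarefree: "finite T \<Longrightarrow> coeff (squarefree_exponent T) i = (if i \<in> T then 1 else 0)"
  by (simp add: squarefree_exponent_def Poly_Mapping.lookup_sum Poly_Mapping.lookup_single when_def)

lemma vars_squarefree [simp]: "finite T \<Longrightarrow> vars (squarefree_exponent T) = T"
  by (auto simp: Poly_Mapping.in_keys_iff coeff_squarefree split: if_splits)

lemma monom_squarefree_polys: "R \<subseteq> {1..n} \<Longrightarrow> monom (squarefree_exponent R) \<in> polys n"
  using finite_subset[of R "{1..n}"] by (auto simp: polys_def monom_def)

lemma vars_factor:
  assumes "finite R" "R \<subseteq> vars w"
  shows "Poly_Mapping.single w c = monom (squarefree_exponent R) * Poly_Mapping.single (w - squarefree_exponent R) c"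
    and "vars (w - squarefree_exponent R) \<subseteq> vars w"
proof -
  have "squarefree_exponent R + (w - squarefree_exponent R) = w"
    by (rule poly_mapping_eqI) (use assms in \<open>auto simp: Poly_Mapping.lookup_add
      Poly_Mapping.lookup_minus coeff_squarefree Poly_Mapping.in_keys_iff Suc_le_eq\<close>)
  then show "Poly_Mapping.single w c = monom (squarefree_exponent R) * Poly_Mapping.single (w - squarefree_exponent R) c"
    by (simp add: monom_def Poly_Mapping.mult_single)
  show "vars (w - squarefree_exponent R) \<subseteq> vars w"
    by (auto simp: Poly_Mapping.in_keys_iff Poly_Mapping.lookup_minus)
qed

lemma adjoin_face_ideal:
  assumes "down_closed \<Gamma>" "R \<subseteq> {1..n}"
  shows "poly.adjoin n (face_ideal n \<Gamma>) (monom (squarefree_exponent R)) = face_ideal n (\<Gamma> - {G. R \<subseteq> G})"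
    (is "?L = ?R")
proof
  have fin: "finite R" using assms(2) finite_subset by auto
  have A: "poly.is_ideal n (face_ideal n \<Gamma>)" by (rule ideal_face_ideal[OF assms(1)])
  have L: "poly.is_ideal n ?L" using poly.ideal_adjoin[OF A] monom_squarefree_polys assms(2) by blast
  show "?L \<subseteq> ?R"
  proof
    fix p assume p: "p \<in> ?L"
    then obtain a c where ac: "p = a + monom (squarefree_exponent R) * c" "a \<in> face_ideal n \<Gamma>" "c \<in> polys n"
      by (auto simp: poly.adjoin_def)
    have "p \<in> polys n" using poly.ideal_C[OF L p] .
    moreover have "vars w \<notin> \<Gamma> - {G. R \<subseteq> G}" if "w \<in> mons p" for w
      using that Poly_Mapping.keys_add[of a "monom (squarefree_exponent R) * c"] ac fin
      by (auto simp: mons_monom_mult vars_add face_ideal_def)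
    ultimately show "p \<in> ?R" by (auto simp: face_ideal_def)
  qed
  show "?R \<subseteq> ?L"
  proof
    fix p assume p: "p \<in> ?R"
    show "p \<in> ?L"
    proof (rule ideal_of_terms[OF L])
      fix w assume w: "w \<in> mons p"
      have wn: "vars w \<subseteq> {1..n}" "vars w \<notin> \<Gamma> \<or> R \<subseteq> vars w" using p w by (auto simp: face_ideal_def polys_def)
      show "Poly_Mapping.single w (coeff p w) \<in> ?L"
      proof (cases "vars w \<in> \<Gamma>")
        case True
        then have R: "R \<subseteq> vars w" using wn by auto
        have "Poly_Mapping.single (w - squarefree_exponent R) (coeff p w) \<in> polys n"
          using wn vars_factor(2)[OF fin R] by (auto simp: polys_def)
        from poly.adjoinI[OF poly.ideal_zero[OF A] this, of "monom (squarefree_exponent R)"]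
        show ?thesis by (simp only: add_0 vars_factor(1)[OF fin R, symmetric])
      next
        case False
        then have "Poly_Mapping.single w (coeff p w) \<in> face_ideal n \<Gamma>"
          using wn by (auto simp: face_ideal_def polys_def)
        then show ?thesis using poly.adjoin_subset[OF A] by blast
      qed
    qed
  qed
qed

text \<open>
  Colon by a squarefree monomial is passage to the star: this and the preceding lemma translate
  the short exact sequence for \<open>w = x\<^sub>R\<close> into removing an interval \<open>[R, F]\<close> from a complex, as
  the star of \<open>R\<close> is then the simplex on \<open>F\<close>.
\<close>
lemma colon_face_ideal:
  assumes "R \<subseteq> {1..n}" "q \<in> polys n"
  shows "monom (squarefree_exponent R) * q \<in> face_ideal n \<Gamma> \<longleftrightarrow> q \<in> face_ideal n {G. G \<union> R \<in> \<Gamma>}"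
proof -
  have "finite R" using assms finite_subset by auto
  moreover have "monom (squarefree_exponent R) * q \<in> polys n"
    using poly.mult_C[OF monom_squarefree_polys[OF assms(1)] assms(2)] .
  ultimately show ?thesis
    using assms(2) by (simp add: face_ideal_def mons_monom_mult vars_add Un_commute)
qed

section \<open>Lifting regularity along a variable\<close>

definition deg :: "(nat \<Rightarrow>\<^sub>0 nat) \<Rightarrow> nat" where
  "deg w = (\<Sum>i\<in>vars w. coeff w i)"

lemma deg_add: "deg (v + w) = deg v + deg w"
  unfolding deg_def by (rule Poly_Mapping.setsum_keys_plus_distrib) auto

lemma deg_squarefree: "finite T \<Longrightarrow> deg (squarefree_exponent T) = card T"
  by (simp add: deg_def coeff_squarefree)

definition homogeneous :: "nat \<Rightarrow> ((nat \<Rightarrow>\<^sub>0 nat) \<Rightarrow>\<^sub>0 'k::field) \<Rightarrow> bool" where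
  "homogeneous e p \<longleftrightarrow> (\<forall>w\<in>mons p. deg w = e)"

text \<open>
  The part of degree less than \<open>N\<close>. Truncations replace homogeneous components as a test for an
  ideal to be homogeneous, because they are additive and cut off all multiples of \<open>x\<^sup>N\<close>.
\<close>
definition truncate :: "nat \<Rightarrow> ((nat \<Rightarrow>\<^sub>0 nat) \<Rightarrow>\<^sub>0 'k::field) \<Rightarrow> ((nat \<Rightarrow>\<^sub>0 nat) \<Rightarrow>\<^sub>0 'k)" where
  "truncate N = Poly_Mapping.mapp (\<lambda>w c. if deg w < N then c else 0)"

lemma coeff_truncate: "coeff (truncate N p) w = (if deg w < N then coeff p w else 0)"
  by (auto simp: truncate_def Poly_Mapping.lookup_mapp when_def Poly_Mapping.in_keys_iff)

lemma truncate_add: "truncate N (p + q) = truncate N p + truncate N q"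
  by (rule poly_mapping_eqI) (simp add: coeff_truncate Poly_Mapping.lookup_add)

lemma truncate_0 [simp]: "truncate 0 p = 0"
  by (rule poly_mapping_eqI) (simp add: coeff_truncate)

lemma mons_truncate: "mons (truncate N p) \<subseteq> mons p"
  by (auto simp: Poly_Mapping.in_keys_iff coeff_truncate split: if_splits)

lemma truncate_polys: "p \<in> polys n \<Longrightarrow> truncate N p \<in> polys n"
  using mons_truncate[of N p] by (auto simp: polys_def)

lemma truncate_mult_homogeneous:
  assumes "homogeneous e f"
  shows "truncate N (f * h) = f * truncate (N - e) h"
proof (rule poly_mapping_eqI)
  fix k
  have "(if deg k < N then coeff f l * (\<Sum>q. coeff h q when k = l + q) else 0)
      = coeff f l * (\<Sum>q. coeff (truncate (N - e) h) q when k = l + q)" for l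
  proof (cases "coeff f l = 0")
    case False
    then have l: "deg l = e" using assms by (auto simp: homogeneous_def Poly_Mapping.in_keys_iff)
    have "(coeff (truncate (N - e) h) q when k = l + q) = (if deg k < N then coeff h q when k = l + q else 0)" for q
      by (cases "k = l + q") (use l in \<open>auto simp: coeff_truncate deg_add\<close>)
    then show ?thesis by auto
  qed simp
  note eq = this
  have "coeff (truncate N (f * h)) k
      = (\<Sum>l. if deg k < N then coeff f l * (\<Sum>q. coeff h q when k = l + q) else 0)"
    by (simp add: coeff_truncate Poly_Mapping.lookup_mult)
  also have "\<dots> = (\<Sum>l. coeff f l * (\<Sum>q. coeff (truncate (N - e) h) q when k = l + q))"
    by (rule Sum_any.cong) (rule eq)
  also have "\<dots> = coeff (f * truncate (N - e) h) k"
    by (simp only: Poly_Mapping.lookup_mult)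
  finally show "coeff (truncate N (f * h)) k = coeff (f * truncate (N - e) h) k" .
qed

definition graded :: "((nat \<Rightarrow>\<^sub>0 nat) \<Rightarrow>\<^sub>0 'k::field) set \<Rightarrow> bool" where
  "graded A \<longleftrightarrow> (\<forall>a\<in>A. \<forall>N. truncate N a \<in> A)"

lemma graded_face_ideal: "graded (face_ideal n \<Gamma>)"
  using mons_truncate truncate_polys by (fastforce simp: graded_def face_ideal_def)

lemma graded_adjoin:
  assumes "graded A" "homogeneous e f"
  shows "graded (poly.adjoin n A f)"
  unfolding graded_def
proof (intro ballI allI)
  fix p N assume "p \<in> poly.adjoin n A f"
  then obtain a c where "p = a + f * c" "a \<in> A" "c \<in> polys n" by (auto simp: poly.adjoin_def)
  then show "truncate N p \<in> poly.adjoin n A f"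
    using assms poly.adjoinI[of "truncate N a" A "truncate (N - e) c" n f]
    by (auto simp: truncate_add truncate_mult_homogeneous graded_def truncate_polys)
qed

text \<open>
  A form of Krull's intersection theorem: if \<open>N\<close> exceeds the degree of \<open>b = a + x\<^sup>N c\<close>, truncation at \<open>N\<close>
  leaves \<open>b\<close> unchanged and kills \<open>x\<^sup>N c\<close>.
\<close>
lemma graded_krull:
  assumes A: "graded A" "A \<subseteq> polys n" and x: "homogeneous e x" "e > 0"
    and b: "\<And>N. b \<in> poly.adjoin n A (x ^ N)"
  shows "b \<in> A"
proof -
  have hom: "homogeneous (N * e) (x ^ N)" for N
  proof (induction N)
    case (Suc N)
    then show ?case
      using Poly_Mapping.keys_mult[of x "x ^ N"] x by (fastforce simp: homogeneous_def deg_add)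
  qed (auto simp: homogeneous_def deg_def)
  define N where "N = Suc (Max (insert 0 (deg ` mons b)))"
  have "deg w < N" if "w \<in> mons b" for w
    using that by (auto simp: N_def less_Suc_eq_le intro!: Max_ge)
  then have "truncate N b = b"
    by (intro poly_mapping_eqI) (auto simp: coeff_truncate Poly_Mapping.in_keys_iff)
  moreover obtain a c where "b = a + x ^ N * c" "a \<in> A" using b[of N] by (auto simp: poly.adjoin_def)
  moreover have "N - N * e = 0" using x(2) by simp
  ultimately have "b = truncate N a"
    using truncate_mult_homogeneous[OF hom, of N N c] by (simp add: truncate_add)
  then show ?thesis using A \<open>a \<in> A\<close> by (simp add: graded_def)
qed

text \<open>
  A nonzerodivisor \<open>x\<close> may be moved from the front of a regular sequence to its end, and then
  dropped. If \<open>f a \<in> A\<close>, then \<open>a = a' + x c\<close> with again \<open>f c \<in> A\<close>, so \<open>a\<close> lies in \<open>A + x\<^sup>N\<close> for all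
  \<open>N\<close>, hence in \<open>A\<close>. Grading is essential: in general regular sequences cannot be permuted.
\<close>
lemma weakly_regular_lift:
  assumes "poly.is_ideal n A" "graded A" "x \<in> polys n" "homogeneous e x" "e > 0"
    and "poly.nonzerodivisor_mod n A x" "poly.weakly_regular n (poly.adjoin n A x) fs"
    and "\<And>f. f \<in> set fs \<Longrightarrow> f \<in> polys n \<and> (\<exists>d. homogeneous d f)"
  shows "poly.weakly_regular n A fs"
  using assms(1,2,6-)
proof (induction fs arbitrary: A)
  case (Cons f fs)
  note A = Cons.prems(1) and x = assms(3)
  obtain d where f: "f \<in> polys n" "homogeneous d f" using Cons.prems(5) by auto
  have nzx: "a \<in> A" if "a \<in> polys n" "x * a \<in> A" for a
    using Cons.prems(3) that by (auto simp: poly.nonzerodivisor_mod_def)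
  have nzf: "a \<in> poly.adjoin n A x" if "a \<in> polys n" "f * a \<in> poly.adjoin n A x" for a
    using Cons.prems(4) that by (auto simp: poly.nonzerodivisor_mod_def)
  have "a \<in> poly.adjoin n A (x ^ N)" if a: "a \<in> polys n" "f * a \<in> A" for a N
    using a
  proof (induction N arbitrary: a)
    case 0
    then show ?case using poly.adjoinI[OF poly.ideal_zero[OF A], where c = a and f = 1] by simp
  next
    case (Suc N)
    have "a \<in> poly.adjoin n A x" using nzf Suc.prems poly.adjoin_subset[OF A] by blast
    then obtain a' c where c: "a = a' + x * c" "a' \<in> A" "c \<in> polys n" by (auto simp: poly.adjoin_def)
    have "x * (f * c) = f * a - f * a'" by (simp add: c algebra_simps)
    also have "\<dots> \<in> A" by (intro poly.ideal_diff[OF A] Suc.prems(2) poly.ideal_mult[OF A] c f)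
    finally have "f * c \<in> A" using nzx f c by blast
    then obtain b h where h: "c = b + x ^ N * h" "b \<in> A" "h \<in> polys n"
      using Suc.IH[OF c(3)] by (auto simp: poly.adjoin_def)
    have "a = (a' + x * b) + x ^ Suc N * h" by (simp add: c h algebra_simps)
    also have "\<dots> \<in> poly.adjoin n A (x ^ Suc N)"
      by (intro poly.adjoinI poly.ideal_add[OF A] poly.ideal_mult[OF A] c h x)
    finally show ?case .
  qed
  then have "poly.nonzerodivisor_mod n A f"
    unfolding poly.nonzerodivisor_mod_def
    using graded_krull[OF Cons.prems(2) _ assms(4,5)] poly.ideal_C[OF A] by blast
  moreover have "poly.weakly_regular n (poly.adjoin n A f) fs"
  proof (rule Cons.IH)
    show "poly.weakly_regular n (poly.adjoin n (poly.adjoin n A f) x) fs"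
      using Cons.prems(4) by (simp add: poly.adjoin_commute)
    show "poly.nonzerodivisor_mod n (poly.adjoin n A f) x"
      unfolding poly.nonzerodivisor_mod_def
    proof (intro ballI impI)
      fix c assume c: "c \<in> polys n" "x * c \<in> poly.adjoin n A f"
      then obtain h where h: "h \<in> polys n" "x * c - f * h \<in> A" using poly.adjoin_iff[OF A] by blast
      have "f * h = - (x * c - f * h) + x * c" by simp
      also have "\<dots> \<in> poly.adjoin n A x" by (intro poly.adjoinI poly.ideal_uminus[OF A] h c)
      finally have "h \<in> poly.adjoin n A x" using nzf h by blast
      then obtain a h' where h': "h = a + x * h'" "a \<in> A" "h' \<in> polys n" by (auto simp: poly.adjoin_def)
      have "x * (c - f * h') = (x * c - f * h) + f * a" by (simp add: h' algebra_simps)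
      also have "\<dots> \<in> A" by (intro poly.ideal_add[OF A] poly.ideal_mult[OF A] h h' f)
      finally have "c - f * h' \<in> A" by (rule nzx[rotated]) (intro poly.diff_C poly.mult_C c f h')
      then show "c \<in> poly.adjoin n A f" using h' poly.adjoin_iff[OF A] by blast
    qed
  qed (use Cons.prems f in \<open>auto intro: poly.ideal_adjoin graded_adjoin\<close>)
  ultimately show ?case by simp
qed simp

section \<open>Partial shellings\<close>

text \<open>
  The family is built by adding intervals \<open>[R, F]\<close>. The last condition says that all faces of \<open>F\<close>
  that do not contain \<open>R\<close> are already there, so that \<open>F\<close> is glued along a union of facets of its
  boundary, as in a shelling; but \<open>F\<close> need not be a facet of the final complex, and only
  a lower bound on its cardinality is required. Taking \<open>R = F\<close>, faces with at least \<open>r\<close> vertices whose boundary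
  is present can be added one by one.
\<close>
inductive shelled :: "nat \<Rightarrow> 'a set set \<Rightarrow> bool" for r where
  shelled_empty: "shelled r {}"
| shelled_step: "shelled r \<Gamma> \<Longrightarrow> finite F \<Longrightarrow> r \<le> card F \<Longrightarrow> R \<subseteq> F \<Longrightarrow> R \<notin> \<Gamma> \<Longrightarrow>
    (\<And>x. x \<in> R \<Longrightarrow> F - {x} \<in> \<Gamma>) \<Longrightarrow> shelled r (\<Gamma> \<union> {G. R \<subseteq> G \<and> G \<subseteq> F})"

lemma shelled_down_closed: "shelled r \<Gamma> \<Longrightarrow> down_closed \<Gamma>"
proof (induction rule: shelled.induct)
  case (shelled_step \<Gamma> F R)
  show ?case
    unfolding down_closed_def
  proof (intro ballI allI impI)
    fix G H assume G: "G \<in> \<Gamma> \<union> {G. R \<subseteq> G \<and> G \<subseteq> F}" and H: "H \<subseteq> G"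
    show "H \<in> \<Gamma> \<union> {G. R \<subseteq> G \<and> G \<subseteq> F}"
    proof (cases "G \<in> \<Gamma> \<or> R \<subseteq> H")
      case True
      then show ?thesis using G H down_closedD[OF shelled_step.IH] by auto
    next
      case False
      then obtain x where "x \<in> R" "x \<notin> H" by blast
      then have "F - {x} \<in> \<Gamma>" "H \<subseteq> F - {x}" using shelled_step.hyps False G H by auto
      then show ?thesis using down_closedD[OF shelled_step.IH] by blast
    qed
  qed
qed (simp add: down_closed_def)

lemma shelled_mono: "shelled r \<Gamma> \<Longrightarrow> s \<le> r \<Longrightarrow> shelled s \<Gamma>"
  by (induction rule: shelled.induct) (auto intro: shelled.intros)

lemma shelled_simplex:
  assumes "finite F" "r \<le> card F"
  shows "shelled r (Pow F)"
  using shelled_step[OF shelled_empty assms, of "{}"] by (simp add: Pow_def)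

text \<open>
  For \<open>X = F\<close> this is the boundary of the simplex. Adding a vertex \<open>a\<close> to \<open>X\<close> adds the
  faces of \<open>F - {a}\<close> that contain \<open>X\<close>.
\<close>
lemma shelled_simplex_minus_star:
  assumes "finite F" "r < card F" "X \<subseteq> F"
  shows "shelled r {G. G \<subseteq> F \<and> \<not> X \<subseteq> G}"
proof -
  have "finite X" using assms finite_subset by blast
  then show ?thesis using assms(3)
  proof (induction X)
    case (insert a X)
    let ?\<Gamma> = "{G. G \<subseteq> F \<and> \<not> X \<subseteq> G}"
    have "shelled r (?\<Gamma> \<union> {G. X \<subseteq> G \<and> G \<subseteq> F - {a}})"
      using insert assms by (intro shelled_step) auto
    also have "?\<Gamma> \<union> {G. X \<subseteq> G \<and> G \<subseteq> F - {a}} = {G. G \<subseteq> F \<and> \<not> insert a X \<subseteq> G}"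
      using insert.hyps by auto
    finally show ?case .
  qed (simp add: shelled_empty)
qed

lemma shelled_glue_cone:
  assumes "shelled (Suc s) \<Gamma>" "shelled s \<Lambda>" "\<Lambda> \<subseteq> \<Gamma>" "\<And>G. G \<in> \<Gamma> \<Longrightarrow> v \<notin> G"
  shows "shelled (Suc s) (\<Gamma> \<union> insert v ` \<Lambda>)"
  using assms(2,3)
proof (induction rule: shelled.induct)
  case shelled_empty
  then show ?case using assms(1) by simp
next
  case (shelled_step \<Lambda> F R)
  let ?\<Delta> = "\<Gamma> \<union> insert v ` \<Lambda>"
  have "{G. R \<subseteq> G \<and> G \<subseteq> F} \<subseteq> \<Gamma>" using shelled_step.prems by simp
  then have \<Gamma>: "F \<in> \<Gamma>" "R \<in> \<Gamma>" using \<open>R \<subseteq> F\<close> by blast+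
  have v: "v \<notin> F" "F \<in> \<Gamma>" "R \<in> \<Gamma>" using \<Gamma> assms(4)[of F] by simp_all
  have "insert v R \<notin> ?\<Delta>"
  proof
    assume "insert v R \<in> ?\<Delta>"
    then obtain G where "G \<in> \<Lambda>" "insert v R = insert v G" using assms(4) by blast
    moreover have "v \<notin> R" "v \<notin> G" using v(3) \<open>G \<in> \<Lambda>\<close> assms(4) shelled_step.prems by auto
    ultimately have "R = G" by (simp add: insert_ident)
    then show False using \<open>G \<in> \<Lambda>\<close> shelled_step.hyps by blast
  qed
  moreover have "insert v F - {x} \<in> ?\<Delta>" if "x \<in> insert v R" for x
  proof (cases "x = v")
    case False
    then have "F - {x} \<in> \<Lambda>" "insert v F - {x} = insert v (F - {x})"
      using that shelled_step.hyps by auto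
    then show ?thesis by auto
  qed (use v in simp)
  ultimately have "shelled (Suc s) (?\<Delta> \<union> {G. insert v R \<subseteq> G \<and> G \<subseteq> insert v F})"
  proof (intro shelled.shelled_step)
    show "shelled (Suc s) ?\<Delta>" using shelled_step.IH shelled_step.prems by simp
  qed (use shelled_step.hyps v in auto)
  also have "{G. insert v R \<subseteq> G \<and> G \<subseteq> insert v F} = insert v ` {G. R \<subseteq> G \<and> G \<subseteq> F}"
  proof (intro equalityI subsetI)
    fix G assume "G \<in> {G. insert v R \<subseteq> G \<and> G \<subseteq> insert v F}"
    then have "G = insert v (G - {v})" "R \<subseteq> G - {v}" "G - {v} \<subseteq> F"
      using v shelled_step.hyps by auto
    then show "G \<in> insert v ` {G. R \<subseteq> G \<and> G \<subseteq> F}" by blast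
  qed auto
  finally show ?case by (simp add: image_Un Un_assoc)
qed

text \<open>
  Remove a vertex \<open>v\<close>: the complex is the deletion of \<open>v\<close> with a cone glued along the link. In terms
  of rings, the depth of \<open>S/I\<close> is at least the minimum of those of \<open>S/(I + x\<^sub>v)\<close> and \<open>S/(I : x\<^sub>v)\<close>.
\<close>
lemma shelled_by_vertex:
  assumes \<Gamma>: "down_closed \<Gamma>" and "shelled (Suc s) {G \<in> \<Gamma>. v \<notin> G}"
    and "shelled s {G. v \<notin> G \<and> insert v G \<in> \<Gamma>}"
  shows "shelled (Suc s) \<Gamma>"
proof -
  let ?D = "{G \<in> \<Gamma>. v \<notin> G}" and ?L = "{G. v \<notin> G \<and> insert v G \<in> \<Gamma>}"
  have "shelled (Suc s) (?D \<union> insert v ` ?L)"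
    using down_closedD[OF \<Gamma>] by (intro shelled_glue_cone assms) blast+
  also have "?D \<union> insert v ` ?L = \<Gamma>"
  proof (intro equalityI subsetI)
    fix G assume "G \<in> \<Gamma>"
    then show "G \<in> ?D \<union> insert v ` ?L"
      by (cases "v \<in> G") (auto simp: insert_absorb intro!: image_eqI[of _ _ "G - {v}"])
  qed auto
  finally show ?thesis .
qed

lemma shelled_cone:
  assumes "shelled s \<Gamma>" "\<And>G. G \<in> \<Gamma> \<Longrightarrow> v \<notin> G"
  shows "shelled (Suc s) {G. G - {v} \<in> \<Gamma>}"
  using assms
proof (induction rule: shelled.induct)
  case (shelled_step \<Gamma> F R)
  let ?\<Delta> = "{G. G - {v} \<in> \<Gamma>}"
  have v: "v \<notin> F" using shelled_step.prems[of F] \<open>R \<subseteq> F\<close> by simp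
  then have R: "R - {v} = R" using \<open>R \<subseteq> F\<close> by auto
  have "shelled (Suc s) (?\<Delta> \<union> {G. R \<subseteq> G \<and> G \<subseteq> insert v F})"
  proof (intro shelled.shelled_step)
    show "shelled (Suc s) ?\<Delta>" using shelled_step.IH shelled_step.prems by simp
    show "R \<notin> ?\<Delta>" using \<open>R \<notin> \<Gamma>\<close> R by simp
    show "insert v F - {x} \<in> ?\<Delta>" if "x \<in> R" for x
    proof -
      have "insert v F - {x} - {v} = F - {x}" using v by auto
      then show ?thesis using that shelled_step.hyps by simp
    qed
  qed (use shelled_step.hyps v in auto)
  also have "?\<Delta> \<union> {G. R \<subseteq> G \<and> G \<subseteq> insert v F} = {G. G - {v} \<in> \<Gamma> \<union> {G. R \<subseteq> G \<and> G \<subseteq> F}}"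
    using v shelled_step.hyps(4) by auto
  finally show ?case .
qed (simp add: shelled_empty)

text \<open>
  To build \<open>\<Delta>\<close> it is not necessary to prescribe an order. Choose a maximal subcomplex \<open>\<Gamma>\<close> that contains
  \<open>\<Gamma>\<^sub>0\<close> and can be built. It is closed under the rule in the assumption, since otherwise the interval
  \<open>[R, F]\<close> could be added. If this closure forces all faces with fewer than \<open>r\<close> vertices into \<open>\<Gamma>\<close>, the
  rule with \<open>R = F\<close> gives the larger faces, by induction on their size.
\<close>
lemma shelled_by_closure:
  assumes fin: "finite \<Delta>" "\<And>G. G \<in> \<Delta> \<Longrightarrow> finite G" and \<Delta>: "down_closed \<Delta>"
    and base: "shelled r \<Gamma>\<^sub>0" "\<Gamma>\<^sub>0 \<subseteq> \<Delta>"
    and closure: "\<And>\<Gamma> G. \<Gamma>\<^sub>0 \<subseteq> \<Gamma> \<Longrightarrow> \<Gamma> \<subseteq> \<Delta> \<Longrightarrow> down_closed \<Gamma> \<Longrightarrow>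
      (\<And>F R. F \<in> \<Delta> \<Longrightarrow> r \<le> card F \<Longrightarrow> R \<subseteq> F \<Longrightarrow> (\<And>x. x \<in> R \<Longrightarrow> F - {x} \<in> \<Gamma>) \<Longrightarrow> R \<in> \<Gamma>) \<Longrightarrow>
      G \<in> \<Delta> \<Longrightarrow> card G < r \<Longrightarrow> G \<in> \<Gamma>"
  shows "shelled r \<Delta>"
proof -
  define M where "M = {\<Gamma>. \<Gamma>\<^sub>0 \<subseteq> \<Gamma> \<and> \<Gamma> \<subseteq> \<Delta> \<and> shelled r \<Gamma>}"
  have "finite M" unfolding M_def by (rule finite_subset[of _ "Pow \<Delta>"]) (use fin in auto)
  moreover have "M \<noteq> {}" using base by (auto simp: M_def)
  ultimately obtain \<Gamma> where \<Gamma>: "\<Gamma> \<in> M" and max: "\<And>\<Gamma>'. \<Gamma>' \<in> M \<Longrightarrow> \<Gamma> \<subseteq> \<Gamma>' \<Longrightarrow> \<Gamma> = \<Gamma>'"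
    using finite_has_maximal[of M] by blast
  have sh: "shelled r \<Gamma>" "\<Gamma>\<^sub>0 \<subseteq> \<Gamma>" "\<Gamma> \<subseteq> \<Delta>" "down_closed \<Gamma>"
    using \<Gamma> shelled_down_closed by (auto simp: M_def)
  have rule: "R \<in> \<Gamma>" if R: "F \<in> \<Delta>" "r \<le> card F" "R \<subseteq> F" "\<And>x. x \<in> R \<Longrightarrow> F - {x} \<in> \<Gamma>" for F R
  proof (rule ccontr)
    assume "R \<notin> \<Gamma>"
    then have "shelled r (\<Gamma> \<union> {G. R \<subseteq> G \<and> G \<subseteq> F})"
      using R sh fin by (intro shelled_step) auto
    then have "\<Gamma> \<union> {G. R \<subseteq> G \<and> G \<subseteq> F} \<in> M"
      using sh R(1) down_closedD[OF \<Delta>] by (auto simp: M_def)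
    then show False using max[of "\<Gamma> \<union> {G. R \<subseteq> G \<and> G \<subseteq> F}"] \<open>R \<notin> \<Gamma>\<close> R(3) by blast
  qed
  have "G \<in> \<Gamma>" if "G \<in> \<Delta>" for G
    using fin(2)[OF that] that
  proof (induction G rule: finite_psubset_induct)
    case (psubset G)
    show ?case
    proof (cases "card G < r")
      case True
      show ?thesis
      proof (rule closure[OF sh(2,3,4)])
        show "R \<in> \<Gamma>" if "F \<in> \<Delta>" "r \<le> card F" "R \<subseteq> F" "\<And>x. x \<in> R \<Longrightarrow> F - {x} \<in> \<Gamma>" for F R
          by (rule rule[OF that])
      qed (fact psubset.prems True)+
    next
      case False
      have "G - {x} \<in> \<Gamma>" if "x \<in> G" for x
        using that down_closedD[OF \<Delta> psubset.prems, of "G - {x}"] by (intro psubset.IH) auto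
      then show ?thesis using rule[of G G] False psubset.prems by simp
    qed
  qed
  then have "\<Gamma> = \<Delta>" using sh by blast
  then show ?thesis using sh by simp
qed

text \<open>
  A connected complex: starting from one edge, each vertex is attached by an edge.
\<close>
lemma shelled_complete_graph:
  assumes fin: "finite V" "2 \<le> card V" and \<Delta>: "down_closed \<Delta>" "\<Delta> \<subseteq> Pow V"
    and pairs: "\<And>a b. a \<in> V \<Longrightarrow> b \<in> V \<Longrightarrow> {a, b} \<in> \<Delta>"
  shows "shelled 2 \<Delta>"
proof -
  have "\<not> card V \<le> Suc 0" using fin by simp
  then obtain a b where ab: "a \<in> V" "b \<in> V" "a \<noteq> b" using card_le_Suc0_iff_eq[OF fin(1)] by blast
  show ?thesis
  proof (rule shelled_by_closure)
    show "finite \<Delta>" using \<Delta> fin finite_subset by blast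
    show "shelled 2 (Pow {a, b})" using ab by (intro shelled_simplex) auto
    show "Pow {a, b} \<subseteq> \<Delta>" using down_closedD[OF \<Delta>(1) pairs[OF ab(1,2)]] by blast
    fix \<Gamma> G
    assume \<Gamma>: "Pow {a, b} \<subseteq> \<Gamma>" "\<Gamma> \<subseteq> \<Delta>" "down_closed \<Gamma>" "G \<in> \<Delta>" "card G < 2"
      and rule: "\<And>F R. F \<in> \<Delta> \<Longrightarrow> 2 \<le> card F \<Longrightarrow> R \<subseteq> F \<Longrightarrow> (\<And>x. x \<in> R \<Longrightarrow> F - {x} \<in> \<Gamma>) \<Longrightarrow> R \<in> \<Gamma>"
    have "finite G" using \<Gamma>(4) \<Delta>(2) finite_subset[OF _ fin(1)] by blast
    then consider "G = {}" | c where "G = {c}"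
      using \<Gamma>(5) by (cases "card G") (auto simp: card_Suc_eq)
    then show "G \<in> \<Gamma>"
    proof cases
      case 2
      show ?thesis
      proof (cases "c = a")
        case False
        have "{a, c} - {c} = {a}" using False by auto
        moreover have "{a, c} \<in> \<Delta>" using \<Gamma>(4) \<Delta>(2) 2 pairs ab(1) by blast
        moreover have "{a} \<in> \<Gamma>" using \<Gamma>(1) by auto
        ultimately show ?thesis using rule[of "{a, c}" "{c}"] False 2 by simp
      qed (use \<Gamma> 2 in auto)
    qed (use \<Gamma> in auto)
  qed (use \<Delta> finite_subset[OF _ fin(1)] in \<open>blast\<close>)+
qed

lemma shelled_nonempty:
  assumes "finite \<Delta>" "\<And>G. G \<in> \<Delta> \<Longrightarrow> finite G" "down_closed \<Delta>" "{c} \<in> \<Delta>"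
  shows "shelled 1 \<Delta>"
proof (rule shelled_by_closure[OF assms(1-3)])
  show "shelled 1 (Pow {c})" by (rule shelled_simplex) auto
  show "Pow {c} \<subseteq> \<Delta>" using down_closedD[OF assms(3,4)] by blast
  fix \<Gamma> G assume "Pow {c} \<subseteq> \<Gamma>" "G \<in> \<Delta>" "card G < 1"
  then show "G \<in> \<Gamma>" using assms(2)[of G] by auto
qed

lemma shelled_points:
  assumes "finite V" "c \<in> V"
  shows "shelled 1 {G. G \<subseteq> V \<and> (\<forall>x\<in>G. \<forall>y\<in>G. x = y)}"
proof (rule shelled_nonempty)
  show "finite {G. G \<subseteq> V \<and> (\<forall>x\<in>G. \<forall>y\<in>G. x = y)}"
    by (rule finite_subset[of _ "Pow V"]) (use assms in auto)
  show "down_closed {G. G \<subseteq> V \<and> (\<forall>x\<in>G. \<forall>y\<in>G. x = y)}" unfolding down_closed_def by blast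
  show "{c} \<in> {G. G \<subseteq> V \<and> (\<forall>x\<in>G. \<forall>y\<in>G. x = y)}" using assms by simp
  show "finite G" if "G \<in> {G. G \<subseteq> V \<and> (\<forall>x\<in>G. \<forall>y\<in>G. x = y)}" for G
    using that finite_subset[OF _ assms(1), of G] by blast
qed

lemma shelled_by_vertex':
  assumes "down_closed \<Gamma>" "{G \<in> \<Gamma>. v \<notin> G} = A" "{G. v \<notin> G \<and> insert v G \<in> \<Gamma>} = B"
    and "shelled (Suc s) A" "shelled s B"
  shows "shelled (Suc s) \<Gamma>"
  using shelled_by_vertex[OF assms(1), of s v] assms by simp

lemma shelled_Suc:
  "shelled (Suc 1) = shelled 2" "shelled (Suc 2) = shelled 3" "shelled (Suc 3) = shelled 4"
  by (simp_all add: eval_nat_numeral)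

text \<open>
  The deletion of 1 from \<open>\<Delta>\<close> for \<open>v = x\<^sub>2x\<^sub>3x\<^sub>j\<close>. Splitting at 2 and 3 leaves only simplices; the smallest,
  on \<open>{j + 1..n}\<close>, has to have two vertices.
\<close>
lemma shelled_small_faces_on_23:
  assumes "3 < j" "j + 2 \<le> n"
  shows "shelled 4 {G :: nat set. G \<subseteq> {2..n} \<and> (2 \<in> G \<longrightarrow> 3 \<in> G \<longrightarrow> (\<forall>c\<in>G. 3 < c \<longrightarrow> j < c))}"
    (is "shelled 4 ?D")
proof -
  let ?B = "{G. G \<subseteq> {3..n} \<and> (3 \<in> G \<longrightarrow> (\<forall>c\<in>G. 3 < c \<longrightarrow> j < c))}"
  have eqs: "{3..n} = {2..n} - {2}" "{4..n} = {3..n} - {3}"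
    "{j + 1..n} = {c \<in> {3..n} - {3}. 3 < c \<longrightarrow> j < c}" and mem: "2 \<in> {2..n}" "3 \<in> {3..n}"
    using assms by auto
  have B: "shelled (Suc 2) ?B"
  proof (rule shelled_by_vertex')
    show "down_closed ?B" unfolding down_closed_def by blast
    show "{G \<in> ?B. 3 \<notin> G} = Pow {4..n}" unfolding eqs(2) by blast
    show "{G. 3 \<notin> G \<and> insert 3 G \<in> ?B} = Pow {j + 1..n}"
      unfolding eqs(3) using mem by (simp add: Pow_def subset_iff) blast
  qed (use assms in \<open>auto intro!: shelled_simplex\<close>)
  have "shelled (Suc 3) ?D"
  proof (rule shelled_by_vertex')
    show "down_closed ?D" unfolding down_closed_def by blast
    show "{G \<in> ?D. 2 \<notin> G} = Pow {3..n}" unfolding eqs(1) by blast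
    show "{G. 2 \<notin> G \<and> insert 2 G \<in> ?D} = ?B"
    proof (rule Set.set_eqI)
      fix G
      have "2 \<notin> G \<and> insert 2 G \<subseteq> {2..n} \<longleftrightarrow> G \<subseteq> {3..n}" unfolding eqs(1) using mem by blast
      then show "G \<in> {G. 2 \<notin> G \<and> insert 2 G \<in> ?D} \<longleftrightarrow> G \<in> ?B" by simp blast
    qed
    show "shelled (Suc 3) (Pow {3..n})" using assms by (intro shelled_simplex) auto
    show "shelled 3 ?B" using B by (simp only: shelled_Suc)
  qed
  then show ?thesis by (simp only: shelled_Suc)
qed

text \<open>
  For \<open>i2 = 4\<close> and \<open>m = i3 - 1\<close> this is the part of the link of 1 on the vertices up to \<open>m\<close>: the
  vertices above 4 are pairwise not adjacent. Splitting at 3 leaves an iterated cone with apexes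
  2 and 4 over these points, and a second complex, which is split once more at 2.
\<close>
lemma shelled_isolated_tail:
  assumes "3 < j" "j < m"
  shows "shelled 3 {G :: nat set. G \<subseteq> {2..m} \<and> (\<forall>b\<in>G. \<forall>c\<in>G. 4 < b \<longrightarrow> 4 < c \<longrightarrow> b = c) \<and>
    (2 \<in> G \<longrightarrow> 3 \<in> G \<longrightarrow> (\<forall>c\<in>G. 3 < c \<longrightarrow> j < c))}" (is "shelled 3 ?N")
proof -
  define amo :: "nat set \<Rightarrow> bool" where "amo G \<longleftrightarrow> (\<forall>b\<in>G. \<forall>c\<in>G. 4 < b \<longrightarrow> 4 < c \<longrightarrow> b = c)" for G
  have amo_insert: "amo (insert x G) \<longleftrightarrow> amo G" if "x \<le> 4" for x G
    using that by (auto simp: amo_def)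
  have amo_Diff: "amo (G - {x}) \<longleftrightarrow> amo G" if "x \<le> 4" for x G
    using that by (auto simp: amo_def)
  have amo_mono: "amo H" if "amo G" "H \<subseteq> G" for G H
    using that unfolding amo_def by blast
  have P: "shelled 1 {G. G \<subseteq> {l..m} \<and> amo G}" if "4 < l" "l \<le> m" for l
  proof -
    have "amo G \<longleftrightarrow> (\<forall>x\<in>G. \<forall>y\<in>G. x = y)" if "G \<subseteq> {l..m}" for G
    proof -
      have "4 < x" if "x \<in> G" for x
        using that \<open>G \<subseteq> {l..m}\<close> \<open>4 < l\<close> by (meson atLeastAtMost_iff less_le_trans subsetD)
      then show ?thesis unfolding amo_def by blast
    qed
    then have "{G. G \<subseteq> {l..m} \<and> amo G} = {G. G \<subseteq> {l..m} \<and> (\<forall>x\<in>G. \<forall>y\<in>G. x = y)}"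
      by (intro Collect_cong conj_cong refl)
    then show ?thesis using that shelled_points[of "{l..m}" l] by simp
  qed
  have eqs: "{5..m} = {2..m} - {2} - {3} - {4}"
    "{j + 1..m} = {c \<in> {2..m} - {2} - {3}. 3 < c \<longrightarrow> j < c}" using assms by auto
  have mem: "2 \<in> {2..m}" "3 \<in> {2..m}" "4 \<in> {2..m}" using assms by auto
  let ?Q = "{G. G \<subseteq> {2..m} \<and> 2 \<notin> G \<and> 3 \<notin> G \<and> amo G}"
  have Q: "shelled (Suc 1) ?Q"
  proof -
    have "shelled (Suc 1) {G. G - {4} \<in> {G. G \<subseteq> {5..m} \<and> amo G}}"
      using assms by (intro shelled_cone P) auto
    also have "{G. G - {4} \<in> {G. G \<subseteq> {5..m} \<and> amo G}} = ?Q"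
    proof (rule Set.set_eqI)
      fix G
      have "G - {4} \<subseteq> W - {2} - {3} - {4} \<longleftrightarrow> G \<subseteq> W \<and> 2 \<notin> G \<and> 3 \<notin> G" if "4 \<in> W" for W :: "nat set"
        using that by auto
      from this[OF mem(3)] have "G - {4} \<subseteq> {5..m} \<longleftrightarrow> G \<subseteq> {2..m} \<and> 2 \<notin> G \<and> 3 \<notin> G"
        unfolding eqs(1) .
      moreover have "amo (G - {4}) \<longleftrightarrow> amo G" by (simp add: amo_Diff)
      ultimately show "G \<in> {G. G - {4} \<in> {G. G \<subseteq> {5..m} \<and> amo G}} \<longleftrightarrow> G \<in> ?Q"
        unfolding mem_Collect_eq by blast
    qed
    finally show ?thesis .
  qed
  let ?B = "{G. G \<subseteq> {2..m} \<and> 3 \<notin> G \<and> amo G \<and> (2 \<in> G \<longrightarrow> (\<forall>c\<in>G. 3 < c \<longrightarrow> j < c))}"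
  have B: "shelled (Suc 1) ?B"
  proof (rule shelled_by_vertex')
    show "down_closed ?B" unfolding down_closed_def using amo_mono by blast
    show "{G \<in> ?B. 2 \<notin> G} = ?Q" by blast
    show "{G. 2 \<notin> G \<and> insert 2 G \<in> ?B} = {G. G \<subseteq> {j + 1..m} \<and> amo G}"
    proof (rule Set.set_eqI)
      fix G
      have "G \<subseteq> {j + 1..m} \<longleftrightarrow> G \<subseteq> {2..m} \<and> 2 \<notin> G \<and> 3 \<notin> G \<and> (\<forall>c\<in>G. 3 < c \<longrightarrow> j < c)"
        unfolding eqs(2) by blast
      moreover have "amo (insert 2 G) \<longleftrightarrow> amo G" by (simp add: amo_insert)
      moreover have "(\<forall>c\<in>insert 2 G. 3 < c \<longrightarrow> j < c) \<longleftrightarrow> (\<forall>c\<in>G. 3 < c \<longrightarrow> j < c)" by simp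
      moreover have "insert 2 G \<subseteq> {2..m} \<longleftrightarrow> G \<subseteq> {2..m}" "3 \<in> insert 2 G \<longleftrightarrow> 3 \<in> G" using mem by auto
      ultimately show "G \<in> {G. 2 \<notin> G \<and> insert 2 G \<in> ?B} \<longleftrightarrow> G \<in> {G. G \<subseteq> {j + 1..m} \<and> amo G}"
        unfolding mem_Collect_eq by blast
    qed
    show "shelled 1 {G. G \<subseteq> {j + 1..m} \<and> amo G}" using assms by (intro P) auto
  qed (rule Q)
  have "shelled (Suc 2) {G. G \<subseteq> {2..m} \<and> amo G \<and> (2 \<in> G \<longrightarrow> 3 \<in> G \<longrightarrow> (\<forall>c\<in>G. 3 < c \<longrightarrow> j < c))}"
    (is "shelled (Suc 2) ?N'")
  proof (rule shelled_by_vertex')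
    show "down_closed ?N'" unfolding down_closed_def using amo_mono by blast
    show "{G \<in> ?N'. 3 \<notin> G} = {G. G - {2} \<in> ?Q}"
    proof (rule Set.set_eqI)
      fix G
      have "G - {2} \<subseteq> {2..m} \<longleftrightarrow> G \<subseteq> {2..m}" using mem by blast
      moreover have "amo (G - {2}) \<longleftrightarrow> amo G" by (simp add: amo_Diff)
      moreover have "3 \<in> G - {2} \<longleftrightarrow> 3 \<in> G" by simp
      ultimately show "G \<in> {G \<in> ?N'. 3 \<notin> G} \<longleftrightarrow> G \<in> {G. G - {2} \<in> ?Q}"
        unfolding mem_Collect_eq by blast
    qed
    show "{G. 3 \<notin> G \<and> insert 3 G \<in> ?N'} = ?B"
    proof (rule Set.set_eqI)
      fix G
      have "insert 3 G \<subseteq> {2..m} \<longleftrightarrow> G \<subseteq> {2..m}" "2 \<in> insert 3 G \<longleftrightarrow> 2 \<in> G" using mem by auto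
      moreover have "amo (insert 3 G) \<longleftrightarrow> amo G" by (simp add: amo_insert)
      moreover have "(\<forall>c\<in>insert 3 G. 3 < c \<longrightarrow> j < c) \<longleftrightarrow> (\<forall>c\<in>G. 3 < c \<longrightarrow> j < c)" by simp
      ultimately show "G \<in> {G. 3 \<notin> G \<and> insert 3 G \<in> ?N'} \<longleftrightarrow> G \<in> ?B"
        unfolding mem_Collect_eq by blast
    qed
    have "shelled 2 ?Q" using Q by (simp only: shelled_Suc)
    then show "shelled (Suc 2) {G. G - {2} \<in> ?Q}"
      by (rule shelled_cone) blast
    show "shelled 2 ?B" using B by (simp only: shelled_Suc)
  qed
  then show ?thesis by (simp only: amo_def shelled_Suc)
qed

section \<open>A sequence that is regular for all partial shellings\<close>

definition esym :: "nat \<Rightarrow> nat \<Rightarrow> ((nat \<Rightarrow>\<^sub>0 nat) \<Rightarrow>\<^sub>0 'k::field)" where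
  "esym n r = (\<Sum>T | T \<subseteq> {1..n} \<and> card T = r. monom (squarefree_exponent T))"

text \<open>
  The order is decreasing. The first element then restricts to the monomial \<open>x\<^sub>F\<close> on a simplex \<open>F\<close> with \<open>r\<close>
  vertices, which leaves the boundary of \<open>F\<close>, a complex again.
\<close>
primrec esyms :: "nat \<Rightarrow> nat \<Rightarrow> ((nat \<Rightarrow>\<^sub>0 nat) \<Rightarrow>\<^sub>0 'k::field) list" where
  "esyms n 0 = []"
| "esyms n (Suc r) = esym n (Suc r) # esyms n r"

lemma length_esyms [simp]: "length (esyms n r) = r"
  by (induction r) auto

lemma mons_esym: "w \<in> mons (esym n r) \<Longrightarrow> \<exists>T. T \<subseteq> {1..n} \<and> card T = r \<and> w = squarefree_exponent T"
  using Poly_Mapping.keys_sum[of "\<lambda>T. monom (squarefree_exponent T)" "{T. T \<subseteq> {1..n} \<and> card T = r}"]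
  by (auto simp: esym_def monom_def)

lemma esym_polys: "esym n r \<in> polys n"
  unfolding esym_def by (intro poly.sum_C monom_squarefree_polys) simp

lemma homogeneous_esym: "homogeneous r (esym n r)"
  unfolding homogeneous_def
proof
  fix w assume "w \<in> mons (esym n r)"
  then obtain T where "T \<subseteq> {1..n}" "card T = r" "w = squarefree_exponent T" using mons_esym by blast
  then show "deg w = r" using deg_squarefree finite_subset[of T "{1..n}"] by simp
qed

lemma set_esyms: "f \<in> set (esyms n r) \<Longrightarrow> \<exists>i. 0 < i \<and> i \<le> r \<and> f = esym n i"
proof (induction r)
  case (Suc r)
  show ?case
  proof (cases "f = esym n (Suc r)")
    case True
    then show ?thesis by blast
  next
    case False
    then show ?thesis using Suc le_SucI by (metis esyms.simps(2) set_ConsD)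
  qed
qed simp

lemma set_esyms_polys: "set (esyms n r) \<subseteq> polys n"
  by (induction r) (simp_all add: esym_polys)

lemma weakly_regular_shelled:
  assumes simplex: "\<And>F. F \<subseteq> {1..n} \<Longrightarrow> r \<le> card F \<Longrightarrow> poly.weakly_regular n (face_ideal n (Pow F)) fs"
    and fs: "set fs \<subseteq> (polys n :: ((nat \<Rightarrow>\<^sub>0 nat) \<Rightarrow>\<^sub>0 'k::field) set)"
    and "shelled r \<Gamma>" "\<Gamma> \<subseteq> Pow {1..n}"
  shows "poly.weakly_regular n (face_ideal n \<Gamma>) fs"
  using assms(3,4)
proof (induction rule: shelled.induct)
  case shelled_empty
  have "face_ideal n {} = (polys n :: ((nat \<Rightarrow>\<^sub>0 nat) \<Rightarrow>\<^sub>0 'k) set)" by (simp add: face_ideal_def)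
  then show ?case using poly.weakly_regular_C fs by simp
next
  case (shelled_step \<Gamma> F R)
  let ?\<Delta> = "\<Gamma> \<union> {G. R \<subseteq> G \<and> G \<subseteq> F}"
  have \<Delta>: "down_closed ?\<Delta>"
    using shelled.shelled_step[OF shelled_step.hyps] shelled_down_closed by blast
  have \<Gamma>: "down_closed \<Gamma>" using shelled_step.hyps shelled_down_closed by blast
  have F: "F \<subseteq> {1..n}" "R \<subseteq> {1..n}" using shelled_step by auto
  have new: "G \<notin> \<Gamma>" if "R \<subseteq> G" for G using that shelled_step.hyps(5) down_closedD[OF \<Gamma>] by blast
  show ?case
  proof (rule poly.weakly_regular_extension[OF ideal_face_ideal[OF \<Delta>] monom_squarefree_polys[OF F(2)] fs])
    have "?\<Delta> - {G. R \<subseteq> G} = \<Gamma>" using new by auto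
    then show "poly.weakly_regular n (poly.adjoin n (face_ideal n ?\<Delta>) (monom (squarefree_exponent R))) fs"
      using shelled_step by (simp add: adjoin_face_ideal[OF \<Delta> F(2)])
    show "poly.weakly_regular n (face_ideal n (Pow F)) fs"
      using simplex F shelled_step.hyps by simp
    show "poly.is_ideal n (face_ideal n (Pow F))"
      by (rule ideal_face_ideal) (auto simp: down_closed_def)
    have "{G. G \<union> R \<in> ?\<Delta>} = Pow F" using new shelled_step.hyps(4) by auto
    then show "monom (squarefree_exponent R) * q \<in> face_ideal n ?\<Delta> \<longleftrightarrow> q \<in> face_ideal n (Pow F)"
      if "q \<in> polys n" for q :: "(nat \<Rightarrow>\<^sub>0 nat) \<Rightarrow>\<^sub>0 'k"
      using colon_face_ideal[OF F(2) that, of ?\<Delta>] by simp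
  qed
qed

lemma nonzerodivisor_face_ideal_vertex:
  assumes "v \<in> F" "F \<subseteq> {1..n}"
  shows "poly.nonzerodivisor_mod n (face_ideal n (Pow F)) (monom (squarefree_exponent {v}))"
    and "poly.adjoin n (face_ideal n (Pow F)) (monom (squarefree_exponent {v})) = face_ideal n (Pow (F - {v}))"
proof -
  have v: "{v} \<subseteq> {1..n}" and down: "down_closed (Pow F)" using assms by (auto simp: down_closed_def)
  have "{G. G \<union> {v} \<in> Pow F} = Pow F" using assms by auto
  then show "poly.nonzerodivisor_mod n (face_ideal n (Pow F)) (monom (squarefree_exponent {v}))"
    unfolding poly.nonzerodivisor_mod_def by (simp add: colon_face_ideal[OF v])
  have "Pow F - {G. {v} \<subseteq> G} = Pow (F - {v})" by auto
  then show "poly.adjoin n (face_ideal n (Pow F)) (monom (squarefree_exponent {v})) = face_ideal n (Pow (F - {v}))"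
    unfolding adjoin_face_ideal[OF down v] by (rule arg_cong)
qed

text \<open>
  Induction on \<open>r\<close>. On a simplex \<open>F\<close> with \<open>r + 1\<close> vertices the polynomial \<open>e\<^bsub>r+1\<^esub>\<close> equals \<open>x\<^sub>F\<close>, a
  nonzerodivisor, and the quotient belongs to the boundary of \<open>F\<close>, which is built from simplices with
  \<open>r\<close> vertices, so the induction hypothesis applies to it. A larger simplex is reduced to this case by
  killing one variable at a time and lifting regularity along it.
\<close>
lemma weakly_regular_esyms_simplex:
  assumes "F \<subseteq> {1..n}" "r \<le> card F"
  shows "poly.weakly_regular n (face_ideal n (Pow F)) (esyms n r :: ((nat \<Rightarrow>\<^sub>0 nat) \<Rightarrow>\<^sub>0 'k::field) list)"
  using assms
proof (induction r arbitrary: F)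
  case 0
  show ?case by (simp only: esyms.simps poly.weakly_regular.simps)
next
  case (Suc r)
  define fs where "fs = (esyms n r :: ((nat \<Rightarrow>\<^sub>0 nat) \<Rightarrow>\<^sub>0 'k) list)"
  have fs: "set fs \<subseteq> polys n" unfolding fs_def by (rule set_esyms_polys)
  have all: "f \<in> polys n \<and> (\<exists>d. homogeneous d f)" if "f \<in> set (esyms n (Suc r))" for f :: "(nat \<Rightarrow>\<^sub>0 nat) \<Rightarrow>\<^sub>0 'k"
    using set_esyms[OF that] esym_polys homogeneous_esym by blast
  have "finite F" using Suc.prems finite_subset by blast
  then show ?case using Suc.prems
  proof (induction F rule: finite_psubset_induct)
    case (psubset F)
    let ?P = "face_ideal n (Pow F) :: ((nat \<Rightarrow>\<^sub>0 nat) \<Rightarrow>\<^sub>0 'k) set"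
    have down: "down_closed (Pow F)" by (auto simp: down_closed_def)
    have P: "poly.is_ideal n ?P" by (rule ideal_face_ideal[OF down])
    show ?case
    proof (cases "card F = Suc r")
      case True
      define x where "x = (monom (squarefree_exponent F) :: (nat \<Rightarrow>\<^sub>0 nat) \<Rightarrow>\<^sub>0 'k)"
      have x: "x \<in> polys n" unfolding x_def by (rule monom_squarefree_polys) fact
      \<comment> \<open>Modulo the ideal of \<open>F\<close> only the monomial of \<open>F\<close> survives in the symmetric polynomial.\<close>
      define d where "d = esym n (Suc r) - x"
      have "d = (\<Sum>T\<in>{T. T \<subseteq> {1..n} \<and> card T = Suc r} - {F}. monom (squarefree_exponent T))"
        unfolding d_def esym_def x_def
        by (subst sum.remove[of _ F]) (use psubset True in \<open>auto\<close>)
      also have "\<dots> \<in> ?P"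
      proof (intro poly.ideal_sum[OF P])
        fix T assume T: "T \<in> {T. T \<subseteq> {1..n} \<and> card T = Suc r} - {F}"
        then have "finite T" "\<not> T \<subseteq> F"
          using finite_subset card_subset_eq[OF psubset.hyps, of T] True by auto
        then show "monom (squarefree_exponent T) \<in> ?P"
          using T monom_squarefree_polys[of T n] by (auto simp: face_ideal_def monom_def)
      qed
      finally have d: "d \<in> ?P" .
      have eq: "esym n (Suc r) = d + x" by (simp add: d_def)
      have adj: "poly.adjoin n ?P (esym n (Suc r)) = poly.adjoin n ?P x"
      proof -
        have "b - (d + x) * c \<in> ?P \<longleftrightarrow> b - x * c \<in> ?P" if "c \<in> polys n" for b c
          using poly.ideal_add[OF P, of "b - (d + x) * c" "d * c"]
            poly.ideal_diff[OF P, of "b - x * c" "d * c"] poly.ideal_mult'[OF P d that]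
          by (auto simp: algebra_simps)
        then show ?thesis unfolding set_eq_iff poly.adjoin_iff[OF P] eq by blast
      qed
      have "poly.nonzerodivisor_mod n ?P (esym n (Suc r))"
        unfolding poly.nonzerodivisor_mod_def
      proof (intro ballI impI)
        fix a :: "(nat \<Rightarrow>\<^sub>0 nat) \<Rightarrow>\<^sub>0 'k"
        assume a: "a \<in> polys n" "esym n (Suc r) * a \<in> ?P"
        have "x * a = esym n (Suc r) * a - d * a" by (simp add: eq algebra_simps)
        also have "\<dots> \<in> ?P" by (intro poly.ideal_diff[OF P] a poly.ideal_mult'[OF P] d)
        finally have "x * a \<in> ?P" .
        moreover have "{G. G \<union> F \<in> Pow F} = Pow F" by auto
        ultimately show "a \<in> ?P"
          using colon_face_ideal[OF psubset.prems(1) a(1), of "Pow F"] by (simp add: x_def)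
      qed
      moreover have "poly.weakly_regular n (poly.adjoin n ?P (esym n (Suc r))) fs"
      proof -
        have "poly.adjoin n ?P x = face_ideal n (Pow F - {G. F \<subseteq> G})"
          unfolding x_def by (rule adjoin_face_ideal[OF down psubset.prems(1)])
        moreover have "poly.weakly_regular n (face_ideal n (Pow F - {G. F \<subseteq> G})) fs"
        proof (rule weakly_regular_shelled[OF _ fs])
          have "shelled r {G. G \<subseteq> F \<and> \<not> F \<subseteq> G}"
            using psubset True by (intro shelled_simplex_minus_star) auto
          also have "{G. G \<subseteq> F \<and> \<not> F \<subseteq> G} = Pow F - {G. F \<subseteq> G}" by auto
          finally show "shelled r (Pow F - {G. F \<subseteq> G})" .
        qed (use Suc.IH psubset.prems in \<open>auto simp: fs_def\<close>)
        ultimately show ?thesis by (simp add: adj)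
      qed
      ultimately show ?thesis by (simp add: fs_def)
    next
      case False
      then obtain v where v: "v \<in> F" using psubset.prems by fastforce
      have IH: "poly.weakly_regular n (face_ideal n (Pow (F - {v}))) (esyms n (Suc r) :: ((nat \<Rightarrow>\<^sub>0 nat) \<Rightarrow>\<^sub>0 'k) list)"
        by (rule psubset.IH) (use v psubset.prems psubset.hyps False in auto)
      show ?thesis
      proof (rule weakly_regular_lift[OF P graded_face_ideal])
        show "homogeneous 1 (monom (squarefree_exponent {v}) :: (nat \<Rightarrow>\<^sub>0 nat) \<Rightarrow>\<^sub>0 'k)"
          by (simp add: homogeneous_def monom_def deg_squarefree)
        show "monom (squarefree_exponent {v}) \<in> polys n"
          using v psubset.prems(1) by (intro monom_squarefree_polys) auto
        show "poly.weakly_regular n (poly.adjoin n ?P (monom (squarefree_exponent {v}))) (esyms n (Suc r))"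
          unfolding nonzerodivisor_face_ideal_vertex(2)[OF v psubset.prems(1)] by (rule IH)
        show "poly.nonzerodivisor_mod n ?P (monom (squarefree_exponent {v}))"
          by (rule nonzerodivisor_face_ideal_vertex(1)[OF v psubset.prems(1)])
        show "f \<in> polys n \<and> (\<exists>d. homogeneous d f)" if "f \<in> set (esyms n (Suc r))" for f :: "(nat \<Rightarrow>\<^sub>0 nat) \<Rightarrow>\<^sub>0 'k"
          by (rule all[OF that])
      qed (rule zero_less_one)
    qed
  qed
qed

theorem weakly_regular_esyms:
  assumes "shelled r \<Gamma>" "\<Gamma> \<subseteq> Pow {1..n}"
  shows "poly.weakly_regular n (face_ideal n \<Gamma>) (esyms n r :: ((nat \<Rightarrow>\<^sub>0 nat) \<Rightarrow>\<^sub>0 'k::field) list)"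
proof (rule weakly_regular_shelled[where r = r])
  show "poly.weakly_regular n (face_ideal n (Pow F)) (esyms n r :: ((nat \<Rightarrow>\<^sub>0 nat) \<Rightarrow>\<^sub>0 'k) list)"
    if "F \<subseteq> {1..n}" "r \<le> card F" for F
    using that by (rule weakly_regular_esyms_simplex)
  show "set (esyms n r :: ((nat \<Rightarrow>\<^sub>0 nat) \<Rightarrow>\<^sub>0 'k) list) \<subseteq> polys n" by (rule set_esyms_polys)
  show "shelled r \<Gamma>" by (rule assms(1))
  show "\<Gamma> \<subseteq> Pow {1..n}" by (rule assms(2))
qed

section \<open>Links bound the length of regular sequences\<close>

definition basis_seq :: "nat \<Rightarrow> nat \<Rightarrow> 'a::comm_ring_1" where
  "basis_seq a t = of_bool (t = a)"

text \<open>
  The exterior product of \<open>e\<^sub>a\<close>, for \<open>a\<close> in \<open>F\<close>, with the cochain \<open>c\<close>: multiplication by \<open>e\<^sub>a\<close> is the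
  Koszul differential for the sequence that is 1 at \<open>a\<close> and 0 elsewhere.
\<close>
primrec wedge :: "nat list \<Rightarrow> (nat list \<Rightarrow> 'a::comm_ring_1) \<Rightarrow> nat list \<Rightarrow> 'a" where
  "wedge [] c = c"
| "wedge (a # F) c = koszul_d (basis_seq a) (wedge F c)"

lemma koszul_d_zero [simp]: "koszul_d y (\<lambda>T. 0) T = 0"
  by (induction T) auto

lemma koszul_d_wedge:
  "koszul_d y (wedge F c) = (\<lambda>T. (-1) ^ length F * wedge F (koszul_d y c) T)"
proof (induction F)
  case (Cons a F)
  show ?case
  proof
    fix T
    have "koszul_d y (wedge (a # F) c) T = - koszul_d (basis_seq a) (koszul_d y (wedge F c)) T"
      by (simp only: wedge.simps koszul_d_anticommute[of y])
    also have "\<dots> = - ((-1) ^ length F * koszul_d (basis_seq a) (wedge F (koszul_d y c)) T)"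
      by (simp only: Cons koszul_d_scale)
    finally show "koszul_d y (wedge (a # F) c) T = (-1) ^ length (a # F) * wedge (a # F) (koszul_d y c) T"
      by simp
  qed
qed simp

lemma koszul_d_basis_wedge:
  "a \<in> set F \<Longrightarrow> koszul_d (basis_seq a) (wedge F c) = (\<lambda>T. 0)"
proof (induction F)
  case (Cons b F)
  show ?case
  proof (cases "a = b")
    case False
    then have eq: "koszul_d (basis_seq a) (wedge F c) = (\<lambda>T. 0)" using Cons by simp
    show ?thesis
      by (rule ext) (simp only: wedge.simps koszul_d_anticommute[of "basis_seq a" "basis_seq b"]
          eq koszul_d_zero minus_zero)
  qed (simp add: fun_eq_iff koszul_d_d)
qed simp

lemma koszul_d_basis_notin:
  "a \<notin> set T \<Longrightarrow> koszul_d (basis_seq a) c T = 0"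
  by (induction T arbitrary: c) (auto simp: basis_seq_def)

lemma wedge_append:
  "distinct F \<Longrightarrow> set F \<inter> set U = {} \<Longrightarrow> wedge F c (F @ U) = c U"
  by (induction F) (auto simp: koszul_d_basis_notin basis_seq_def)

text \<open>
  As \<open>e\<^sub>a e\<^sub>a = 0\<close>, the entries of \<open>y\<close> at the indices in \<open>F\<close> do not contribute to the differential of a
  multiple of the product of the \<open>e\<^sub>a\<close>.
\<close>
lemma koszul_d_wedge_restrict:
  assumes "set L \<subseteq> set F"
  shows "koszul_d (\<lambda>t. if t \<in> set L then 0 else y t) (wedge F c) = koszul_d y (wedge F c)"
  using assms
proof (induction L)
  case (Cons a L)
  let ?z = "\<lambda>t. if t \<in> set L then 0 else y t"
  have "(\<lambda>t. if t \<in> set (a # L) then 0 else y t) = (\<lambda>t. ?z t + - ?z a * (basis_seq a) t)"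
    by (auto simp: basis_seq_def)
  moreover have "koszul_d (basis_seq a) (wedge F c) T = 0" for T
    using koszul_d_basis_wedge[of a F c] Cons.prems by simp
  ultimately show ?case
    using Cons by (simp only: fun_eq_iff koszul_d_add_seq koszul_d_scale_seq) simp
qed simp

lemma (in subring_of) wedge_ideal:
  assumes "is_ideal A" and "\<And>U. length U + length F = length T \<Longrightarrow> c U \<in> A"
  shows "wedge F c T \<in> A"
  using assms(2)
proof (induction F arbitrary: T)
  case (Cons a F)
  show ?case
    unfolding wedge.simps
  proof (rule koszul_d_ideal[OF assms(1)])
    show "wedge F c U \<in> A" if "Suc (length U) = length T" for U
      using that by (intro Cons) simp
  qed (simp add: basis_seq_def)
qed simp

lemma (in subring_of) wedge_C: "(\<And>U. c U \<in> C) \<Longrightarrow> wedge F c T \<in> C"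
proof (induction F arbitrary: T)
  case (Cons a F)
  show ?case
    unfolding wedge.simps by (rule koszul_d_C) (simp_all add: Cons basis_seq_def)
qed simp

text \<open>
  Every term that omits an index of \<open>F\<close> has a factor \<open>y a\<close> with \<open>a\<close> in \<open>F\<close>. So modulo these elements a
  coboundary, evaluated on lists that begin with \<open>F\<close>, is again a coboundary.
\<close>
lemma (in subring_of) koszul_d_append:
  assumes Q: "is_ideal Q" and "\<And>a. a \<in> set F \<Longrightarrow> y a \<in> Q" and "\<And>T. g T \<in> C"
  shows "koszul_d y g (F @ U) - (-1) ^ length F * koszul_d y (\<lambda>V. g (F @ V)) U \<in> Q"
  using assms(2,3)
proof (induction F arbitrary: g)
  case (Cons a F)
  have "koszul_d y (\<lambda>u. g (a # u)) (F @ U) - (-1) ^ length F * koszul_d y (\<lambda>V. g (a # F @ V)) U \<in> Q"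
    using Cons.IH[of "\<lambda>u. g (a # u)"] Cons.prems by simp
  moreover have "y a * g (F @ U) \<in> Q" using Cons.prems by (intro ideal_mult'[OF Q]) simp_all
  ultimately have "y a * g (F @ U) - (koszul_d y (\<lambda>u. g (a # u)) (F @ U) - (-1) ^ length F * koszul_d y (\<lambda>V. g (a # F @ V)) U) \<in> Q"
    using ideal_diff[OF Q] by blast
  then show ?case by (simp add: algebra_simps)
qed (simp add: ideal_zero[OF Q])

text \<open>
  Squares rather than variables: a coboundary \<open>\<Sum>\<^sub>a x\<^sub>a\<^sup>2 g\<^sub>a\<close> over \<open>a \<in> F\<close> has no term whose exponents on
  \<open>F\<close> are all 1, so the monomial \<open>x\<^sub>F\<close> can be used to isolate the link of \<open>F\<close>. The value 0 outside
  \<open>{1..n}\<close> allows cochains on arbitrary lists of naturals.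
\<close>
definition square_var :: "nat \<Rightarrow> nat \<Rightarrow> ((nat \<Rightarrow>\<^sub>0 nat) \<Rightarrow>\<^sub>0 'k::field)" where
  "square_var n t = (if t \<in> {1..n} then monom (Poly_Mapping.single t 2) else 0)"

lemma square_var_polys: "square_var n t \<in> polys n"
  by (auto simp: square_var_def polys_def monom_def)

lemma power_generated:
  fixes f :: "(nat \<Rightarrow>\<^sub>0 nat) \<Rightarrow>\<^sub>0 'k::field"
  assumes "f \<in> face_ideal n {{}}"
  shows "\<exists>K. f ^ K \<in> poly.generated n (square_var n)"
proof -
  have f: "f \<in> polys n" "\<And>w. w \<in> mons f \<Longrightarrow> vars w \<noteq> {}" using assms by (auto simp: face_ideal_def)
  have "1 \<le> deg w" if w: "w \<in> mons f" for w
  proof -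
    obtain i where "i \<in> vars w" using f(2)[OF w] by blast
    then have "0 < coeff w i" "coeff w i \<le> deg w"
      by (auto simp: deg_def Poly_Mapping.in_keys_iff intro: member_le_sum)
    then show ?thesis by simp
  qed
  note deg1 = this
  have degK: "K \<le> deg w" if "w \<in> mons (f ^ K)" for w K
    using that
  proof (induction K arbitrary: w)
    case (Suc K)
    then obtain u v where "w = u + v" "u \<in> mons f" "v \<in> mons (f ^ K)"
      using Poly_Mapping.keys_mult[of f "f ^ K"] by auto
    then show ?case using deg1[of u] Suc.IH[of v] by (simp add: deg_add)
  qed simp
  \<comment> \<open>A monomial of degree above \<open>n\<close> in \<open>n\<close> variables has an exponent that is at least 2.\<close>
  define p where "p = f ^ Suc n"
  have p: "p \<in> polys n" unfolding p_def using f by (intro poly.power_C)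
  have double: "\<exists>i\<in>{1..n}. 2 \<le> coeff w i" if w: "w \<in> mons p" for w
  proof (rule ccontr)
    assume "\<not> ?thesis"
    then have "coeff w i \<le> 1" if "i \<in> {1..n}" for i using that by force
    moreover have "vars w \<subseteq> {1..n}" using p w by (auto simp: polys_def)
    ultimately have "deg w \<le> (\<Sum>i\<in>vars w. 1)" unfolding deg_def by (intro sum_mono) blast
    also have "\<dots> \<le> n" using card_mono[OF _ \<open>vars w \<subseteq> {1..n}\<close>] by simp
    finally show False using degK[of w "Suc n"] w by (simp add: p_def)
  qed
  have "(\<Sum>w\<in>X. Poly_Mapping.single w (coeff p w)) \<in> poly.generated n (square_var n)"
    if "finite X" "X \<subseteq> mons p" for X
    using that
  proof (induction X)
    case (insert w X)
    then obtain i where i: "i \<in> {1..n}" "2 \<le> coeff w i" using double by blast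
    define v where "v = w - Poly_Mapping.single i 2"
    have w: "w = v + Poly_Mapping.single i 2"
      by (rule poly_mapping_eqI) (use i in \<open>auto simp: v_def Poly_Mapping.lookup_add
          Poly_Mapping.lookup_minus Poly_Mapping.lookup_single when_def\<close>)
    have "vars w \<subseteq> {1..n}" using p insert.prems by (auto simp: polys_def)
    then have "Poly_Mapping.single v (coeff p w) \<in> polys n"
      using w by (auto simp: polys_def vars_add)
    from poly.generated_step[OF insert.IH this, of i] insert.prems
    have "(\<Sum>w\<in>X. Poly_Mapping.single w (coeff p w)) + Poly_Mapping.single v (coeff p w) * square_var n i
        \<in> poly.generated n (square_var n)" by simp
    also have "Poly_Mapping.single v (coeff p w) * square_var n i = Poly_Mapping.single w (coeff p w)"
      using i by (simp add: square_var_def monom_def Poly_Mapping.mult_single w[symmetric])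
    finally show ?case using insert.hyps by (simp add: add.commute)
  qed (simp add: poly.generated_zero)
  from this[of "mons p"] have "p \<in> poly.generated n (square_var n)"
    by (simp flip: sum_terms)
  then show ?thesis unfolding p_def by blast
qed

definition squares :: "nat list \<Rightarrow> (nat \<Rightarrow>\<^sub>0 nat)" where
  "squares U = (\<Sum>t\<leftarrow>U. Poly_Mapping.single t 2)"

lemma squares_simps [simp]: "squares [] = 0" "squares (t # U) = Poly_Mapping.single t 2 + squares U"
  by (simp_all add: squares_def)

lemma vars_squares: "vars (squares U) = set U"
  by (induction U) (auto simp: vars_add)

text \<open>
  In a fixed multidegree the Koszul differential is the simplicial coboundary.
\<close>
lemma coeff_koszul_d_square_var:
  assumes "set U \<subseteq> {1..n}"
  shows "coeff (koszul_d (square_var n) h U) (e + squares U)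
    = koszul_d (\<lambda>_. 1) (\<lambda>V. coeff (h V) (e + squares V)) U"
  using assms
proof (induction U arbitrary: h e)
  case (Cons t U)
  have eq: "e + squares (t # U) = Poly_Mapping.single t 2 + (e + squares U)" by (simp add: add_ac)
  have "coeff (square_var n t * h U) (e + squares (t # U)) = coeff (h U) (e + squares U)"
    unfolding eq using Cons.prems by (simp add: square_var_def coeff_monom_mult)
  moreover have "coeff (koszul_d (square_var n) (\<lambda>u. h (t # u)) U) (e + squares (t # U))
      = koszul_d (\<lambda>_. 1) (\<lambda>V. coeff (h (t # V)) (e + squares (t # V))) U"
    using Cons.IH[of "\<lambda>u. h (t # u)" "e + Poly_Mapping.single t 2"] Cons.prems by (simp add: add.assoc)
  ultimately show ?case by (simp add: Poly_Mapping.lookup_minus)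
qed simp

lemma koszul_d_constant_multiples:
  fixes \<phi> :: "nat list \<Rightarrow> 'k::field" and y :: "nat \<Rightarrow> ((nat \<Rightarrow>\<^sub>0 nat) \<Rightarrow>\<^sub>0 'k)"
  shows "koszul_d y (\<lambda>U. Poly_Mapping.single 0 (\<phi> U) * w * prod_list (map y U)) V
    = Poly_Mapping.single 0 (koszul_d (\<lambda>_. 1) \<phi> V) * w * prod_list (map y V)"
proof (induction V arbitrary: \<phi>)
  case (Cons t V)
  have "koszul_d y (\<lambda>U. Poly_Mapping.single 0 (\<phi> (t # U)) * w * prod_list (map y (t # U))) V
      = koszul_d y (\<lambda>U. y t * (Poly_Mapping.single 0 (\<phi> (t # U)) * w * prod_list (map y U))) V"
    by (simp add: mult_ac)
  also have "\<dots> = y t * (Poly_Mapping.single 0 (koszul_d (\<lambda>_. 1) (\<lambda>U. \<phi> (t # U)) V) * w * prod_list (map y V))"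
    by (simp only: koszul_d_scale Cons)
  finally show ?case by (simp add: algebra_simps Poly_Mapping.single_diff)
qed simp

text \<open>
  The map \<open>koszul_d (\<lambda>_. 1)\<close> is the simplicial coboundary on ordered cochains, so the conclusion says that
  each cocycle \<open>\<phi>\<close> of the link of \<open>F\<close> on \<open>q\<close> vertices is a coboundary. From \<open>\<phi>\<close> one forms the Koszul
  cochain \<open>e\<^sub>F \<and> \<phi>(U) x\<^sub>F x\<^sub>U\<^sup>2\<close>. It is a cocycle modulo the ideal, since \<open>x\<^sub>F x\<^sub>U\<^sup>2\<close> lies in the ideal unless
  \<open>F \<union> U\<close> is a face. Regularity makes it a coboundary, and the coefficients of \<open>x\<^sub>F x\<^sub>U\<^sup>2\<close> yield \<open>\<psi>\<close>.
\<close>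
theorem link_coboundary:
  fixes \<phi> :: "nat list \<Rightarrow> 'k::field" and fs :: "((nat \<Rightarrow>\<^sub>0 nat) \<Rightarrow>\<^sub>0 'k) list"
  assumes \<Gamma>: "down_closed \<Gamma>" "\<Gamma> \<subseteq> Pow {1..n}" and F: "F \<in> \<Gamma>"
    and reg: "poly.weakly_regular n (face_ideal n \<Gamma>) fs" "set fs \<subseteq> face_ideal n {{}}"
    and len: "card F + q < length fs"
    and cocycle: "\<And>U. length U = Suc q \<Longrightarrow> set U \<inter> F = {} \<Longrightarrow> F \<union> set U \<in> \<Gamma> \<Longrightarrow> koszul_d (\<lambda>_. 1) \<phi> U = 0"
  shows "\<exists>\<psi>. \<forall>U. length U = q \<longrightarrow> set U \<inter> F = {} \<longrightarrow> F \<union> set U \<in> \<Gamma> \<longrightarrow> \<phi> U = koszul_d (\<lambda>_. 1) \<psi> U"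
proof -
  let ?A = "face_ideal n \<Gamma> :: ((nat \<Rightarrow>\<^sub>0 nat) \<Rightarrow>\<^sub>0 'k) set"
  have A: "poly.is_ideal n ?A" by (rule ideal_face_ideal[OF \<Gamma>(1)])
  have Fn: "F \<subseteq> {1..n}" "finite F" using F \<Gamma>(2) finite_subset[of F "{1..n}"] by auto
  obtain L where L: "set L = F" "distinct L" using finite_distinct_list[OF Fn(2)] by blast
  have lenL: "length L = card F" using L distinct_card by metis
  let ?y = "square_var n :: nat \<Rightarrow> ((nat \<Rightarrow>\<^sub>0 nat) \<Rightarrow>\<^sub>0 'k)"
  define y' where "y' t = (if t \<in> set L then 0 else ?y t)" for t
  have y': "y' t \<in> polys n" for t by (simp add: y'_def square_var_polys)
  define w where "w = (monom (squarefree_exponent F) :: (nat \<Rightarrow>\<^sub>0 nat) \<Rightarrow>\<^sub>0 'k)"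
  have w: "w \<in> polys n" unfolding w_def by (rule monom_squarefree_polys[OF Fn(1)])
  define \<phi>' where "\<phi>' U = Poly_Mapping.single 0 (\<phi> U) * w * prod_list (map y' U)" for U
  define c where "c = wedge L \<phi>'"
  have const: "Poly_Mapping.single 0 r \<in> (polys n :: ((nat \<Rightarrow>\<^sub>0 nat) \<Rightarrow>\<^sub>0 'k) set)" for r
    by (simp add: polys_def)
  have prod: "prod_list (map y' U) \<in> polys n" for U
    by (induction U) (auto intro!: poly.mult_C y')
  have \<phi>'C: "\<phi>' U \<in> polys n" for U unfolding \<phi>'_def by (intro poly.mult_C const w prod)
  have prod_eq: "prod_list (map y' U) = monom (squares U)" if "set U \<inter> F = {}" "set U \<subseteq> {1..n}" for U
    using that by (induction U) (auto simp: y'_def L square_var_def monom_def Poly_Mapping.mult_single)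
  have prod_0: "prod_list (map y' U) = 0" if "\<not> (set U \<inter> F = {} \<and> set U \<subseteq> {1..n})" for U
    using that by (induction U) (auto simp: y'_def L square_var_def)
  have w_prod: "w * prod_list (map y' U) = monom (squarefree_exponent F + squares U)"
    if "set U \<inter> F = {}" "set U \<subseteq> {1..n}" for U
    by (simp add: prod_eq[OF that] w_def monom_def Poly_Mapping.mult_single)
  have vars_exp: "vars (squarefree_exponent F + squares U) = F \<union> set U" for U
    by (simp add: vars_add vars_squares Fn)
  have dc: "koszul_d ?y c T \<in> ?A" if T: "length T = Suc (card F + q)" for T
  proof -
    have "koszul_d ?y c T = koszul_d y' c T"
      using koszul_d_wedge_restrict[of L L ?y \<phi>'] by (simp add: c_def y'_def[abs_def])
    also have "\<dots> = (-1) ^ length L * wedge L (koszul_d y' \<phi>') T"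
      by (simp add: c_def koszul_d_wedge)
    also have "\<dots> \<in> ?A"
    proof (intro poly.ideal_mult[OF A] poly.wedge_ideal[OF A])
      fix U :: "nat list" assume "length U + length L = length T"
      then have U: "length U = Suc q" using T lenL by simp
      have eq: "koszul_d y' \<phi>' U
          = Poly_Mapping.single 0 (koszul_d (\<lambda>_. 1) \<phi> U) * (w * prod_list (map y' U))"
        using koszul_d_constant_multiples[of y' \<phi> w U] by (simp add: \<phi>'_def[abs_def] mult.assoc)
      show "koszul_d y' \<phi>' U \<in> ?A"
      proof (cases "set U \<inter> F = {} \<and> set U \<subseteq> {1..n}")
        case True
        show ?thesis
        proof (cases "F \<union> set U \<in> \<Gamma>")
          case True
          then show ?thesis using cocycle[OF U] \<open>set U \<inter> F = {} \<and> _\<close> eq poly.ideal_zero[OF A] by simp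
        next
          case False
          have "w * prod_list (map y' U) \<in> polys n" by (intro poly.mult_C w prod)
          then have "w * prod_list (map y' U) \<in> ?A"
            using False w_prod True vars_exp by (auto simp: face_ideal_def monom_def)
          then show ?thesis unfolding eq by (rule poly.ideal_mult[OF A _ const])
        qed
      next
        case False
        then show ?thesis using prod_0[OF False] eq poly.ideal_zero[OF A] by simp
      qed
    qed (intro poly.power_C poly.uminus_C poly.one_C)
    finally show ?thesis .
  qed
  have "\<exists>g. (\<forall>T. g T \<in> polys n) \<and> (\<forall>T. length T = card F + q \<longrightarrow> c T - koszul_d ?y g T \<in> ?A)"
  proof (rule poly.koszul_acyclic[OF A reg(1)])
    show "set fs \<subseteq> polys n" using reg(2) by (auto simp: face_ideal_def)
    show "\<exists>K. f ^ K \<in> poly.generated n ?y" if "f \<in> set fs" for f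
      using that reg(2) by (intro power_generated) blast
    show "c T \<in> polys n" for T unfolding c_def by (rule poly.wedge_C) (rule \<phi>'C)
  qed (use len dc square_var_polys in auto)
  then obtain g where g: "\<And>T. g T \<in> polys n"
    and cg: "\<And>T. length T = card F + q \<Longrightarrow> c T - koszul_d ?y g T \<in> ?A"
    by (elim exE conjE) auto
  \<comment> \<open>An ideal without terms in the multidegrees that are compared, containing \<open>x\<^sub>a\<^sup>2\<close> for all \<open>a \<in> F\<close>.\<close>
  define Q where "Q = {p \<in> (polys n :: ((nat \<Rightarrow>\<^sub>0 nat) \<Rightarrow>\<^sub>0 'k) set). \<forall>v\<in>mons p. \<exists>a\<in>F. 2 \<le> coeff v a}"
  have Q: "poly.is_ideal n Q"
  proof (rule poly.is_idealI)
    fix a b assume "a \<in> Q" "b \<in> Q"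
    then show "a + b \<in> Q" using Poly_Mapping.keys_add[of a b] by (fastforce simp: Q_def)
  next
    fix a b assume a: "a \<in> Q" "b \<in> (polys n :: ((nat \<Rightarrow>\<^sub>0 nat) \<Rightarrow>\<^sub>0 'k) set)"
    have "\<exists>i\<in>F. 2 \<le> coeff v i" if v: "v \<in> mons (b * a)" for v
    proof -
      obtain s t where st: "v = s + t" "t \<in> mons a" using Poly_Mapping.keys_mult[of b a] v by blast
      then obtain i where "i \<in> F" "2 \<le> coeff t i" using a by (auto simp: Q_def)
      then show ?thesis using st by (intro bexI[of _ i]) (auto simp: Poly_Mapping.lookup_add)
    qed
    then show "b * a \<in> Q" using a by (auto simp: Q_def)
  qed (auto simp: Q_def)
  have yQ: "?y a \<in> Q" if "a \<in> set L" for a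
    using that Fn L square_var_polys[of n a]
    by (auto simp: Q_def square_var_def monom_def intro!: bexI[of _ a])
  \<comment> \<open>The sign comes from moving the differential past the indices of \<open>F\<close>.\<close>
  define \<psi> where "\<psi> V = (-1) ^ length L * coeff (g (L @ V)) (squarefree_exponent F + squares V)" for V
  have "\<phi> U = koszul_d (\<lambda>_. 1) \<psi> U"
    if U: "length U = q" "set U \<inter> F = {}" "F \<union> set U \<in> \<Gamma>" for U
  proof -
    let ?m = "squarefree_exponent F + squares U"
    have Un: "set U \<subseteq> {1..n}" using U(3) \<Gamma>(2) by auto
    define d where "d = koszul_d ?y (\<lambda>V. g (L @ V)) U"
    have cLU: "c (L @ U) = Poly_Mapping.single 0 (\<phi> U) * monom ?m"
      using wedge_append[of L U \<phi>'] L U w_prod[OF U(2) Un] by (auto simp: c_def \<phi>'_def mult.assoc)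
    have "c (L @ U) - koszul_d ?y g (L @ U) \<in> ?A" using U lenL by (intro cg) simp
    then have "?m \<notin> mons (c (L @ U) - koszul_d ?y g (L @ U))"
      using U(3) vars_exp[of U] by (auto simp: face_ideal_def)
    then have "coeff (c (L @ U) - koszul_d ?y g (L @ U)) ?m = 0" by (simp add: Poly_Mapping.in_keys_iff)
    moreover have "coeff (koszul_d ?y g (L @ U) - (-1) ^ length L * d) ?m = 0"
    proof -
      have "coeff ?m a = 1" if "a \<in> F" for a
        using that U(2) vars_squares[of U] Fn(2)
        by (auto simp: Poly_Mapping.lookup_add coeff_squarefree Poly_Mapping.in_keys_iff[symmetric]
            simp flip: Poly_Mapping.not_in_keys_iff_lookup_eq_zero)
      then have "?m \<notin> mons (koszul_d ?y g (L @ U) - (-1) ^ length L * d)"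
        using poly.koszul_d_append[OF Q yQ g, where U = U] unfolding d_def Q_def by fastforce
      then show ?thesis by (simp add: Poly_Mapping.in_keys_iff)
    qed
    moreover have "coeff ((-1) ^ length L * d) ?m = (-1) ^ length L * coeff d ?m"
      by (cases "even (length L)") auto
    moreover have "(-1) ^ length L * coeff d ?m = koszul_d (\<lambda>_. 1) \<psi> U"
      unfolding d_def \<psi>_def coeff_koszul_d_square_var[OF Un] by (simp only: koszul_d_scale)
    moreover have "coeff (c (L @ U)) ?m = \<phi> U"
      unfolding cLU by (simp add: monom_def Poly_Mapping.mult_single)
    ultimately show ?thesis by (simp add: Poly_Mapping.lookup_minus)
  qed
  then show ?thesis by blast
qed

text \<open>
  The link is \<open>{{}}\<close>, and the constant 1 on the empty list is not a coboundary.
\<close>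
lemma facet_bound:
  fixes fs :: "((nat \<Rightarrow>\<^sub>0 nat) \<Rightarrow>\<^sub>0 'k::field) list"
  assumes \<Gamma>: "down_closed \<Gamma>" "\<Gamma> \<subseteq> Pow {1..n}"
    and reg: "poly.weakly_regular n (face_ideal n \<Gamma>) fs" "set fs \<subseteq> face_ideal n {{}}"
    and F: "F \<in> \<Gamma>" "\<And>t. t \<notin> F \<Longrightarrow> insert t F \<notin> \<Gamma>"
  shows "length fs \<le> card F"
proof (rule ccontr)
  assume "\<not> ?thesis"
  then have "card F + 0 < length fs" by simp
  moreover have "koszul_d (\<lambda>_. 1) (\<lambda>_. 1 :: 'k) U = 0"
    if "length U = Suc 0" "set U \<inter> F = {}" "F \<union> set U \<in> \<Gamma>" for U
    using that F(2) by (auto simp: length_Suc_conv)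
  ultimately have "\<exists>\<psi>. \<forall>U. length U = 0 \<longrightarrow> set U \<inter> F = {} \<longrightarrow> F \<union> set U \<in> \<Gamma> \<longrightarrow> (1::'k) = koszul_d (\<lambda>_. 1) \<psi> U"
    by (rule link_coboundary[OF \<Gamma> F(1) reg])
  then show False using F(1) by simp
qed

text \<open>
  \<open>X\<close> is a union of components of the link; its indicator function is a cocycle, but not constant.
\<close>
lemma disconnected_link_bound:
  fixes fs :: "((nat \<Rightarrow>\<^sub>0 nat) \<Rightarrow>\<^sub>0 'k::field) list"
  assumes \<Gamma>: "down_closed \<Gamma>" "\<Gamma> \<subseteq> Pow {1..n}"
    and reg: "poly.weakly_regular n (face_ideal n \<Gamma>) fs" "set fs \<subseteq> face_ideal n {{}}"
    and F: "F \<in> \<Gamma>"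
    and sep: "\<And>s t. s \<notin> F \<Longrightarrow> t \<notin> F \<Longrightarrow> s \<in> X \<Longrightarrow> t \<notin> X \<Longrightarrow> insert s (insert t F) \<notin> \<Gamma>"
    and ab: "a \<in> X" "b \<notin> X" "a \<notin> F" "b \<notin> F" "insert a F \<in> \<Gamma>" "insert b F \<in> \<Gamma>"
  shows "length fs \<le> card F + 1"
proof (rule ccontr)
  assume "\<not> ?thesis"
  then have "card F + 1 < length fs" by simp
  moreover define \<phi> :: "nat list \<Rightarrow> 'k" where "\<phi> U = (if hd U \<in> X then 1 else 0)" for U
  have "koszul_d (\<lambda>_. 1) \<phi> U = 0"
    if "length U = Suc 1" "set U \<inter> F = {}" "F \<union> set U \<in> \<Gamma>" for U
  proof -
    obtain s t where "U = [s, t]" using \<open>length U = Suc 1\<close> by (auto simp: length_Suc_conv)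
    then show ?thesis
      using that sep[of s t] sep[of t s] by (auto simp: \<phi>_def insert_commute)
  qed
  ultimately have "\<exists>\<psi>. \<forall>U. length U = 1 \<longrightarrow> set U \<inter> F = {} \<longrightarrow> F \<union> set U \<in> \<Gamma> \<longrightarrow> \<phi> U = koszul_d (\<lambda>_. 1) \<psi> U"
    by (rule link_coboundary[OF \<Gamma> F reg])
  then obtain \<psi> where "\<And>u. u \<notin> F \<Longrightarrow> insert u F \<in> \<Gamma> \<Longrightarrow> \<phi> [u] = \<psi> []" by force
  from this[of a] this[of b] ab show False by (simp add: \<phi>_def)
qed

text \<open>
  A coboundary sums to zero along the loop \<open>a, b, c\<close>, whose three edges are faces.
\<close>
lemma loop_bound:
  fixes fs :: "((nat \<Rightarrow>\<^sub>0 nat) \<Rightarrow>\<^sub>0 'k::field) list" and \<phi> :: "nat \<Rightarrow> nat \<Rightarrow> 'k"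
  assumes \<Gamma>: "down_closed \<Gamma>" "\<Gamma> \<subseteq> Pow {1..n}"
    and reg: "poly.weakly_regular n (face_ideal n \<Gamma>) fs" "set fs \<subseteq> face_ideal n {{}}"
    and cocycle: "\<And>a b c. {a, b, c} \<in> \<Gamma> \<Longrightarrow> \<phi> b c - \<phi> a c + \<phi> a b = 0"
    and loop: "{a, b} \<in> \<Gamma>" "{b, c} \<in> \<Gamma>" "{a, c} \<in> \<Gamma>" "\<phi> b c - \<phi> a c + \<phi> a b \<noteq> 0"
  shows "length fs \<le> 2"
proof (rule ccontr)
  assume "\<not> ?thesis"
  then have "card ({} :: nat set) + 2 < length fs" by simp
  moreover define \<phi>' :: "nat list \<Rightarrow> 'k" where "\<phi>' U = \<phi> (U ! 0) (U ! 1)" for U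
  have "koszul_d (\<lambda>_. 1) \<phi>' U = 0"
    if "length U = Suc 2" "set U \<inter> {} = {}" "{} \<union> set U \<in> \<Gamma>" for U
  proof -
    obtain a b c where "U = [a, b, c]" using \<open>length U = Suc 2\<close> by (auto simp: length_Suc_conv numeral_2_eq_2)
    then show ?thesis using that cocycle[of a b c] by (simp add: \<phi>'_def algebra_simps)
  qed
  moreover have "{} \<in> \<Gamma>" using down_closedD[OF \<Gamma>(1) loop(1)] by blast
  ultimately have "\<exists>\<psi>. \<forall>U. length U = 2 \<longrightarrow> set U \<inter> {} = {} \<longrightarrow> {} \<union> set U \<in> \<Gamma> \<longrightarrow> \<phi>' U = koszul_d (\<lambda>_. 1) \<psi> U"
    by (intro link_coboundary[OF \<Gamma> _ reg]) blast+
  then obtain \<psi> where \<psi>: "\<And>U. length U = 2 \<Longrightarrow> set U \<in> \<Gamma> \<Longrightarrow> \<phi>' U = koszul_d (\<lambda>_. 1) \<psi> U"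
    by auto
  have "\<phi> s t = \<psi> [t] - \<psi> [s]" if "{s, t} \<in> \<Gamma>" for s t
    using \<psi>[of "[s, t]"] that by (simp add: \<phi>'_def)
  then show False using loop by simp
qed

section \<open>Depth of the quotient by a monomial ideal of a complex\<close>

context subring_of
begin

lemma ideal_foldl_adjoin:
  "is_ideal A \<Longrightarrow> set fs \<subseteq> C \<Longrightarrow> is_ideal (foldl adjoin A fs)"
  by (induction fs arbitrary: A) (auto intro: ideal_adjoin)

lemma mem_foldl_adjoin:
  assumes "is_ideal A" "set fs \<subseteq> C"
  shows "b \<in> foldl adjoin A fs \<longleftrightarrow>
    (\<exists>g. (\<forall>i<length fs. g i \<in> C) \<and> b - (\<Sum>i<length fs. fs ! i * g i) \<in> A)"
  using assms(2)
proof (induction fs arbitrary: b rule: rev_induct)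
  case (snoc f fs)
  have A': "is_ideal (foldl adjoin A fs)" using snoc.prems assms(1) by (intro ideal_foldl_adjoin) auto
  have sum: "(\<Sum>i<length (fs @ [f]). (fs @ [f]) ! i * g i)
      = (\<Sum>i<length fs. fs ! i * g i) + f * g (length fs)" for g :: "nat \<Rightarrow> 'a"
    by (simp add: nth_append)
  have "b \<in> foldl adjoin A (fs @ [f]) \<longleftrightarrow> (\<exists>c\<in>C. b - f * c \<in> foldl adjoin A fs)"
    by (simp add: adjoin_iff[OF A'])
  also have "\<dots> \<longleftrightarrow> (\<exists>c\<in>C. \<exists>g. (\<forall>i<length fs. g i \<in> C) \<and> b - f * c - (\<Sum>i<length fs. fs ! i * g i) \<in> A)"
    using snoc by simp
  also have "\<dots> \<longleftrightarrow> (\<exists>g. (\<forall>i<length (fs @ [f]). g i \<in> C) \<and>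
      b - (\<Sum>i<length (fs @ [f]). (fs @ [f]) ! i * g i) \<in> A)" (is "?L \<longleftrightarrow> ?R")
  proof
    assume ?L
    then obtain c g where *: "c \<in> C" "\<forall>i<length fs. g i \<in> C"
      "b - f * c - (\<Sum>i<length fs. fs ! i * g i) \<in> A" by blast
    let ?g = "g(length fs := c)"
    have "b - (\<Sum>i<length (fs @ [f]). (fs @ [f]) ! i * ?g i) \<in> A"
      using *(3) unfolding sum by (simp add: algebra_simps)
    then show ?R using * by (intro exI[of _ ?g]) (auto simp: less_Suc_eq)
  next
    assume ?R
    then obtain g where *: "\<forall>i<length (fs @ [f]). g i \<in> C"
      "b - (\<Sum>i<length (fs @ [f]). (fs @ [f]) ! i * g i) \<in> A" by blast
    then have "b - f * g (length fs) - (\<Sum>i<length fs. fs ! i * g i) \<in> A"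
      unfolding sum by (simp add: algebra_simps)
    then show ?L using * by (intro bexI[of _ "g (length fs)"] exI[of _ g]) auto
  qed
  finally show ?case .
qed simp

lemma weakly_regular_iff:
  "weakly_regular A fs \<longleftrightarrow> (\<forall>i<length fs. nonzerodivisor_mod (foldl adjoin A (take i fs)) (fs ! i))"
  by (induction fs arbitrary: A) (auto simp: All_less_Suc2)

end

lemma poly_ring_simps:
  "carrier (poly_ring n) = polys n" "x \<otimes>\<^bsub>poly_ring n\<^esub> y = x * y" "\<one>\<^bsub>poly_ring n\<^esub> = 1"
  "\<zero>\<^bsub>poly_ring n\<^esub> = 0" "x \<oplus>\<^bsub>poly_ring n\<^esub> y = x + y"
  by (simp_all add: poly_ring_def polys_def)

lemma ideal_poly_ringI:
  fixes A :: "((nat \<Rightarrow>\<^sub>0 nat) \<Rightarrow>\<^sub>0 'k::field) set"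
  assumes A: "poly.is_ideal n A"
  shows "ideal A (poly_ring n)"
proof -
  interpret R: cring "poly_ring n :: ((nat \<Rightarrow>\<^sub>0 nat) \<Rightarrow>\<^sub>0 'k) ring" by (rule poly_ring_cring)
  have inv: "\<ominus>\<^bsub>poly_ring n\<^esub> a = - a" if "a \<in> polys n" for a :: "(nat \<Rightarrow>\<^sub>0 nat) \<Rightarrow>\<^sub>0 'k"
    using that by (intro R.minus_equality) (auto simp: poly_ring_simps)
  show ?thesis
  proof (rule idealI[OF R.ring_axioms])
    show "subgroup A (add_monoid (poly_ring n))"
    proof (rule R.add.subgroupI)
      show "A \<subseteq> carrier (poly_ring n)" using poly.ideal_C[OF A] by (auto simp: poly_ring_simps)
      show "A \<noteq> {}" using poly.ideal_zero[OF A] by blast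
      show "\<ominus>\<^bsub>poly_ring n\<^esub> a \<in> A" if "a \<in> A" for a
        using that inv poly.ideal_uminus[OF A] poly.ideal_C[OF A] by simp
      show "a \<oplus>\<^bsub>poly_ring n\<^esub> b \<in> A" if "a \<in> A" "b \<in> A" for a b
        using that poly.ideal_add[OF A] by (simp add: poly_ring_simps)
    qed
  qed (use poly.ideal_mult[OF A] poly.ideal_mult'[OF A] in \<open>simp_all add: poly_ring_simps\<close>)
qed

context
  fixes n :: nat and A :: "((nat \<Rightarrow>\<^sub>0 nat) \<Rightarrow>\<^sub>0 'k::field) set"
  assumes A: "poly.is_ideal n A"
begin

interpretation R: cring "poly_ring n :: ((nat \<Rightarrow>\<^sub>0 nat) \<Rightarrow>\<^sub>0 'k) ring" by (rule poly_ring_cring)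
interpretation I: ideal A "poly_ring n" by (rule ideal_poly_ringI[OF A])
interpretation H: ring_hom_cring "poly_ring n" "poly_ring n Quot A" "(+>\<^bsub>poly_ring n\<^esub>) A"
  by (rule I.rcos_ring_hom_cring[OF R.is_cring])

abbreviation "cls \<equiv> (+>\<^bsub>poly_ring n\<^esub>) A"

lemma cls_eq_iff:
  assumes "a \<in> polys n" "b \<in> polys n"
  shows "cls a = cls b \<longleftrightarrow> a - b \<in> A"
proof -
  have "\<ominus>\<^bsub>poly_ring n\<^esub> b = - b"
    using assms by (intro R.minus_equality) (auto simp: poly_ring_simps)
  then have "a \<ominus>\<^bsub>poly_ring n\<^esub> b = a - b" by (simp add: a_minus_def poly_ring_simps)
  then show ?thesis
    using R.quotient_eq_iff_same_a_r_cos[OF I.is_ideal, of a b] assms by (simp add: poly_ring_simps)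
qed

lemma carrier_quot: "carrier (quot_module (poly_ring n) A) = cls ` polys n"
  by (auto simp: quot_module_def FactRing_def A_RCOSETS_def' poly_ring_simps)

lemma smult_quot:
  "r \<in> polys n \<Longrightarrow> x \<in> polys n \<Longrightarrow> r \<odot>\<^bsub>quot_module (poly_ring n) A\<^esub> cls x = cls (r * x)"
  using H.hom_mult[of r x] by (simp add: quot_module_def poly_ring_simps)

lemma finsum_quot:
  assumes "\<And>i. i \<in> X \<Longrightarrow> h i \<in> polys n"
  shows "finsum (quot_module (poly_ring n) A) (\<lambda>i. cls (h i)) X = cls (sum h X)"
proof -
  have "finsum (quot_module (poly_ring n) A) (\<lambda>i. cls (h i)) X = finsum (poly_ring n Quot A) (cls \<circ> h) X"
    by (simp add: finsum_def finprod_def quot_module_def comp_def)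
  also have "\<dots> = cls (finsum (poly_ring n) h X)"
    using assms by (subst H.hom_finsum) (auto simp: poly_ring_simps)
  also have "finsum (poly_ring n) h X = sum h X"
    using assms by (induction X rule: infinite_finite_induct)
      (auto simp: R.finsum_insert poly_ring_simps Pi_def)
  finally show ?thesis .
qed

text \<open>
  Cosets are compared with representatives in the polynomial ring, so that the sums in the quotient
  module disappear from all later arguments.
\<close>
lemma seq_submodule_quot:
  assumes "set fs \<subseteq> polys n" "a \<in> polys n"
  shows "cls a \<in> seq_submodule (quot_module (poly_ring n) A) fs \<longleftrightarrow> a \<in> foldl (poly.adjoin n) A fs"
proof -
  let ?M = "quot_module (poly_ring n) A" and ?m = "length fs"
  have fs: "fs ! i \<in> polys n" if "i < ?m" for i using that assms(1) by (meson nth_mem subsetD)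
  interpret M: Module.module "poly_ring n" ?M by (rule R.quot_module_module[OF I.is_ideal])
  have eval: "(\<Oplus>\<^bsub>?M\<^esub>i\<in>{..<?m}. fs ! i \<odot>\<^bsub>?M\<^esub> G i) = cls (\<Sum>i<?m. fs ! i * g i)"
    if g: "\<And>i. i < ?m \<Longrightarrow> g i \<in> polys n" and G: "\<And>i. i < ?m \<Longrightarrow> G i = cls (g i)" for g G
  proof -
    have "(\<Oplus>\<^bsub>?M\<^esub>i\<in>{..<?m}. fs ! i \<odot>\<^bsub>?M\<^esub> G i) = (\<Oplus>\<^bsub>?M\<^esub>i\<in>{..<?m}. cls (fs ! i * g i))"
      using fs g G by (intro M.finsum_cong') (auto simp: smult_quot carrier_quot)
    then show ?thesis using finsum_quot[of "{..<?m}" "\<lambda>i. fs ! i * g i"] fs g by auto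
  qed
  have sum: "(\<Sum>i<?m. fs ! i * g i) \<in> polys n" if "\<And>i. i < ?m \<Longrightarrow> g i \<in> polys n" for g
    using that fs by (intro poly.sum_C) auto
  show ?thesis
  proof
    assume "cls a \<in> seq_submodule ?M fs"
    then obtain G where G: "G \<in> {..<?m} \<rightarrow> carrier ?M"
      "cls a = (\<Oplus>\<^bsub>?M\<^esub>i\<in>{..<?m}. fs ! i \<odot>\<^bsub>?M\<^esub> G i)"
      by (auto simp: seq_submodule_def)
    have "\<exists>x. x \<in> polys n \<and> G i = cls x" if "i < ?m" for i
    proof -
      have "G i \<in> cls ` polys n" using G(1) that unfolding carrier_quot[symmetric] by auto
      then show ?thesis by blast
    qed
    then obtain g where g: "\<And>i. i < ?m \<Longrightarrow> g i \<in> polys n" "\<And>i. i < ?m \<Longrightarrow> G i = cls (g i)" by metis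
    then have "cls a = cls (\<Sum>i<?m. fs ! i * g i)" using G(2) eval[of g G] by simp
    then show "a \<in> foldl (poly.adjoin n) A fs"
      using cls_eq_iff[OF assms(2) sum[of g]] g poly.mem_foldl_adjoin[OF A assms(1)] by blast
  next
    assume "a \<in> foldl (poly.adjoin n) A fs"
    then obtain g where g: "\<And>i. i < ?m \<Longrightarrow> g i \<in> polys n" "a - (\<Sum>i<?m. fs ! i * g i) \<in> A"
      using poly.mem_foldl_adjoin[OF A assms(1)] by blast
    then have "cls a = (\<Oplus>\<^bsub>?M\<^esub>i\<in>{..<?m}. fs ! i \<odot>\<^bsub>?M\<^esub> cls (g i))"
      using cls_eq_iff[OF assms(2) sum[of g]] eval[of g "\<lambda>i. cls (g i)"] by simp
    moreover have "(\<lambda>i. cls (g i)) \<in> {..<?m} \<rightarrow> carrier ?M" using g(1) carrier_quot by auto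
    ultimately show "cls a \<in> seq_submodule ?M fs"
      unfolding seq_submodule_def by (intro CollectI exI[of _ "\<lambda>i. cls (g i)"] conjI)
  qed
qed

lemma seq_submodule_quot_subset:
  assumes "set fs \<subseteq> polys n"
  shows "seq_submodule (quot_module (poly_ring n) A) fs \<subseteq> cls ` polys n"
proof -
  interpret M: Module.module "poly_ring n" "quot_module (poly_ring n) A"
    by (rule R.quot_module_module[OF I.is_ideal])
  have "fs ! i \<in> carrier (poly_ring n)" if "i < length fs" for i
    using that assms by (auto simp: poly_ring_simps)
  then show ?thesis
    unfolding seq_submodule_def carrier_quot[symmetric]
    by (auto intro!: M.finsum_closed M.smult_closed simp: Pi_iff)
qed

lemma regular_sequence_quot:
  assumes fs: "set fs \<subseteq> polys n"
  shows "regular_sequence (poly_ring n) (quot_module (poly_ring n) A) fs \<longleftrightarrow>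
    poly.weakly_regular n A fs \<and> foldl (poly.adjoin n) A fs \<noteq> polys n"
proof -
  let ?M = "quot_module (poly_ring n) A"
  have mem: "cls a \<in> seq_submodule ?M (take i fs) \<longleftrightarrow> a \<in> foldl (poly.adjoin n) A (take i fs)"
    if "a \<in> polys n" for a i
    using that fs set_take_subset[of i fs] by (intro seq_submodule_quot) auto
  have "(\<forall>x\<in>carrier ?M. fs ! i \<odot>\<^bsub>?M\<^esub> x \<in> seq_submodule ?M (take i fs) \<longrightarrow> x \<in> seq_submodule ?M (take i fs))
    \<longleftrightarrow> poly.nonzerodivisor_mod n (foldl (poly.adjoin n) A (take i fs)) (fs ! i)"
    if i: "i < length fs" for i
  proof -
    have "fs ! i \<in> polys n" using i fs by (meson nth_mem subsetD)
    then show ?thesis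
      by (simp add: carrier_quot poly.nonzerodivisor_mod_def smult_quot mem)
  qed
  moreover have "seq_submodule ?M fs = carrier ?M \<longleftrightarrow> foldl (poly.adjoin n) A fs = polys n"
  proof -
    have "seq_submodule ?M fs = carrier ?M \<longleftrightarrow> (\<forall>a\<in>polys n. cls a \<in> seq_submodule ?M fs)"
      using seq_submodule_quot_subset[OF fs] by (auto simp: carrier_quot)
    also have "\<dots> \<longleftrightarrow> polys n \<subseteq> foldl (poly.adjoin n) A fs"
      using seq_submodule_quot[OF fs] by blast
    also have "\<dots> \<longleftrightarrow> foldl (poly.adjoin n) A fs = polys n"
      using poly.ideal_C[OF poly.ideal_foldl_adjoin[OF A fs]] by blast
    finally show ?thesis .
  qed
  ultimately show ?thesis
    using fs by (simp add: regular_sequence_def poly.weakly_regular_iff poly_ring_simps)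
qed

end

text \<open>
  A term whose support contains that of a squarefree monomial is a multiple of this monomial.
\<close>
lemma genideal_squarefree_monomials:
  fixes W :: "(nat \<Rightarrow>\<^sub>0 nat) set"
  assumes W: "\<And>w. w \<in> W \<Longrightarrow> vars w \<subseteq> {1..n}" "\<And>w i. w \<in> W \<Longrightarrow> coeff w i \<le> 1"
  shows "Idl\<^bsub>poly_ring n\<^esub> (monom ` W)
    = (face_ideal n {G. G \<subseteq> {1..n} \<and> (\<forall>w\<in>W. \<not> vars w \<subseteq> G)} :: ((nat \<Rightarrow>\<^sub>0 nat) \<Rightarrow>\<^sub>0 'k::field) set)"
    (is "?L = face_ideal n ?\<Gamma>")
proof
  interpret R: cring "poly_ring n :: ((nat \<Rightarrow>\<^sub>0 nat) \<Rightarrow>\<^sub>0 'k) ring" by (rule poly_ring_cring)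
  have A: "poly.is_ideal n (face_ideal n ?\<Gamma> :: ((nat \<Rightarrow>\<^sub>0 nat) \<Rightarrow>\<^sub>0 'k) set)"
    by (rule ideal_face_ideal) (auto simp: down_closed_def)
  have "monom w \<in> (face_ideal n ?\<Gamma> :: ((nat \<Rightarrow>\<^sub>0 nat) \<Rightarrow>\<^sub>0 'k) set)" if "w \<in> W" for w
    using that W by (auto simp: face_ideal_def polys_def monom_def)
  then show "?L \<subseteq> (face_ideal n ?\<Gamma> :: ((nat \<Rightarrow>\<^sub>0 nat) \<Rightarrow>\<^sub>0 'k) set)"
    by (intro R.genideal_minimal ideal_poly_ringI[OF A]) auto
  have sub: "monom ` W \<subseteq> carrier (poly_ring n :: ((nat \<Rightarrow>\<^sub>0 nat) \<Rightarrow>\<^sub>0 'k) ring)"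
    using W(1) by (simp add: poly_ring_simps polys_def monom_def image_subset_iff)
  interpret I: ideal ?L "poly_ring n :: ((nat \<Rightarrow>\<^sub>0 nat) \<Rightarrow>\<^sub>0 'k) ring" by (rule R.genideal_ideal[OF sub])
  have L: "poly.is_ideal n (?L :: ((nat \<Rightarrow>\<^sub>0 nat) \<Rightarrow>\<^sub>0 'k) set)"
  proof (rule poly.is_idealI)
    show "(?L :: ((nat \<Rightarrow>\<^sub>0 nat) \<Rightarrow>\<^sub>0 'k) set) \<subseteq> polys n" using I.a_subset by (simp add: poly_ring_simps)
    show "(0 :: (nat \<Rightarrow>\<^sub>0 nat) \<Rightarrow>\<^sub>0 'k) \<in> ?L" using I.zero_closed by (simp add: poly_ring_simps)
    show "a + b \<in> ?L" if "a \<in> ?L" "b \<in> ?L" for a b :: "(nat \<Rightarrow>\<^sub>0 nat) \<Rightarrow>\<^sub>0 'k"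
      using I.a_closed[OF that] by (simp add: poly_ring_simps)
    show "c * a \<in> ?L" if "a \<in> ?L" "c \<in> polys n" for a c :: "(nat \<Rightarrow>\<^sub>0 nat) \<Rightarrow>\<^sub>0 'k"
      using I.I_l_closed[of a c] that by (simp add: poly_ring_simps)
  qed
  show "(face_ideal n ?\<Gamma> :: ((nat \<Rightarrow>\<^sub>0 nat) \<Rightarrow>\<^sub>0 'k) set) \<subseteq> ?L"
  proof
    fix p :: "(nat \<Rightarrow>\<^sub>0 nat) \<Rightarrow>\<^sub>0 'k" assume p: "p \<in> face_ideal n ?\<Gamma>"
    show "p \<in> ?L"
    proof (rule ideal_of_terms[OF L])
      fix v assume v: "v \<in> mons p"
      then have vn: "vars v \<subseteq> {1..n}" using p by (auto simp: face_ideal_def polys_def)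
      then obtain w where w: "w \<in> W" "vars w \<subseteq> vars v" using p v by (auto simp: face_ideal_def)
      have "squarefree_exponent (vars w) = w"
      proof (rule poly_mapping_eqI)
        fix i show "coeff (squarefree_exponent (vars w)) i = coeff w i"
          using W(2)[OF w(1), of i] by (auto simp: coeff_squarefree Poly_Mapping.in_keys_iff)
      qed
      then have eq: "Poly_Mapping.single v (coeff p v) = Poly_Mapping.single (v - w) (coeff p v) * monom w"
        using vars_factor(1)[OF Poly_Mapping.finite_keys w(2), of "coeff p v"] by (simp add: mult.commute)
      have "Poly_Mapping.single (v - w) (coeff p v) \<in> polys n"
        using vn vars_factor(2)[OF Poly_Mapping.finite_keys w(2)] \<open>squarefree_exponent (vars w) = w\<close>
        by (auto simp: polys_def)
      moreover have "monom w \<in> (?L :: ((nat \<Rightarrow>\<^sub>0 nat) \<Rightarrow>\<^sub>0 'k) set)" using R.genideal_self[OF sub] w by blast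
      ultimately show "Poly_Mapping.single v (coeff p v) \<in> ?L"
        unfolding eq using poly.ideal_mult[OF L] by blast
    qed
  qed
qed

lemma graded_max_ideal_eq:
  "graded_max_ideal n = (face_ideal n {{}} :: ((nat \<Rightarrow>\<^sub>0 nat) \<Rightarrow>\<^sub>0 'k::field) set)"
proof -
  let ?W = "{Poly_Mapping.single i 1 |i. i \<in> {1..n}} :: (nat \<Rightarrow>\<^sub>0 nat) set"
  have "{monom (Poly_Mapping.single i 1) |i. i \<in> {1..n}} = (monom ` ?W :: ((nat \<Rightarrow>\<^sub>0 nat) \<Rightarrow>\<^sub>0 'k) set)"
    by blast
  moreover have "{G. G \<subseteq> {1..n} \<and> (\<forall>w\<in>?W. \<not> vars w \<subseteq> G)} = {{}}"
    by fastforce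
  moreover have "Idl\<^bsub>poly_ring n\<^esub> (monom ` ?W)
      = (face_ideal n {G. G \<subseteq> {1..n} \<and> (\<forall>w\<in>?W. \<not> vars w \<subseteq> G)} :: ((nat \<Rightarrow>\<^sub>0 nat) \<Rightarrow>\<^sub>0 'k) set)"
    by (rule genideal_squarefree_monomials) (auto simp: Poly_Mapping.lookup_single when_def)
  ultimately show ?thesis unfolding graded_max_ideal_def by (simp only:)
qed

text \<open>
  The two certificates together. The quotient by the symmetric polynomials is not zero because they
  and the monomials in the ideal have no constant term.
\<close>
theorem depth_face_ideal:
  fixes S :: "((nat \<Rightarrow>\<^sub>0 nat) \<Rightarrow>\<^sub>0 'k::field) ring"
  assumes \<Gamma>: "\<Gamma> \<subseteq> Pow {1..n}" "{} \<in> \<Gamma>" and sh: "shelled r \<Gamma>"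
    and bound: "\<And>fs :: ((nat \<Rightarrow>\<^sub>0 nat) \<Rightarrow>\<^sub>0 'k) list. poly.weakly_regular n (face_ideal n \<Gamma>) fs \<Longrightarrow>
      set fs \<subseteq> face_ideal n {{}} \<Longrightarrow> length fs \<le> r"
    and S: "S = poly_ring n"
  shows "depth S (graded_max_ideal n) (quot_module S (face_ideal n \<Gamma>)) = enat r"
proof -
  let ?A = "face_ideal n \<Gamma> :: ((nat \<Rightarrow>\<^sub>0 nat) \<Rightarrow>\<^sub>0 'k) set"
  let ?m = "face_ideal n {{}} :: ((nat \<Rightarrow>\<^sub>0 nat) \<Rightarrow>\<^sub>0 'k) set"
  let ?X = "{enat (length fs) |fs. set fs \<subseteq> ?m \<and> regular_sequence S (quot_module S ?A) fs}"
  have A: "poly.is_ideal n ?A" by (rule ideal_face_ideal[OF shelled_down_closed[OF sh]])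
  have m: "poly.is_ideal n ?m" by (rule ideal_face_ideal) (auto simp: down_closed_def)
  have m_polys: "?m \<subseteq> polys n" by (auto simp: face_ideal_def)
  have proper: "foldl (poly.adjoin n) ?A fs \<noteq> polys n" if "set fs \<subseteq> ?m" for fs
  proof -
    have "foldl (poly.adjoin n) B fs \<subseteq> ?m" if "B \<subseteq> ?m" "set fs \<subseteq> ?m" for B
      using that
    proof (induction fs arbitrary: B)
      case (Cons f fs)
      have "poly.adjoin n B f \<subseteq> ?m"
        using Cons.prems poly.ideal_add[OF m] poly.ideal_mult'[OF m] by (auto simp: poly.adjoin_def)
      then show ?case using Cons by simp
    qed simp
    moreover have "?A \<subseteq> ?m" using \<Gamma>(2) by (auto simp: face_ideal_def)
    ultimately have "foldl (poly.adjoin n) ?A fs \<subseteq> ?m" using that by simp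
    moreover have "(1 :: (nat \<Rightarrow>\<^sub>0 nat) \<Rightarrow>\<^sub>0 'k) \<notin> ?m" by (simp add: face_ideal_def)
    ultimately show ?thesis using poly.one_C[of n] by auto
  qed
  have esym_m: "set (esyms n r) \<subseteq> ?m"
  proof
    fix f :: "(nat \<Rightarrow>\<^sub>0 nat) \<Rightarrow>\<^sub>0 'k" assume "f \<in> set (esyms n r)"
    then obtain i where i: "0 < i" "f = esym n i" using set_esyms by blast
    have "vars w \<noteq> {}" if w: "w \<in> mons f" for w
    proof -
      obtain T where "T \<subseteq> {1..n}" "card T = i" "w = squarefree_exponent T"
        using mons_esym[of w n i] w i(2) by blast
      then show ?thesis using i finite_subset[of T "{1..n}"] by auto
    qed
    then show "f \<in> ?m" using i esym_polys by (simp add: face_ideal_def)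
  qed
  have "regular_sequence S (quot_module S ?A) (esyms n r)"
    unfolding S regular_sequence_quot[OF A set_esyms_polys]
    using weakly_regular_esyms[OF sh \<Gamma>(1)] proper[OF esym_m] by blast
  then have "enat r \<in> ?X" using esym_m by (intro CollectI exI[of _ "esyms n r"]) simp
  moreover have "x \<le> enat r" if x: "x \<in> ?X" for x
  proof -
    obtain fs where fs: "x = enat (length fs)" "set fs \<subseteq> ?m" "regular_sequence S (quot_module S ?A) fs"
      using x by blast
    have "set fs \<subseteq> polys n" using fs(2) m_polys by simp
    then have "poly.weakly_regular n ?A fs"
      using regular_sequence_quot[OF A] fs(3) S by simp
    then show ?thesis using bound[OF _ fs(2)] fs(1) by simp
  qed
  ultimately have "Sup ?X = enat r" by (intro antisym Sup_least Sup_upper)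
  then show ?thesis by (simp add: depth_def graded_max_ideal_eq)
qed

section \<open>Squarefree lexsegments of degree three\<close>

lemma coeff_mon3:
  "a < b \<Longrightarrow> b < c \<Longrightarrow> coeff (mon3 a b c) k = (if k = a \<or> k = b \<or> k = c then 1 else 0)"
  by (auto simp: mon3_def Poly_Mapping.lookup_add Poly_Mapping.lookup_single when_def)

lemma vars_mon3: "a < b \<Longrightarrow> b < c \<Longrightarrow> vars (mon3 a b c) = {a, b, c}"
  by (auto simp: Poly_Mapping.in_keys_iff coeff_mon3 split: if_splits)

lemma mon3_less:
  assumes "a < b" "b < c" "a' < b'" "b' < c'"
    and "a < a' \<or> a = a' \<and> (b < b' \<or> b = b' \<and> c < c')"
  shows "mon3 a' b' c' < mon3 a b c"
proof -
  let ?k = "if a < a' then a else if b < b' then b else c"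
  have "coeff (mon3 a' b' c') ?k < coeff (mon3 a b c) ?k \<and>
      (\<forall>k'<?k. coeff (mon3 a' b' c') k' = coeff (mon3 a b c) k')"
    using assms by (auto simp: coeff_mon3)
  then show ?thesis unfolding lex_less_iff by blast
qed

lemma mon3_le_iff:
  assumes "a < b" "b < c" "a' < b'" "b' < c'"
  shows "mon3 a' b' c' \<le> mon3 a b c \<longleftrightarrow> a < a' \<or> a = a' \<and> (b < b' \<or> b = b' \<and> c \<le> c')"
proof (cases "a < a' \<or> a = a' \<and> (b < b' \<or> b = b' \<and> c < c')")
  case True
  then show ?thesis using mon3_less[OF assms] by auto
next
  case False
  show ?thesis
  proof (cases "a = a' \<and> b = b' \<and> c = c'")
    case True
    then show ?thesis by simp
  next
    case neq: False
    then have "a' < a \<or> a' = a \<and> (b' < b \<or> b' = b \<and> c' < c)" using False by linarith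
    then show ?thesis using mon3_less[OF assms(3,4,1,2)] by auto
  qed
qed

lemma squarefree_monomials_3:
  "squarefree_monomials n 3 = {mon3 a b c |a b c. 1 \<le> a \<and> a < b \<and> b < c \<and> c \<le> n}"
proof (intro equalityI subsetI)
  fix w assume w: "w \<in> squarefree_monomials n 3"
  have one: "coeff w i = 1" if "i \<in> vars w" for i
    using w that by (auto simp: squarefree_monomials_def Poly_Mapping.in_keys_iff intro: le_antisym)
  then have "(\<Sum>i\<in>vars w. coeff w i) = card (vars w)" by simp
  then have "card (vars w) = 3" using w by (simp add: squarefree_monomials_def)
  then obtain x y z where xyz: "vars w = {x, y, z}" "x \<noteq> y" "y \<noteq> z" "x \<noteq> z"
    by (auto simp: card_Suc_eq numeral_3_eq_3)
  have "\<exists>a b c. a < b \<and> b < c \<and> {x, y, z} = {a, b, c}"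
  proof -
    have "\<exists>a b c. a < b \<and> b < c \<and> {x, y, z} = {a, b, c}" if xy: "x < y" "y \<noteq> z" "x \<noteq> z" for x y z :: nat
    proof -
      consider "z < x" | "x < z" "z < y" | "y < z" using xy by linarith
      then show ?thesis
      proof cases
        case 1
        then show ?thesis using xy by (intro exI[of _ z] exI[of _ x] exI[of _ y]) auto
      next
        case 2
        then show ?thesis using xy by (intro exI[of _ x] exI[of _ z] exI[of _ y]) auto
      next
        case 3
        then show ?thesis using xy by (intro exI[of _ x] exI[of _ y] exI[of _ z]) auto
      qed
    qed
    from this[of x y z] this[of y x z] xyz show ?thesis
      by (cases "x < y") (auto simp: insert_commute)
  qed
  then obtain a b c where abc: "a < b" "b < c" "vars w = {a, b, c}" using xyz by auto
  have "w = mon3 a b c"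
  proof (rule poly_mapping_eqI)
    fix k show "coeff w k = coeff (mon3 a b c) k"
      using one[of k] abc Poly_Mapping.in_keys_iff[of k w] by (auto simp: coeff_mon3)
  qed
  then show "w \<in> {mon3 a b c |a b c. 1 \<le> a \<and> a < b \<and> b < c \<and> c \<le> n}"
    using abc w by (auto simp: squarefree_monomials_def)
next
  fix w assume "w \<in> {mon3 a b c |a b c. 1 \<le> a \<and> a < b \<and> b < c \<and> c \<le> n}"
  then obtain a b c where "w = mon3 a b c" "1 \<le> a" "a < b" "b < c" "c \<le> n" by blast
  then show "w \<in> squarefree_monomials n 3"
    by (auto simp: squarefree_monomials_def vars_mon3 coeff_mon3)
qed

locale lex_complex =
  fixes n i2 i3 j1 j2 j3 :: nat
  assumes i: "1 < i2" "i2 < i3" "i3 \<le> n"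
    and j: "2 \<le> j1" "j1 < j2" "j2 < j3" "j3 \<le> n"
begin

text \<open>
  For \<open>1 < b < c\<close>, the triple \<open>1, b, c\<close> is
  in the segment iff \<open>seg1 b c\<close>; the comparison with \<open>v\<close> is automatic as \<open>j1 \<ge> 2\<close>. For \<open>2 \<le> a < b < c\<close>
  the triple \<open>a, b, c\<close> is in the segment iff \<open>seg a b c\<close>.
\<close>
definition seg1 :: "nat \<Rightarrow> nat \<Rightarrow> bool" where
  "seg1 b c \<longleftrightarrow> i2 < b \<or> b = i2 \<and> i3 \<le> c"

definition seg :: "nat \<Rightarrow> nat \<Rightarrow> nat \<Rightarrow> bool" where
  "seg a b c \<longleftrightarrow> a < j1 \<or> a = j1 \<and> (b < j2 \<or> b = j2 \<and> c \<le> j3)"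

definition \<Delta> :: "nat set set" where
  "\<Delta> = {G. G \<subseteq> {1..n} \<and> (1 \<in> G \<longrightarrow> (\<forall>b\<in>G. \<forall>c\<in>G. 1 < b \<longrightarrow> b < c \<longrightarrow> \<not> seg1 b c)) \<and>
    (\<forall>a\<in>G. \<forall>b\<in>G. \<forall>c\<in>G. 2 \<le> a \<longrightarrow> a < b \<longrightarrow> b < c \<longrightarrow> \<not> seg a b c)}"

lemma lexsegment_ideal_eq:
  "lexsegment_ideal n (mon3 1 i2 i3) (mon3 j1 j2 j3) = (face_ideal n \<Delta> :: ((nat \<Rightarrow>\<^sub>0 nat) \<Rightarrow>\<^sub>0 'k::field) set)"
proof -
  let ?W = "lexsegment n (mon3 1 i2 i3) (mon3 j1 j2 j3)"
  have mem: "mon3 a b c \<in> ?W \<longleftrightarrow> (if a = 1 then seg1 b c else seg a b c)"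
    if "1 \<le> a" "a < b" "b < c" "c \<le> n" for a b c
  proof -
    have "mon3 a b c \<in> squarefree_monomials n 3" using that by (auto simp: squarefree_monomials_3)
    moreover have "mon3 j1 j2 j3 \<le> mon3 a b c \<longleftrightarrow> seg a b c"
      using mon3_le_iff[OF that(2,3) j(2,3)] by (simp add: seg_def)
    moreover have "mon3 a b c \<le> mon3 1 i2 i3 \<longleftrightarrow> 1 < a \<or> 1 = a \<and> seg1 b c"
      using mon3_le_iff[OF i(1,2) that(2,3)] by (auto simp: seg1_def)
    ultimately show ?thesis using that(1) j(1) by (auto simp: lexsegment_def seg_def)
  qed
  have sub: "\<exists>a b c. w = mon3 a b c \<and> 1 \<le> a \<and> a < b \<and> b < c \<and> c \<le> n" if "w \<in> ?W" for w
    using that by (auto simp: lexsegment_def squarefree_monomials_3)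
  have "(\<forall>w\<in>?W. \<not> vars w \<subseteq> G) \<longleftrightarrow>
     (1 \<in> G \<longrightarrow> (\<forall>b\<in>G. \<forall>c\<in>G. 1 < b \<longrightarrow> b < c \<longrightarrow> \<not> seg1 b c)) \<and>
     (\<forall>a\<in>G. \<forall>b\<in>G. \<forall>c\<in>G. 2 \<le> a \<longrightarrow> a < b \<longrightarrow> b < c \<longrightarrow> \<not> seg a b c)" (is "?L \<longleftrightarrow> ?R1 \<and> ?R2")
    if G: "G \<subseteq> {1..n}" for G
  proof
    assume L: ?L
    have no: "mon3 a b c \<notin> ?W" if "a \<in> G" "b \<in> G" "c \<in> G" "a < b" "b < c" for a b c
      using L that vars_mon3[of a b c] by auto
    have ?R1
    proof (intro impI ballI)
      fix b c assume "1 \<in> G" "b \<in> G" "c \<in> G" "1 < b" "b < c"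
      then show "\<not> seg1 b c" using no[of 1 b c] mem[of 1 b c] G by auto
    qed
    moreover have ?R2
    proof (intro impI ballI)
      fix a b c assume "a \<in> G" "b \<in> G" "c \<in> G" "2 \<le> a" "a < b" "b < c"
      then show "\<not> seg a b c" using no[of a b c] mem[of a b c] G by auto
    qed
    ultimately show "?R1 \<and> ?R2" ..
  next
    assume R: "?R1 \<and> ?R2"
    show ?L
    proof
      fix w assume w: "w \<in> ?W"
      obtain a b c where abc: "w = mon3 a b c" "1 \<le> a" "a < b" "b < c" "c \<le> n" using sub[OF w] by blast
      have "if a = 1 then seg1 b c else seg a b c" using mem[OF abc(2-5)] w abc(1) by simp
      have "\<not> {a, b, c} \<subseteq> G"
      proof (cases "a = 1")
        case True
        then have "seg1 b c" "1 < b" using \<open>if a = 1 then _ else _\<close> abc by simp_all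
        then show ?thesis using R abc(4) True by blast
      next
        case False
        then have "seg a b c" "2 \<le> a" using \<open>if a = 1 then _ else _\<close> abc by simp_all
        then show ?thesis using R abc(3,4) by blast
      qed
      then show "\<not> vars w \<subseteq> G" using abc by (simp add: vars_mon3)
    qed
  qed
  then have eq: "{G. G \<subseteq> {1..n} \<and> (\<forall>w\<in>?W. \<not> vars w \<subseteq> G)} = \<Delta>"
    unfolding \<Delta>_def by (intro Collect_cong conj_cong refl)
  have "Idl\<^bsub>poly_ring n\<^esub> (monom ` ?W) = (face_ideal n {G. G \<subseteq> {1..n} \<and> (\<forall>w\<in>?W. \<not> vars w \<subseteq> G)} :: ((nat \<Rightarrow>\<^sub>0 nat) \<Rightarrow>\<^sub>0 'k) set)"
    by (rule genideal_squarefree_monomials) (auto simp: lexsegment_def squarefree_monomials_def)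
  then show ?thesis unfolding lexsegment_ideal_def eq .
qed

lemma \<Delta>_subset: "\<Delta> \<subseteq> Pow {1..n}"
  by (auto simp: \<Delta>_def)

lemma finite_\<Delta>: "finite \<Delta>" "G \<in> \<Delta> \<Longrightarrow> finite G"
  using finite_subset[OF \<Delta>_subset] \<Delta>_subset finite_subset[of G "{1..n}"] by auto

lemma down_closed_\<Delta>: "down_closed \<Delta>"
  unfolding down_closed_def \<Delta>_def by blast

lemma pair_face: "a \<in> {1..n} \<Longrightarrow> b \<in> {1..n} \<Longrightarrow> {a, b} \<in> \<Delta>"
  by (auto simp: \<Delta>_def)

lemma triangle_face: "2 \<le> a \<Longrightarrow> a < b \<Longrightarrow> b < c \<Longrightarrow> c \<le> n \<Longrightarrow> \<not> seg a b c \<Longrightarrow> {a, b, c} \<in> \<Delta>"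
  by (auto simp: \<Delta>_def)

lemma triangle1_face: "1 < b \<Longrightarrow> b < c \<Longrightarrow> c \<le> n \<Longrightarrow> \<not> seg1 b c \<Longrightarrow> {1, b, c} \<in> \<Delta>"
  by (auto simp: \<Delta>_def)

lemma empty_face: "{} \<in> \<Delta>"
  by (simp add: \<Delta>_def)

section \<open>Shellings of the complex of a segment\<close>

lemma shelled_2: "shelled 2 \<Delta>"
  by (rule shelled_complete_graph[of "{1..n}"])
    (use i j down_closed_\<Delta> \<Delta>_subset pair_face in simp_all)

text \<open>
  Let \<open>p = i2 - 1\<close>. The triangles \<open>1, p, c\<close> share the edge \<open>1, p\<close> and contain all vertices. From there
  an edge may be attached as soon as some triangle of \<open>\<Delta>\<close> contains it whose two other edges are
  present. The vertex \<open>1\<close> gives all edges \<open>b, c\<close> with \<open>1, b, c\<close> a face, then \<open>i2\<close> the edges within \<open>{i2..i3-1}\<close>,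
  and \<open>p\<close> those within \<open>{i3..n}\<close>. The edges between \<open>{i2..i3-1}\<close> and \<open>{i3..n}\<close> are attached starting with \<open>i3-1, n\<close>, by the triangle
  \<open>p, i3-1, n\<close>; that this triangle is a face is the second assumption.
\<close>
lemma shelled_3:
  assumes i2: "3 \<le> i2" and nseg: "\<not> seg (i2 - 1) (i3 - 1) n"
  shows "shelled 3 \<Delta>"
proof -
  define p where "p = i2 - 1"
  have p: "2 \<le> p" "p < i2" "p < n" using i2 i by (auto simp: p_def)
  have nseg_p: "\<not> seg p b c" if "i3 \<le> b" for b c
    using nseg that i by (auto simp: seg_def p_def)
  have nseg_ge: "\<not> seg a b c" if "i2 \<le> a" for a b c
    using nseg that i by (auto simp: seg_def)
  define V where "V = {1..n} - {1, p}"
  define \<Gamma>\<^sub>0 where "\<Gamma>\<^sub>0 = {G. G - {1} - {p} \<subseteq> V \<and> (\<forall>x\<in>G - {1} - {p}. \<forall>y\<in>G - {1} - {p}. x = y)}"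
  have "shelled 1 {G. G \<subseteq> V \<and> (\<forall>x\<in>G. \<forall>y\<in>G. x = y)}"
    by (rule shelled_points[of _ n]) (use i i2 p in \<open>auto simp: V_def\<close>)
  then have "shelled (Suc 1) {G. G - {p} \<in> {G. G \<subseteq> V \<and> (\<forall>x\<in>G. \<forall>y\<in>G. x = y)}}"
    by (rule shelled_cone) (auto simp: V_def)
  then have "shelled (Suc (Suc 1)) {G. G - {1} \<in> {G. G - {p} \<in> {G. G \<subseteq> V \<and> (\<forall>x\<in>G. \<forall>y\<in>G. x = y)}}}"
    by (rule shelled_cone) (use p in \<open>auto simp: V_def\<close>)
  then have base: "shelled 3 \<Gamma>\<^sub>0" by (simp add: \<Gamma>\<^sub>0_def numeral_3_eq_3)
  have base_edges: "{1, c} \<in> \<Gamma>\<^sub>0" "{p, c} \<in> \<Gamma>\<^sub>0" if "c \<in> {1..n}" for c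
    using that p by (auto simp: \<Gamma>\<^sub>0_def V_def)
  show ?thesis
  proof (rule shelled_by_closure[OF finite_\<Delta> down_closed_\<Delta> base])
    show "\<Gamma>\<^sub>0 \<subseteq> \<Delta>"
    proof
      fix G assume G: "G \<in> \<Gamma>\<^sub>0"
      have "\<exists>c\<in>V. G \<subseteq> {1, p, c}"
      proof (cases "G \<subseteq> {1, p}")
        case True
        have "n \<in> V" using i i2 p by (auto simp: V_def)
        then show ?thesis using True by blast
      next
        case False
        then obtain c where "c \<in> G - {1} - {p}" by blast
        moreover have "G - {1} - {p} \<subseteq> V" "\<forall>x\<in>G - {1} - {p}. \<forall>y\<in>G - {1} - {p}. x = y"
          using G unfolding \<Gamma>\<^sub>0_def by blast+
        ultimately have "c \<in> V" "G - {1} - {p} \<subseteq> {c}" by blast+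
        then show ?thesis by blast
      qed
      then obtain c where c: "c \<in> V" "G \<subseteq> {1, p, c}" by blast
      have "{1, p, c} \<in> \<Delta>"
        using c(1) p triangle1_face[of p c] triangle1_face[of c p]
        by (cases "p < c") (auto simp: V_def seg1_def insert_commute)
      then show "G \<in> \<Delta>" using down_closedD[OF down_closed_\<Delta>] c(2) by blast
    qed
    fix \<Gamma> G
    assume \<Gamma>: "\<Gamma>\<^sub>0 \<subseteq> \<Gamma>" "\<Gamma> \<subseteq> \<Delta>" "down_closed \<Gamma>" and G: "G \<in> \<Delta>" "card G < 3"
      and rule: "\<And>F R. F \<in> \<Delta> \<Longrightarrow> 3 \<le> card F \<Longrightarrow> R \<subseteq> F \<Longrightarrow> (\<And>x. x \<in> R \<Longrightarrow> F - {x} \<in> \<Gamma>) \<Longrightarrow> R \<in> \<Gamma>"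
    have third: "{x, y} \<in> \<Gamma>"
      if xyz: "{x, y, z} \<in> \<Delta>" "x \<noteq> y" "x \<noteq> z" "y \<noteq> z" "{x, z} \<in> \<Gamma>" "{y, z} \<in> \<Gamma>" for x y z
    proof (rule rule[OF xyz(1)])
      have eqs: "{x, y, z} - {x} = {y, z}" "{x, y, z} - {y} = {x, z}" using xyz(2-4) by auto
      show "{x, y, z} - {t} \<in> \<Gamma>" if t: "t \<in> {x, y}" for t
      proof (cases "t = x")
        case True
        then show ?thesis using xyz(6) by (simp only: eqs)
      next
        case False
        then have "t = y" using t by blast
        then show ?thesis using xyz(5) by (simp only: eqs)
      qed
      show "3 \<le> card {x, y, z}" using xyz(2-4) by simp
    qed blast
    have e1: "{1, c} \<in> \<Gamma>" "{p, c} \<in> \<Gamma>" if "c \<in> {1..n}" for c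
      using base_edges[OF that] \<Gamma>(1) by auto
    have A: "{b, c} \<in> \<Gamma>" if "1 < b" "b < c" "c \<le> n" "\<not> seg1 b c" for b c
      using third[of b c 1] triangle1_face[OF that] e1[of b] e1[of c] that by (simp add: insert_commute)
    have B: "{b, c} \<in> \<Gamma>" if "i3 \<le> b" "b < c" "c \<le> n" for b c
      using third[of b c p] triangle_face[of p b c] nseg_p[OF that(1)] e1[of b] e1[of c] that p i
      by (simp add: insert_commute)
    have C: "{b, c} \<in> \<Gamma>" if "i2 \<le> b" "b < c" "c < i3" for b c
    proof (cases "b = i2")
      case True
      then show ?thesis using A[of b c] that i by (simp add: seg1_def)
    next
      case False
      have "{i2, b} \<in> \<Gamma>" "{i2, c} \<in> \<Gamma>" using A[of i2 b] A[of i2 c] False that i by (simp_all add: seg1_def)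
      then show ?thesis
        using third[of b c i2] triangle_face[of i2 b c] nseg_ge[of i2 b c] False that i
        by (simp add: insert_commute)
    qed
    have q: "p < i3 - 1" "i3 - 1 < n" "1 \<le> i3 - 1" using p i by (auto simp: p_def)
    have nseg': "\<not> seg p (i3 - 1) n" using nseg unfolding p_def .
    \<comment> \<open>The first edge between \<open>{i2..i3-1}\<close> and \<open>{i3..n}\<close>; each later one completes a triangle
      of the complex whose two other edges are already present.\<close>
    have D0: "{i3 - 1, n} \<in> \<Gamma>"
    proof (rule third[of _ _ p])
      show "{i3 - 1, n, p} \<in> \<Delta>"
        using triangle_face[OF p(1) q(1,2) _ nseg'] by (simp add: insert_commute)
      show "{i3 - 1, p} \<in> \<Gamma>" "{n, p} \<in> \<Gamma>"
        using e1(2)[of "i3 - 1"] e1(2)[of n] q by (simp_all add: insert_commute)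
    qed (use q p in auto)
    have D1: "{i3 - 1, c} \<in> \<Gamma>" if "i3 \<le> c" "c \<le> n" for c
    proof (cases "c = n")
      case False
      then show ?thesis
        using third[of "i3 - 1" c n] triangle_face[of "i3 - 1" c n] nseg_ge[of "i3 - 1" c n] B[of c n] D0 that i
        by (simp add: insert_commute)
    qed (use D0 in simp)
    have D: "{b, c} \<in> \<Gamma>" if "i2 \<le> b" "b < i3" "i3 \<le> c" "c \<le> n" for b c
    proof (cases "b = i3 - 1")
      case False
      then show ?thesis
        using third[of b c "i3 - 1"] triangle_face[of b "i3 - 1" c] nseg_ge[of b "i3 - 1" c]
          C[of b "i3 - 1"] D1[of c] that i
        by (simp add: insert_commute)
    qed (use D1 that in simp)
    have edges: "{b, c} \<in> \<Gamma>" if bc: "1 \<le> b" "b < c" "c \<le> n" for b c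
    proof -
      consider "b = 1" | "1 < b" "b < i2" | "i2 \<le> b" "c < i3" | "i2 \<le> b" "b < i3" "i3 \<le> c" | "i3 \<le> b"
        using bc by linarith
      then show ?thesis
        using e1[of c] A[of b c] B[of b c] C[of b c] D[of b c] bc by cases (auto simp: seg1_def)
    qed
    have Gn: "G \<subseteq> {1..n}" "finite G" using G \<Delta>_subset finite_\<Delta> by auto
    show "G \<in> \<Gamma>"
    proof (cases "\<exists>b\<in>G. \<exists>c\<in>G. b < c")
      case True
      then obtain b c where bc: "b \<in> G" "c \<in> G" "b < c" by blast
      have "{b, c} = G" using G(2) bc Gn(2) by (intro card_seteq) auto
      then show ?thesis using edges[of b c] bc Gn(1) by auto
    next
      case False
      then have single: "x = y" if "x \<in> G" "y \<in> G" for x y using that linorder_neqE_nat by blast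
      have "1 \<in> {1..n}" using i by simp
      moreover have "\<exists>c\<in>{1..n}. G \<subseteq> {1, c}"
      proof (cases "G = {}")
        case False
        then obtain c where c: "c \<in> G" by blast
        then have "G \<subseteq> {1, c}" using single by blast
        then show ?thesis using c Gn(1) by blast
      qed (use calculation in blast)
      ultimately show ?thesis using e1(1) down_closedD[OF \<Gamma>(3)] by blast
    qed
  qed
qed

text \<open>
  The faces of \<open>\<Delta>\<close> on the vertices \<open>1, m, \<dots>, n\<close>, if triples without 1 are ignored. These complexes are what
  is left after splitting off the vertices 2 and 3.
\<close>
definition tail_complex :: "nat \<Rightarrow> nat set set" where
  "tail_complex m = {G. G \<subseteq> insert 1 {m..n} \<and> (1 \<in> G \<longrightarrow> (\<forall>b\<in>G. \<forall>c\<in>G. 1 < b \<longrightarrow> b < c \<longrightarrow> \<not> seg1 b c))}"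

lemma shelled_tail_complex_2:
  assumes "2 \<le> m" "m \<le> n"
  shows "shelled 2 (tail_complex m)"
proof (rule shelled_complete_graph[of "insert 1 {m..n}"])
  show "2 \<le> card (insert 1 {m..n})" using assms by simp
  show "down_closed (tail_complex m)" unfolding down_closed_def tail_complex_def by blast
qed (auto simp: tail_complex_def)

text \<open>
  Each vertex \<open>m < i2\<close> lies in no forbidden triple, so the complex is a cone over the next one.
\<close>
lemma shelled_tail_complex:
  assumes "2 \<le> m" "m \<le> i2"
  shows "shelled (i2 - m + 2) (tail_complex m)"
  using assms(2)
proof (induction rule: inc_induct)
  case base
  show ?case using shelled_tail_complex_2[of i2] i by (simp add: numeral_2_eq_2)
next
  case (step k)
  have k: "2 \<le> k" "k < i2" using step.hyps assms(1) by simp_all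
  have "shelled (Suc (i2 - Suc k + 2)) {G. G - {k} \<in> tail_complex (Suc k)}"
    by (rule shelled_cone[OF step.IH]) (use k in \<open>auto simp: tail_complex_def\<close>)
  also have "{G. G - {k} \<in> tail_complex (Suc k)} = tail_complex k"
  proof (intro equalityI subsetI)
    fix G assume G: "G \<in> {G. G - {k} \<in> tail_complex (Suc k)}"
    have "G \<subseteq> insert 1 {k..n}"
    proof
      fix x assume "x \<in> G"
      then show "x \<in> insert 1 {k..n}" using G k i by (cases "x = k") (auto simp: tail_complex_def)
    qed
    moreover have "\<not> seg1 b c" if "1 \<in> G" "b \<in> G" "c \<in> G" "1 < b" "b < c" for b c
    proof (cases "b = k \<or> c = k")
      case False
      then show ?thesis using G that k by (auto simp: tail_complex_def)
    qed (use that k in \<open>auto simp: seg1_def\<close>)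
    ultimately show "G \<in> tail_complex k" by (auto simp: tail_complex_def)
  next
    fix G assume "G \<in> tail_complex k"
    then have G: "G \<subseteq> insert 1 {k..n}" "1 \<in> G \<Longrightarrow> \<forall>b\<in>G. \<forall>c\<in>G. 1 < b \<longrightarrow> b < c \<longrightarrow> \<not> seg1 b c"
      by (auto simp: tail_complex_def)
    have "G - {k} \<subseteq> insert 1 {Suc k..n}"
    proof
      fix x assume "x \<in> G - {k}"
      then show "x \<in> insert 1 {Suc k..n}" using G(1) by (cases "x = 1") auto
    qed
    then show "G \<in> {G. G - {k} \<in> tail_complex (Suc k)}" using G(2) by (auto simp: tail_complex_def)
  qed
  finally show ?case using k by (simp add: Suc_diff_Suc)
qed

definition seg1_free :: "nat set \<Rightarrow> bool" where
  "seg1_free G \<longleftrightarrow> (\<forall>b\<in>G. \<forall>c\<in>G. 1 < b \<longrightarrow> b < c \<longrightarrow> \<not> seg1 b c)"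

lemma mem_tail_complex: "G \<in> tail_complex m \<longleftrightarrow> G \<subseteq> insert 1 {m..n} \<and> (1 \<in> G \<longrightarrow> seg1_free G)"
  by (simp add: tail_complex_def seg1_free_def)

lemma seg1_free_insert: "x < i2 \<Longrightarrow> seg1_free (insert x G) \<longleftrightarrow> seg1_free G"
  by (auto simp: seg1_free_def seg1_def)

lemma mem_\<Delta>:
  assumes "j1 = 2" "j2 = 3"
  shows "G \<in> \<Delta> \<longleftrightarrow> G \<subseteq> {1..n} \<and> (1 \<in> G \<longrightarrow> seg1_free G) \<and>
    (2 \<in> G \<longrightarrow> 3 \<in> G \<longrightarrow> (\<forall>c\<in>G. 3 < c \<longrightarrow> j3 < c))"
proof -
  have seg: "seg a b c \<longleftrightarrow> a = 2 \<and> b = 3 \<and> c \<le> j3" if "2 \<le> a" "a < b" for a b c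
    unfolding seg_def using that assms by auto
  have "(\<forall>a\<in>G. \<forall>b\<in>G. \<forall>c\<in>G. 2 \<le> a \<longrightarrow> a < b \<longrightarrow> b < c \<longrightarrow> \<not> seg a b c) \<longleftrightarrow>
    (2 \<in> G \<longrightarrow> 3 \<in> G \<longrightarrow> (\<forall>c\<in>G. 3 < c \<longrightarrow> j3 < c))" (is "?L \<longleftrightarrow> ?R")
  proof
    assume ?L
    show ?R
    proof (intro impI ballI)
      fix c assume "2 \<in> G" "3 \<in> G" "c \<in> G" "3 < c"
      then have "\<not> seg 2 3 c" using \<open>?L\<close> by simp
      then show "j3 < c" using seg[of 2 3 c] by simp
    qed
  next
    assume ?R
    show ?L
    proof (intro impI ballI)
      fix a b c assume abc: "a \<in> G" "b \<in> G" "c \<in> G" "2 \<le> a" "a < b" "b < c"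
      show "\<not> seg a b c"
      proof
        assume "seg a b c"
        then have "a = 2" "b = 3" "c \<le> j3" using seg[OF abc(4,5)] by simp_all
        moreover from this have "2 \<in> G" "3 \<in> G" "3 < c" using abc(1,2,6) by simp_all
        ultimately show False using \<open>?R\<close> abc(3) by fastforce
      qed
    qed
  qed
  then show ?thesis by (simp add: \<Delta>_def seg1_free_def)
qed

text \<open>
  The vertices \<open>j3 + 1, \<dots>, i2 - 1\<close> are cone points of \<open>\<Delta>\<close>; their number is the truncated difference
  \<open>i2 - 1 - j3\<close>. Splitting at 2 and then at 3 leaves the tail complexes that start at 3, at 4 and at \<open>j3 + 1\<close>.
\<close>
lemma shelled_free_variables:
  assumes j1: "j1 = 2" "j2 = 3" and i2: "5 \<le> i2" and j3: "j3 < n"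
  shows "shelled (i2 - 1 - j3 + 4) \<Delta>"
proof -
  define f where "f = i2 - 1 - j3"
  have n: "2 \<le> n" "3 \<le> n" "3 < j3" using i i2 j j1 by simp_all
  define B where "B = {G. 2 \<notin> G \<and> insert 2 G \<in> \<Delta>}"
  have down_B: "down_closed B"
    unfolding down_closed_def
  proof (intro ballI allI impI)
    fix G H assume "G \<in> B" "H \<subseteq> G"
    then have "insert 2 H \<subseteq> insert 2 G" "2 \<notin> H" by (auto simp: B_def)
    then show "H \<in> B" using \<open>G \<in> B\<close> down_closedD[OF down_closed_\<Delta>] by (auto simp: B_def)
  qed
  have mem_B: "G \<in> B \<longleftrightarrow> 2 \<notin> G \<and> G \<subseteq> {1..n} \<and> (1 \<in> G \<longrightarrow> seg1_free G) \<and> (3 \<in> G \<longrightarrow> (\<forall>c\<in>G. 3 < c \<longrightarrow> j3 < c))" for G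
    using i2 n by (simp add: B_def mem_\<Delta>[OF j1] seg1_free_insert)
  have sub3: "G \<subseteq> insert 1 {3..n} \<longleftrightarrow> 2 \<notin> G \<and> G \<subseteq> {1..n}" for G
  proof -
    have "insert 1 {3..n} = {1..n} - {2}" using n by auto
    then show ?thesis by blast
  qed
  have sub4: "G \<subseteq> insert 1 {4..n} \<longleftrightarrow> 2 \<notin> G \<and> 3 \<notin> G \<and> G \<subseteq> {1..n}" for G
  proof -
    have "insert 1 {4..n} = {1..n} - {2} - {3}" using n by auto
    then show ?thesis by blast
  qed
  have subj: "G \<subseteq> insert 1 {j3 + 1..n} \<longleftrightarrow> 2 \<notin> G \<and> 3 \<notin> G \<and> G \<subseteq> {1..n} \<and> (\<forall>c\<in>G. 3 < c \<longrightarrow> j3 < c)" for G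
  proof -
    have "insert 1 {j3 + 1..n} = {c \<in> {1..n} - {2} - {3}. 3 < c \<longrightarrow> j3 < c}" using n by auto
    then show ?thesis by blast
  qed
  have "shelled (Suc (f + 3)) \<Delta>"
  proof (rule shelled_by_vertex[OF down_closed_\<Delta>, of _ 2])
    have "{G \<in> \<Delta>. 2 \<notin> G} = tail_complex 3"
      by (rule Set.set_eqI) (auto simp only: mem_Collect_eq mem_tail_complex mem_\<Delta>[OF j1] sub3)
    moreover have "shelled (i2 - 3 + 2) (tail_complex 3)" using i2 by (intro shelled_tail_complex) auto
    ultimately show "shelled (Suc (f + 3)) {G \<in> \<Delta>. 2 \<notin> G}"
      using i2 n by (simp only:) (rule shelled_mono, assumption, simp add: f_def)
    have "shelled (Suc (f + 2)) B"
    proof (rule shelled_by_vertex[OF down_B, of _ 3])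
      have "{G \<in> B. 3 \<notin> G} = tail_complex 4"
        by (rule Set.set_eqI) (auto simp only: mem_Collect_eq mem_tail_complex mem_B sub4)
      moreover have "shelled (i2 - 4 + 2) (tail_complex 4)" using i2 by (intro shelled_tail_complex) auto
      ultimately show "shelled (Suc (f + 2)) {G \<in> B. 3 \<notin> G}"
        using i2 n by (simp only:) (rule shelled_mono, assumption, simp add: f_def)
      have "3 \<notin> G \<and> insert 3 G \<in> B \<longleftrightarrow> G \<in> tail_complex (j3 + 1)" for G
        unfolding mem_tail_complex subj mem_B using i2 n by (auto simp: seg1_free_insert)
      then have "{G. 3 \<notin> G \<and> insert 3 G \<in> B} = tail_complex (j3 + 1)" by blast
      moreover have "shelled (f + 2) (tail_complex (j3 + 1))"
      proof (cases "j3 + 1 \<le> i2")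
        case True
        then show ?thesis using shelled_tail_complex[of "j3 + 1"] n by (simp add: f_def)
      next
        case False
        then show ?thesis using shelled_tail_complex_2[of "j3 + 1"] n j3 by (simp add: f_def numeral_2_eq_2)
      qed
      ultimately show "shelled (f + 2) {G. 3 \<notin> G \<and> insert 3 G \<in> B}" by simp
    qed
    then show "shelled (f + 3) {G. 2 \<notin> G \<and> insert 2 G \<in> \<Delta>}" by (simp add: B_def numeral_3_eq_3)
  qed
  then show ?thesis by (simp add: f_def add.commute)
qed

text \<open>
  Split at 1. In the link of 1 each vertex from \<open>i3\<close> on is adjacent only to 2 and 3, so these vertices are
  split off one at a time, with the edge \<open>{2, 3}\<close> as link: the triangle on 2, 3 and such a vertex is
  a face of the link of 1 because \<open>j3 < i3\<close>.
\<close>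
lemma shelled_4:
  assumes j1: "j1 = 2" "j2 = 3" and i2: "i2 = 4" and j3: "j3 + 1 < i3"
  shows "shelled 4 \<Delta>"
proof -
  have n: "6 \<le> n" "3 < j3" "6 \<le> i3" "j3 + 2 \<le> n" using i j j1 j3 by simp_all
  have seg1: "seg1 b c \<longleftrightarrow> 4 < b \<or> b = 4 \<and> i3 \<le> c" for b c
    unfolding seg1_def using i2 by simp
  define no23 :: "nat set \<Rightarrow> bool" where
    "no23 G \<longleftrightarrow> (2 \<in> G \<longrightarrow> 3 \<in> G \<longrightarrow> (\<forall>c\<in>G. 3 < c \<longrightarrow> j3 < c))" for G
  have no23_mono: "no23 H" if "no23 G" "H \<subseteq> G" for G H
    using that unfolding no23_def by blast
  have free_mono: "seg1_free H" if "seg1_free G" "H \<subseteq> G" for G H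
    using that unfolding seg1_free_def by blast
  define M where "M m = {G. G \<subseteq> {2..m} \<and> seg1_free G \<and> no23 G}" for m
  have down_M: "down_closed (M m)" for m
    unfolding down_closed_def M_def using no23_mono free_mono by blast
  have free: "seg1_free G \<longleftrightarrow> (\<forall>b\<in>G. \<forall>c\<in>G. 4 < b \<longrightarrow> 4 < c \<longrightarrow> b = c)" (is "_ \<longleftrightarrow> ?R")
    if G: "G \<subseteq> {2..i3 - 1}" for G
  proof
    assume L: "seg1_free G"
    show ?R
    proof (intro ballI impI)
      fix b c assume bc: "b \<in> G" "c \<in> G" "4 < b" "4 < c"
      have "\<not> b < c" "\<not> c < b" using L bc unfolding seg1_free_def seg1 by auto
      then show "b = c" by simp
    qed
  next
    assume R: ?R
    show "seg1_free G"
      unfolding seg1_free_def seg1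
    proof (intro ballI impI)
      fix b c assume bc: "b \<in> G" "c \<in> G" "1 < b" "b < c"
      have "\<not> 4 < b"
      proof
        assume "4 < b"
        then show False using R bc by (metis less_trans nat_neq_iff)
      qed
      moreover have "c \<le> i3 - 1" using bc(2) G by auto
      ultimately show "\<not> (4 < b \<or> b = 4 \<and> i3 \<le> c)" using n(3) by linarith
    qed
  qed
  have shelled_M: "shelled 3 (M m)" if "i3 - 1 \<le> m" "m \<le> n" for m
    using that
  proof (induction m rule: dec_induct)
    case base
    have "M (i3 - 1) = {G. G \<subseteq> {2..i3 - 1} \<and> (\<forall>b\<in>G. \<forall>c\<in>G. 4 < b \<longrightarrow> 4 < c \<longrightarrow> b = c) \<and>
        (2 \<in> G \<longrightarrow> 3 \<in> G \<longrightarrow> (\<forall>c\<in>G. 3 < c \<longrightarrow> j3 < c))}"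
      unfolding M_def no23_def using free by (intro Collect_cong conj_cong refl)
    then show ?case using shelled_isolated_tail[of j3 "i3 - 1"] n j3 by simp
  next
    case (step m)
    let ?v = "Suc m"
    have v: "i3 \<le> ?v" "?v \<le> n" "j3 < ?v" "3 < ?v" using step.hyps step.prems n j3 by auto
    have eq: "{2..m} = {2..?v} - {?v}" by auto
    have "shelled (Suc 2) (M ?v)"
    proof (rule shelled_by_vertex'[OF down_M])
      show "{G \<in> M ?v. ?v \<notin> G} = M m" unfolding M_def eq by blast
      show "shelled (Suc 2) (M m)" using step.IH v by (simp only: shelled_Suc Suc_leD)
      show "{G. ?v \<notin> G \<and> insert ?v G \<in> M ?v} = Pow {2, 3}"
      proof (intro equalityI subsetI)
        fix G assume "G \<in> {G. ?v \<notin> G \<and> insert ?v G \<in> M ?v}"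
        then have G: "G \<subseteq> {2..m}" "seg1_free (insert ?v G)" unfolding M_def eq by blast+
        have "x \<in> {2, 3}" if x: "x \<in> G" for x
        proof -
          have "2 \<le> x" "x < ?v" using G(1) x by auto
          moreover have "\<not> seg1 x ?v" using G(2) x calculation unfolding seg1_free_def by auto
          ultimately show ?thesis unfolding seg1 using v(1) by auto
        qed
        then show "G \<in> Pow {2, 3}" by blast
      next
        fix G :: "nat set" assume "G \<in> Pow {2, 3}"
        then have G: "G \<subseteq> {2, 3}" by simp
        have "{2, 3, ?v} \<in> M ?v"
        proof -
          have "seg1_free {2, 3, ?v}" unfolding seg1_free_def seg1 using v by auto
          moreover have "no23 {2, 3, ?v}" unfolding no23_def using v by auto
          ultimately show ?thesis using v by (simp add: M_def)
        qed
        moreover have "insert ?v G \<subseteq> {2, 3, ?v}" using G by blast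
        ultimately have "insert ?v G \<in> M ?v" by (rule down_closedD[OF down_M])
        moreover have "?v \<notin> G" using G v(4) by auto
        ultimately show "G \<in> {G. ?v \<notin> G \<and> insert ?v G \<in> M ?v}" by simp
      qed
      show "shelled 2 (Pow {2, 3 :: nat})" by (rule shelled_simplex) auto
    qed
    then show ?case by (simp only: shelled_Suc)
  qed
  have sub: "{2..n} = {1..n} - {1}" and one: "1 \<in> {1..n}" using n by auto
  have "shelled (Suc 3) \<Delta>"
  proof (rule shelled_by_vertex'[OF down_closed_\<Delta>])
    show "{G \<in> \<Delta>. 1 \<notin> G} = {G. G \<subseteq> {2..n} \<and> (2 \<in> G \<longrightarrow> 3 \<in> G \<longrightarrow> (\<forall>c\<in>G. 3 < c \<longrightarrow> j3 < c))}"
      unfolding sub mem_\<Delta>[OF j1] by blast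
    show "shelled (Suc 3) {G. G \<subseteq> {2..n} \<and> (2 \<in> G \<longrightarrow> 3 \<in> G \<longrightarrow> (\<forall>c\<in>G. 3 < c \<longrightarrow> j3 < c))}"
      using shelled_small_faces_on_23[OF n(2,4)] by (simp only: shelled_Suc)
    show "{G. 1 \<notin> G \<and> insert 1 G \<in> \<Delta>} = M n"
    proof (rule Set.set_eqI)
      fix G
      have "no23 (insert 1 G) \<longleftrightarrow> no23 G" by (simp add: no23_def)
      moreover have "1 \<notin> G \<and> insert 1 G \<subseteq> {1..n} \<longleftrightarrow> G \<subseteq> {2..n}" unfolding sub using one by blast
      ultimately show "G \<in> {G. 1 \<notin> G \<and> insert 1 G \<in> \<Delta>} \<longleftrightarrow> G \<in> M n"
        unfolding mem_Collect_eq mem_\<Delta>[OF j1] M_def no23_def[symmetric] seg1_free_insert[OF i(1)] by blast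
    qed
    show "shelled 3 (M n)" using i by (intro shelled_M) auto
  qed
  then show ?thesis by (simp only: shelled_Suc)
qed

section \<open>Obstructions in the complex of a segment\<close>

context
  fixes fs :: "((nat \<Rightarrow>\<^sub>0 nat) \<Rightarrow>\<^sub>0 'k::field) list"
  assumes reg: "poly.weakly_regular n (face_ideal n \<Delta>) fs" "set fs \<subseteq> face_ideal n {{}}"
begin

text \<open>
  The class is the coboundary of the indicator function of \<open>{i3..n}\<close>, but restricted to edges with both ends at
  least \<open>i2\<close>. It is a cocycle as no face contains a vertex below \<open>i2\<close> together with one in
  \<open>{i2..i3-1}\<close> and one in \<open>{i3..n}\<close>; for a vertex other than 1 this is where the assumption enters.
\<close>
lemma length_le_2:
  assumes "seg (i2 - 1) (i3 - 1) n"
  shows "length fs \<le> 2"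
proof -
  define g :: "nat \<Rightarrow> 'k" where "g x = (if i3 \<le> x then 1 else 0)" for x
  define \<phi> where "\<phi> x y = (if i2 \<le> x \<and> i2 \<le> y then g y - g x else 0)" for x y
  have nonface: "{x, y, z} \<notin> \<Delta>" if x: "x < i2" and yz: "i2 \<le> y" "y < i3" "i3 \<le> z" for x y z
  proof
    assume face: "{x, y, z} \<in> \<Delta>"
    then have n: "1 \<le> x" "z \<le> n" using \<Delta>_subset by auto
    show False
    proof (cases "x = 1")
      case True
      have "seg1 y z" using yz by (auto simp: seg1_def)
      then show False using face True yz i by (auto simp: \<Delta>_def)
    next
      case False
      have "seg x y z" using assms n x yz by (auto simp: seg_def)
      then show False using face False n x yz by (auto simp: \<Delta>_def)
    qed
  qed
  have eq: "g y = g z" if "x < i2" "i2 \<le> y" "i2 \<le> z" "{x, y, z} \<in> \<Delta>" for x y z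
  proof -
    have "{x, z, y} \<in> \<Delta>" using that(4) by (simp add: insert_commute)
    then have "\<not> (y < i3 \<and> i3 \<le> z)" "\<not> (z < i3 \<and> i3 \<le> y)"
      using nonface[of x y z] nonface[of x z y] that by blast+
    then show ?thesis by (auto simp: g_def)
  qed
  show ?thesis
  proof (rule loop_bound[OF down_closed_\<Delta> \<Delta>_subset reg])
    show "\<phi> b c - \<phi> a c + \<phi> a b = 0" if "{a, b, c} \<in> \<Delta>" for a b c
      using that eq[of a b c] eq[of b a c] eq[of c a b]
      by (auto simp: \<phi>_def insert_commute not_le)
    show "{1, i2} \<in> \<Delta>" "{i2, i3} \<in> \<Delta>" "{1, i3} \<in> \<Delta>" using i by (auto intro!: pair_face)
    show "\<phi> i2 i3 - \<phi> 1 i3 + \<phi> 1 i2 \<noteq> 0" using i by (simp add: \<phi>_def g_def)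
  qed
qed

text \<open>
  The facet consists of \<open>1, 2, 3\<close>, the cone points \<open>j3 + 1, \<dots>, i2 - 1\<close>, and \<open>n\<close>. A further vertex is either at most \<open>j3\<close>,
  and forms a triple of the segment with 2 and 3, or at least \<open>i2\<close>, and forms one with 1 and \<open>n\<close>.
\<close>
lemma length_le_facet:
  assumes j1: "j1 = 2" "j2 = 3" and i2: "4 \<le> i2" and j3: "j3 < n"
  shows "length fs \<le> i2 - 1 - j3 + 4"
proof -
  let ?F = "{1, 2, 3} \<union> {j3 + 1..i2 - 1} \<union> {n}"
  have n: "3 < j3" "i2 < n" using i j j1 by auto
  have "length fs \<le> card ?F"
  proof (rule facet_bound[OF down_closed_\<Delta> \<Delta>_subset reg])
    have "seg1_free ?F" using n i2 by (auto simp: seg1_free_def seg1_def)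
    moreover have "?F \<subseteq> {1..n}" using n i2 by auto
    moreover have "\<forall>c\<in>?F. 3 < c \<longrightarrow> j3 < c" using j3 by auto
    ultimately show "?F \<in> \<Delta>" unfolding mem_\<Delta>[OF j1] by blast
    show "insert t ?F \<notin> \<Delta>" if t: "t \<notin> ?F" for t
    proof
      assume "insert t ?F \<in> \<Delta>"
      then have *: "t \<in> {1..n}" "seg1_free (insert t ?F)" "\<forall>c\<in>insert t ?F. 3 < c \<longrightarrow> j3 < c"
        unfolding mem_\<Delta>[OF j1] by blast+
      have "t \<noteq> 1" "t \<noteq> 2" "t \<noteq> 3" "t \<noteq> n" using t by auto
      then have "3 < t" "t < n" using *(1) by auto
      then have "j3 < t" using *(3) by auto
      then have "i2 \<le> t" using t by auto
      then have "seg1 t n" using i by (auto simp: seg1_def)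
      then show False using *(2) \<open>3 < t\<close> \<open>t < n\<close> by (auto simp: seg1_free_def)
    qed
  qed
  also have "card ?F = i2 - 1 - j3 + 4"
  proof -
    have "card ({j3 + 1..i2 - 1} \<union> {1, 2, 3, n}) = card {j3 + 1..i2 - 1} + card {1, 2, 3, n}"
      using n by (intro card_Un_disjoint) auto
    moreover have "card {1, 2, 3, n} = 4" using n i2 by auto
    moreover have "?F = {j3 + 1..i2 - 1} \<union> {1, 2, 3, n}" by auto
    ultimately show ?thesis by simp
  qed
  finally show ?thesis .
qed

lemma length_le_3_123:
  assumes "3 \<le> i2" and "\<not> (j1 = 2 \<and> j2 = 3 \<and> j3 < n)"
  shows "length fs \<le> 3"
proof -
  have "length fs \<le> card {1, 2, 3 :: nat}"
  proof (rule facet_bound[OF down_closed_\<Delta> \<Delta>_subset reg])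
    show "{1, 2, 3} \<in> \<Delta>" using assms i by (intro triangle1_face) (auto simp: seg1_def)
    show "insert t {1, 2, 3} \<notin> \<Delta>" if t: "t \<notin> {1, 2, 3}" for t
    proof
      assume face: "insert t {1, 2, 3} \<in> \<Delta>"
      then have "t \<le> n" "1 \<le> t" using \<Delta>_subset by auto
      then have "3 < t" using t by auto
      have "seg 2 3 t" using assms(2) j \<open>t \<le> n\<close> by (auto simp: seg_def)
      then show False using face \<open>3 < t\<close> by (auto simp: \<Delta>_def)
    qed
  qed
  then show ?thesis by simp
qed

lemma length_le_3_12n:
  assumes "i2 = 3"
  shows "length fs \<le> 3"
proof -
  have n: "3 < n" using i assms by simp
  have "length fs \<le> card {1, 2, n}"
  proof (rule facet_bound[OF down_closed_\<Delta> \<Delta>_subset reg])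
    have "\<not> seg1 2 n" unfolding seg1_def using assms by simp
    then show "{1, 2, n} \<in> \<Delta>" using n by (intro triangle1_face) auto
    show "insert t {1, 2, n} \<notin> \<Delta>" if t: "t \<notin> {1, 2, n}" for t
    proof
      assume face: "insert t {1, 2, n} \<in> \<Delta>"
      then have "t \<le> n" "1 \<le> t" using \<Delta>_subset by auto
      then have t: "3 \<le> t" "t < n" using t by auto
      then have "seg1 t n" unfolding seg1_def using assms i by auto
      then show False using face t by (auto simp: \<Delta>_def)
    qed
  qed
  then show ?thesis using n by simp
qed

text \<open>
  In the link of \<open>{1, 2}\<close> the vertex 3 is adjacent only to vertices above \<open>j3\<close>, hence from \<open>i3\<close> on, and 4 only to
  vertices below \<open>i3\<close>; no other edges exist. So \<open>{4..<i3}\<close> is a union of components.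
\<close>
lemma length_le_3_link12:
  assumes j1: "j1 = 2" "j2 = 3" and i2: "i2 = 4" and j3: "i3 - 1 \<le> j3"
  shows "length fs \<le> 3"
proof -
  have n: "4 < i3" "i3 \<le> n" using i i2 by linarith+
  have seg1: "seg1 b c \<longleftrightarrow> 4 < b \<or> b = 4 \<and> i3 \<le> c" for b c
    unfolding seg1_def using i2 by simp
  have "length fs \<le> card {1, 2 :: nat} + 1"
  proof (rule disconnected_link_bound[OF down_closed_\<Delta> \<Delta>_subset reg, where X = "{4..<i3}" and a = 4 and b = 3])
    show "{1, 2} \<in> \<Delta>" using n by (intro pair_face) auto
    show "insert 4 {1, 2} \<in> \<Delta>" "insert 3 {1, 2} \<in> \<Delta>"
      using triangle1_face[of 2 4] triangle1_face[of 2 3] n seg1 by (auto simp: insert_commute)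
    fix s t assume st: "s \<notin> {1, 2}" "t \<notin> {1, 2}" "s \<in> {4..<i3}" "t \<notin> {4..<i3}"
    show "insert s (insert t {1, 2}) \<notin> \<Delta>"
    proof
      assume face: "insert s (insert t {1, 2}) \<in> \<Delta>"
      then have t: "1 \<le> t" "t \<le> n" using \<Delta>_subset by auto
      show False
      proof (cases "t = 3")
        case True
        then have "j3 < s" using face st(3) by (auto simp: mem_\<Delta>[OF j1])
        then show False using st(3) j3 by auto
      next
        case False
        then have "i3 \<le> t" using st t by auto
        then have "seg1 s t" "s < t" using st(3) seg1 by auto
        then show False using face st(3) by (auto simp: \<Delta>_def)
      qed
    qed
  qed (use n in auto)
  then show ?thesis by simp
qed

end

end

section \<open>Depth of squarefree lexsegment ideals of degree three\<close>

theorem theorem6: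
  fixes n i2 i3 j1 j2 j3 :: nat
    and u v :: "nat \<Rightarrow>\<^sub>0 nat"
    and S :: "((nat \<Rightarrow>\<^sub>0 nat) \<Rightarrow>\<^sub>0 'k::field) ring"
    and \<mm> I :: "((nat \<Rightarrow>\<^sub>0 nat) \<Rightarrow>\<^sub>0 'k) set"
  assumes S: "S = poly_ring n"
    and m: "\<mm> = graded_max_ideal n"
    and i: "1 < i2" "i2 < i3" "i3 \<le> n"
    and j: "2 \<le> j1" "j1 < j2" "j2 < j3" "j3 \<le> n"
    and u: "u = mon3 1 i2 i3"
    and v: "v = mon3 j1 j2 j3"
    and I: "I = lexsegment_ideal n u v"
  shows
    "(v \<le> mon3 (i2 - 1) (i3 - 1) n \<longrightarrow> depth S \<mm> (quot_module S I) = 2) \<and>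
     ((i2 = 4 \<and> i3 \<ge> 6 \<and> j1 = 2 \<and> j2 = 3 \<and> j3 < i3 - 1) \<or>
      (i2 \<ge> 5 \<and> j1 = 2 \<and> j2 = 3 \<and> i2 - 1 \<le> j3 \<and> j3 \<le> n - 1)
        \<longrightarrow> depth S \<mm> (quot_module S I) = 4) \<and>
     (i2 > 4 \<and> j1 = 2 \<and> j2 = 3 \<and> j3 \<le> i2 - 1
        \<longrightarrow> depth S \<mm> (quot_module S I) = enat (i2 - j3 + 3)) \<and>
     (\<not> v \<le> mon3 (i2 - 1) (i3 - 1) n \<and>
      \<not> ((i2 = 4 \<and> i3 \<ge> 6 \<and> j1 = 2 \<and> j2 = 3 \<and> j3 < i3 - 1) \<or>
         (i2 \<ge> 5 \<and> j1 = 2 \<and> j2 = 3 \<and> i2 - 1 \<le> j3 \<and> j3 \<le> n - 1)) \<and>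
      \<not> (i2 > 4 \<and> j1 = 2 \<and> j2 = 3 \<and> j3 \<le> i2 - 1)
        \<longrightarrow> depth S \<mm> (quot_module S I) = 3)"
proof -
  interpret L: lex_complex n i2 i3 j1 j2 j3
    by unfold_locales (use i j in auto)
  have depth: "depth S \<mm> (quot_module S I) = enat r"
    if "shelled r L.\<Delta>" and "\<And>fs :: ((nat \<Rightarrow>\<^sub>0 nat) \<Rightarrow>\<^sub>0 'k) list.
      poly.weakly_regular n (face_ideal n L.\<Delta>) fs \<Longrightarrow> set fs \<subseteq> face_ideal n {{}} \<Longrightarrow> length fs \<le> r" for r
    unfolding m I u v L.lexsegment_ideal_eq
    by (rule depth_face_ideal[OF L.\<Delta>_subset L.empty_face that S])
  have seg: "v \<le> mon3 (i2 - 1) (i3 - 1) n \<longleftrightarrow> L.seg (i2 - 1) (i3 - 1) n"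
    unfolding v L.seg_def using i j by (intro mon3_le_iff) auto
  have a: "depth S \<mm> (quot_module S I) = 2" if "v \<le> mon3 (i2 - 1) (i3 - 1) n"
    using depth[OF L.shelled_2 L.length_le_2] that seg by (simp add: numeral_eq_enat)
  have bc: "depth S \<mm> (quot_module S I) = enat (i2 - 1 - j3 + 4)"
    if "i2 \<ge> 5" "j1 = 2" "j2 = 3" "j3 < n"
    using that by (intro depth L.shelled_free_variables L.length_le_facet) auto
  have b4: "depth S \<mm> (quot_module S I) = 4" if *: "i2 = 4" "j1 = 2" "j2 = 3" "j3 < i3 - 1"
  proof -
    have "depth S \<mm> (quot_module S I) = enat 4"
    proof (rule depth)
      show "shelled 4 L.\<Delta>" using * by (intro L.shelled_4) auto
      fix fs :: "((nat \<Rightarrow>\<^sub>0 nat) \<Rightarrow>\<^sub>0 'k) list"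
      assume "poly.weakly_regular n (face_ideal n L.\<Delta>) fs" "set fs \<subseteq> face_ideal n {{}}"
      then show "length fs \<le> 4" using L.length_le_facet[of fs] * i j by simp
    qed
    then show ?thesis by (simp add: numeral_eq_enat)
  qed
  have d: "depth S \<mm> (quot_module S I) = 3"
    if na: "\<not> v \<le> mon3 (i2 - 1) (i3 - 1) n"
      and nbc: "j1 = 2 \<Longrightarrow> j2 = 3 \<Longrightarrow> j3 < n \<Longrightarrow> i2 = 3 \<or> i2 = 4 \<and> i3 - 1 \<le> j3"
  proof -
    \<comment> \<open>For \<open>i2 = 2\<close> the monomial in the first case is divisible by \<open>x\<^sub>1\<close>, so it exceeds \<open>v\<close>.\<close>
    have i2: "3 \<le> i2"
    proof (rule ccontr)
      assume "\<not> 3 \<le> i2"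
      then have "i2 = 2" using i by simp
      then have "L.seg (i2 - 1) (i3 - 1) n" using j by (simp add: L.seg_def)
      then show False using na seg by simp
    qed
    have "depth S \<mm> (quot_module S I) = enat 3"
    proof (rule depth)
      show "shelled 3 L.\<Delta>" using L.shelled_3[OF i2] na seg by blast
      fix fs :: "((nat \<Rightarrow>\<^sub>0 nat) \<Rightarrow>\<^sub>0 'k) list"
      assume fs: "poly.weakly_regular n (face_ideal n L.\<Delta>) fs" "set fs \<subseteq> face_ideal n {{}}"
      consider "\<not> (j1 = 2 \<and> j2 = 3 \<and> j3 < n)" | "i2 = 3" | "j1 = 2" "j2 = 3" "i2 = 4" "i3 - 1 \<le> j3"
        using nbc by blast
      then show "length fs \<le> 3"
        using L.length_le_3_123[OF fs i2] L.length_le_3_12n[OF fs] L.length_le_3_link12[OF fs]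
        by cases blast+
    qed
    then show ?thesis by (simp add: numeral_eq_enat)
  qed
  have b: "depth S \<mm> (quot_module S I) = 4"
    if "(i2 = 4 \<and> i3 \<ge> 6 \<and> j1 = 2 \<and> j2 = 3 \<and> j3 < i3 - 1) \<or>
      (i2 \<ge> 5 \<and> j1 = 2 \<and> j2 = 3 \<and> i2 - 1 \<le> j3 \<and> j3 \<le> n - 1)"
    using that
  proof
    assume *: "i2 \<ge> 5 \<and> j1 = 2 \<and> j2 = 3 \<and> i2 - 1 \<le> j3 \<and> j3 \<le> n - 1"
    then have "i2 - 1 - j3 = 0" "j3 < n" using i by auto
    then show ?thesis using bc * by (simp add: numeral_eq_enat)
  qed (use b4 in blast)
  have c: "depth S \<mm> (quot_module S I) = enat (i2 - j3 + 3)"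
    if *: "i2 > 4 \<and> j1 = 2 \<and> j2 = 3 \<and> j3 \<le> i2 - 1"
  proof -
    have "i2 - 1 - j3 + 4 = i2 - j3 + 3" "j3 < n" using * i by auto
    then show ?thesis using bc * by simp
  qed
  have cases: "i2 = 3 \<or> i2 = 4 \<and> i3 - 1 \<le> j3"
    if "\<not> ((i2 = 4 \<and> i3 \<ge> 6 \<and> j1 = 2 \<and> j2 = 3 \<and> j3 < i3 - 1) \<or>
         (i2 \<ge> 5 \<and> j1 = 2 \<and> j2 = 3 \<and> i2 - 1 \<le> j3 \<and> j3 \<le> n - 1))"
      "\<not> (i2 > 4 \<and> j1 = 2 \<and> j2 = 3 \<and> j3 \<le> i2 - 1)" "i2 \<noteq> 2" "j1 = 2" "j2 = 3" "j3 < n"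
    using that i j by linarith
  have i2: "i2 \<noteq> 2" if "\<not> v \<le> mon3 (i2 - 1) (i3 - 1) n"
    using that seg j by (auto simp: L.seg_def)
  show ?thesis
  proof (intro conjI impI)
    assume *: "\<not> v \<le> mon3 (i2 - 1) (i3 - 1) n \<and>
      \<not> ((i2 = 4 \<and> i3 \<ge> 6 \<and> j1 = 2 \<and> j2 = 3 \<and> j3 < i3 - 1) \<or>
         (i2 \<ge> 5 \<and> j1 = 2 \<and> j2 = 3 \<and> i2 - 1 \<le> j3 \<and> j3 \<le> n - 1)) \<and>
      \<not> (i2 > 4 \<and> j1 = 2 \<and> j2 = 3 \<and> j3 \<le> i2 - 1)"
    show "depth S \<mm> (quot_module S I) = 3"
    proof (rule d)
      show "i2 = 3 \<or> i2 = 4 \<and> i3 - 1 \<le> j3" if "j1 = 2" "j2 = 3" "j3 < n"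
        using cases[OF _ _ i2 that] * by blast
    qed (use * in blast)
  qed (fact a b c)+
qed

end
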